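(* Let $\kappa$ be a regular uncountable cardinal, $\nu<\kappa$ a regular cardinal, $\eta$ a cardinal such that $\lambda^{<\eta}<\kappa$ for all $\lambda<\kappa$, and let $U\subseteq{}^{<\kappa}\kappa$ be a downward-closed $\kappa$-tree that is $\mathrm{P}^-_{14}(\kappa,\sqsubseteq_\nu,\kappa,\{E^\kappa_{\ge\eta}\})$-respecting. Let $\chi=\min\{\eta,\nu\}$. If $\diamondsuit(\kappa)$ holds, then for every infinite cardinal $\theta<\kappa$ there exists a downward-closed $T\subseteq{}^{<\kappa}\kappa$ which is a prolific $\chi$-free $\eta$-complete $\kappa$-Souslin tree admitting an injective $(\mathcal F^\nu_\theta,U)$-ascent path.
   Context: Downward-closed subsets of ${}^{<\kappa}\kappa$ are ordered by $\subsetneq$, height $=\mathrm{dom}$, $T_\alpha=T\cap{}^\alpha\kappa$, and $T\restriction Y=\{t\in T\mid\mathrm{dom}(t)\in Y\}$. Prolific: $x^\frown\langle i\rangle\in T$ for $x\in T_\alpha$, $i<\max\{\omega,\alpha\}$. $\eta$-complete: every increasing sequence of length $<\eta$ has an upper bound. $\kappa$-tree: height $\kappa$, levels of size $<\kappa$; $\kappa$-Souslin: no cofinal branch, no antichain of size $\kappa$. Derived tree: for nonzero $\tau$, $\beta<\kappa$, distinct $\langle w_i\mid i<\tau\rangle\in{}^\tau T_\beta$, $\bigotimes_{i<\tau}w_i^\uparrow$ is the set of $f:\tau\to T$ with $\mathrm{dom}\circ f$ constant and each $f(i)$ compatible with $w_i$, ordered coordinatewise; $T$ is $\chi$-free if all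 such derived trees with $0<\tau<\chi$ are $\kappa$-Souslin. $\mathcal F^\nu_\theta=\{Z\subseteq\theta\mid|\theta\setminus Z|<\nu\}$. An $(\mathcal F,U)$-ascent path through $T$ is $\langle f_u\mid u\in U\rangle$ with $f_u:\bigcup\mathcal F\to T_{\mathrm{dom}(u)}$, $\{i\mid f_u(i)\subsetneq f_v(i)\}\in\mathcal F$ for $u\subsetneq v$, $\{i\mid f_u(i)\ne f_v(i)\}\in\mathcal F$ for distinct $u,v\in U$ of equal domain; injective if for every $b:\kappa\to\kappa$ with all $b\restriction\alpha\in U$ there are $\alpha<\kappa$, $I\in\mathcal F$ with $f_{b\restriction\alpha}\restriction I$ injective. Proxy principle: $\mathrm{acc}(D)=\{\alpha\in D\mid\sup(D\cap\alpha)=\alpha>0\}$, $\mathrm{nacc}(D)=D\setminus\mathrm{acc}(D)$, $\mathrm{succ}_\omega(D)=\{\delta\in D\mid0<\mathrm{otp}(D\cap\delta)<\omega\}$, $E^\kappa_{\ge\eta}=\{\alpha<\kappa\mid\mathrm{cf}(\alpha)\ge\eta\}$; $D\sqsubseteq_\nu C$ iff $D=C\cap\beta$ for some $\beta$, or ($\mathrm{otp}(C)<\nu$ and $\mathrm{nacc}(C)$ consists of successor ordinals). $\mathrm{P}^-_{14}(\kappa,\mathcal R,\mu,\mathcal S)$ asserts the existence of $\langle C_\alpha\mid\alpha<\kappa\rangle$ with $C_\alpha$ club in $\alpha$ for limit $\alpha$, $C_{\bar\alpha}\mathrel{\mathcal R}C_\alpha$ for $\bar\alpha\in\mathrm{acc}(C_\alpha)$,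 and for every sequence $\langle A_i\mid i<\mu\rangle$ of cofinal subsets of $\kappa$ and $S\in\mathcal S$, stationarily many $\alpha\in S$ with $\sup\{\beta\in C_\alpha\mid\mathrm{succ}_\omega(C_\alpha\setminus\beta)\subseteq A_i\}=\alpha$ for all $i<\min\{\alpha,\mu\}$. A downward-closed $\kappa$-tree $U\subseteq{}^{<\kappa}\kappa$ is $\mathrm{P}^-_{14}(\kappa,\mathcal R,\mu,\mathcal S)$-respecting if there are $\tilde S\subseteq\kappa$, $\langle C_\alpha\mid\alpha<\kappa\rangle$ and maps $\mathbf b^\alpha:U\restriction C_\alpha\to{}^\alpha\kappa\cup\{\emptyset\}$ such that (1) $U_\alpha\subseteq\mathrm{range}(\mathbf b^\alpha)$ for $\alpha\in\tilde S$; (2) $\langle C_\alpha\rangle$ witnesses $\mathrm{P}^-_{14}(\kappa,\mathcal R,\mu,\{S\cap\tilde S\mid S\in\mathcal S\})$; (3) for all $\bar\alpha,\alpha<\kappa$, if $x\in U\restriction C_{\bar\alpha}$ and $C_\alpha\cap[\mathrm{dom}(x),\bar\alpha)=C_{\bar\alpha}\cap[\mathrm{dom}(x),\bar\alpha)$ then $\mathbf b^{\bar\alpha}(x)=\mathbf b^\alpha(x)\restriction\bar\alpha$. *)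

theory Defs
  imports Main "HOL-Library.FuncSet"
begin

unbundle cardinal_syntax

text \<open>Setting. The cardinal kappa is represented by a cardinal well-order r on a type 'k
(card_order r, so Field r = UNIV); the elements of 'k are the ordinals below kappa,
ordinal alpha corresponds to the set underS r alpha of its predecessors.
Nodes of the full tree of height kappa are partial maps 'k to 'k option whose domain
is an initial segment underS r alpha; tree order is strict map inclusion.\<close>

type_synonym 'k node = "'k \<Rightarrow> 'k option"

definition olt :: "'k rel \<Rightarrow> 'k \<Rightarrow> 'k \<Rightarrow> bool" where
  "olt r a b \<longleftrightarrow> (a, b) \<in> r \<and> a \<noteq> b"

definition is_sup :: "'k rel \<Rightarrow> 'k set \<Rightarrow> 'k \<Rightarrow> bool" where
  "is_sup r X a \<longleftrightarrow> (\<forall>x\<in>X. (x, a) \<in> r) \<and> (\<forall>y. (\<forall>x\<in>X. (x, y) \<in> r) \<longrightarrow> (a, y) \<in> r)"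

definition is_limit :: "'k rel \<Rightarrow> 'k \<Rightarrow> bool" where
  "is_limit r a \<longleftrightarrow> (\<exists>b. olt r b a) \<and> (\<forall>b. olt r b a \<longrightarrow> (\<exists>c. olt r b c \<and> olt r c a))"

definition is_successor :: "'k rel \<Rightarrow> 'k \<Rightarrow> bool" where
  "is_successor r a \<longleftrightarrow> (\<exists>b. olt r b a \<and> \<not> (\<exists>c. olt r b c \<and> olt r c a))"

definition is_cardinal :: "'k rel \<Rightarrow> 'k \<Rightarrow> bool" where
  "is_cardinal r a \<longleftrightarrow> (\<forall>b. olt r b a \<longrightarrow> |underS r b| <o |underS r a| )"

definition cofinal_in :: "'k rel \<Rightarrow> 'k set \<Rightarrow> 'k \<Rightarrow> bool" where
  "cofinal_in r X a \<longleftrightarrow> X \<subseteq> underS r a \<and> (\<forall>b. olt r b a \<longrightarrow> (\<exists>x\<in>X. (b, x) \<in> r))"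

definition cf_ge :: "'k rel \<Rightarrow> 'k \<Rightarrow> 'k \<Rightarrow> bool" where
  "cf_ge r a e \<longleftrightarrow> (\<forall>X. cofinal_in r X a \<longrightarrow> \<not> (Restr r X <o Restr r (underS r e)))"

definition regular_cardinal :: "'k rel \<Rightarrow> 'k \<Rightarrow> bool" where
  "regular_cardinal r a \<longleftrightarrow> is_cardinal r a \<and> infinite (underS r a) \<and> cf_ge r a a"

definition E_ge :: "'k rel \<Rightarrow> 'k \<Rightarrow> 'k set" where
  "E_ge r e = {a. cf_ge r a e}"

text \<open>club subsets of Z, where Z is an initial segment (underS r alpha, or UNIV for kappa)\<close>
definition club_in :: "'k rel \<Rightarrow> 'k set \<Rightarrow> 'k set \<Rightarrow> bool" where
  "club_in r Z C \<longleftrightarrow> C \<subseteq> Z \<and> (\<forall>b\<in>Z. \<exists>c\<in>C. (b, c) \<in> r) \<and>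
     (\<forall>g\<in>Z. (\<exists>b. olt r b g) \<and> is_sup r (C \<inter> underS r g) g \<longrightarrow> g \<in> C)"

definition stationary :: "'k rel \<Rightarrow> 'k set \<Rightarrow> bool" where
  "stationary r S \<longleftrightarrow> (\<forall>C. club_in r UNIV C \<longrightarrow> S \<inter> C \<noteq> {})"

definition diamond :: "'k rel \<Rightarrow> bool" where
  "diamond r \<longleftrightarrow> (\<exists>A :: 'k \<Rightarrow> 'k set. (\<forall>a. A a \<subseteq> underS r a) \<and>
      (\<forall>Z. stationary r {a. Z \<inter> underS r a = A a}))"

definition acc :: "'k rel \<Rightarrow> 'k set \<Rightarrow> 'k set" where
  "acc r D = {a\<in>D. (\<exists>b. olt r b a) \<and> is_sup r (D \<inter> underS r a) a}"

definition nacc :: "'k rel \<Rightarrow> 'k set \<Rightarrow> 'k set" where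
  "nacc r D = D - acc r D"

definition succ_omega :: "'k rel \<Rightarrow> 'k set \<Rightarrow> 'k set" where
  "succ_omega r D = {d\<in>D. finite (D \<inter> underS r d) \<and> D \<inter> underS r d \<noteq> {}}"

definition sqleq :: "'k rel \<Rightarrow> 'k \<Rightarrow> 'k set \<Rightarrow> 'k set \<Rightarrow> bool" where
  "sqleq r nu D C \<longleftrightarrow> (D = C \<or> (\<exists>b. D = C \<inter> underS r b)) \<or>
     (Restr r C <o Restr r (underS r nu) \<and> (\<forall>a\<in>nacc r C. is_successor r a))"

definition P14_witness :: "'k rel \<Rightarrow> 'k \<Rightarrow> 'k set \<Rightarrow> ('k \<Rightarrow> 'k set) \<Rightarrow> bool" where
  "P14_witness r nu S C \<longleftrightarrow>
     (\<forall>a. C a \<subseteq> underS r a) \<and>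
     (\<forall>a. is_limit r a \<longrightarrow> club_in r (underS r a) (C a)) \<and>
     (\<forall>a. \<forall>a'\<in>acc r (C a). sqleq r nu (C a') (C a)) \<and>
     (\<forall>A :: 'k \<Rightarrow> 'k set. (\<forall>i. \<forall>b. \<exists>c\<in>A i. (b, c) \<in> r) \<longrightarrow>
        stationary r {a\<in>S. \<forall>i. olt r i a \<longrightarrow>
           is_sup r {b\<in>C a. succ_omega r {c\<in>C a. (b, c) \<in> r} \<subseteq> A i} a})"

definition seqs :: "'k rel \<Rightarrow> 'k node set" where
  "seqs r = {x. \<exists>a. dom x = underS r a}"

definition level :: "'k rel \<Rightarrow> 'k node set \<Rightarrow> 'k \<Rightarrow> 'k node set" where
  "level r T a = {x\<in>T. dom x = underS r a}"

definition restr_levels :: "'k rel \<Rightarrow> 'k node set \<Rightarrow> 'k set \<Rightarrow> 'k node set" where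
  "restr_levels r T Y = {x\<in>T. \<exists>a\<in>Y. dom x = underS r a}"

definition sless :: "'k node \<Rightarrow> 'k node \<Rightarrow> bool" where
  "sless x y \<longleftrightarrow> x \<subseteq>\<^sub>m y \<and> x \<noteq> y"

definition down_closed :: "'k rel \<Rightarrow> 'k node set \<Rightarrow> bool" where
  "down_closed r T \<longleftrightarrow> T \<subseteq> seqs r \<and> (\<forall>y\<in>T. \<forall>x\<in>seqs r. x \<subseteq>\<^sub>m y \<longrightarrow> x \<in> T)"

text \<open>Generic notions for a tree given by a carrier X, a strict order less and a level
predicate L (L x a: x lies on level a).\<close>
definition kappa_tree_gen :: "'k rel \<Rightarrow> 'x set \<Rightarrow> ('x \<Rightarrow> 'k \<Rightarrow> bool) \<Rightarrow> bool" where
  "kappa_tree_gen r X L \<longleftrightarrow> (\<forall>a. {x\<in>X. L x a} \<noteq> {} \<and> |{x\<in>X. L x a}| <o r)"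

definition kappa_souslin_gen :: "'k rel \<Rightarrow> 'x set \<Rightarrow> ('x \<Rightarrow> 'x \<Rightarrow> bool) \<Rightarrow> ('x \<Rightarrow> 'k \<Rightarrow> bool) \<Rightarrow> bool" where
  "kappa_souslin_gen r X lt L \<longleftrightarrow> kappa_tree_gen r X L \<and>
     \<not> (\<exists>B\<subseteq>X. (\<forall>x\<in>B. \<forall>y\<in>B. x = y \<or> lt x y \<or> lt y x) \<and> (\<forall>a. \<exists>x\<in>B. L x a)) \<and>
     \<not> (\<exists>A\<subseteq>X. (\<forall>x\<in>A. \<forall>y\<in>A. x \<noteq> y \<longrightarrow> \<not> lt x y \<and> \<not> lt y x) \<and> |A| =o r)"

definition kappa_tree :: "'k rel \<Rightarrow> 'k node set \<Rightarrow> bool" where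
  "kappa_tree r T \<longleftrightarrow> kappa_tree_gen r T (\<lambda>x a. dom x = underS r a)"

definition kappa_souslin :: "'k rel \<Rightarrow> 'k node set \<Rightarrow> bool" where
  "kappa_souslin r T \<longleftrightarrow> kappa_souslin_gen r T sless (\<lambda>x a. dom x = underS r a)"

text \<open>prolific: i < max(omega, alpha) iff i is a finite ordinal or i < alpha\<close>
definition prolific :: "'k rel \<Rightarrow> 'k node set \<Rightarrow> bool" where
  "prolific r T \<longleftrightarrow> (\<forall>a. \<forall>x\<in>level r T a. \<forall>i.
      finite (underS r i) \<or> olt r i a \<longrightarrow> x(a \<mapsto> i) \<in> T)"

definition eta_complete :: "'k rel \<Rightarrow> 'k \<Rightarrow> 'k node set \<Rightarrow> bool" where
  "eta_complete r e T \<longleftrightarrow> (\<forall>d (s :: 'k \<Rightarrow> 'k node). olt r d e \<and>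
      (\<forall>i\<in>underS r d. s i \<in> T) \<and> (\<forall>i\<in>underS r d. \<forall>j\<in>underS r d. olt r i j \<longrightarrow> sless (s i) (s j))
      \<longrightarrow> (\<exists>t\<in>T. \<forall>i\<in>underS r d. s i \<subseteq>\<^sub>m t))"

definition derived_tree :: "'k rel \<Rightarrow> 'k node set \<Rightarrow> 'k \<Rightarrow> ('k \<Rightarrow> 'k node) \<Rightarrow> ('k \<Rightarrow> 'k node) set" where
  "derived_tree r T tau w = {f. (\<forall>i. i \<notin> underS r tau \<longrightarrow> f i = Map.empty) \<and>
      (\<exists>a. \<forall>i\<in>underS r tau. f i \<in> T \<and> dom (f i) = underS r a) \<and>
      (\<forall>i\<in>underS r tau. f i \<subseteq>\<^sub>m w i \<or> w i \<subseteq>\<^sub>m f i)}"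

definition derived_less :: "'k rel \<Rightarrow> 'k \<Rightarrow> ('k \<Rightarrow> 'k node) \<Rightarrow> ('k \<Rightarrow> 'k node) \<Rightarrow> bool" where
  "derived_less r tau f g \<longleftrightarrow> (\<forall>i\<in>underS r tau. sless (f i) (g i))"

definition derived_level :: "'k rel \<Rightarrow> 'k \<Rightarrow> ('k \<Rightarrow> 'k node) \<Rightarrow> 'k \<Rightarrow> bool" where
  "derived_level r tau f a \<longleftrightarrow> (\<forall>i\<in>underS r tau. dom (f i) = underS r a)"

definition chi_free :: "'k rel \<Rightarrow> ('k \<Rightarrow> bool) \<Rightarrow> 'k node set \<Rightarrow> bool" where
  "chi_free r below_chi T \<longleftrightarrow> (\<forall>tau b (w :: 'k \<Rightarrow> 'k node).
      (\<exists>c. olt r c tau) \<and> below_chi tau \<and>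
      (\<forall>i\<in>underS r tau. w i \<in> level r T b) \<and> inj_on w (underS r tau)
      \<longrightarrow> kappa_souslin_gen r (derived_tree r T tau w) (derived_less r tau) (derived_level r tau))"

definition filt :: "'k rel \<Rightarrow> 'k \<Rightarrow> 'k \<Rightarrow> 'k set set" where
  "filt r nu th = {Z. Z \<subseteq> underS r th \<and> |underS r th - Z| <o |underS r nu| }"

definition branch_restr :: "'k rel \<Rightarrow> ('k \<Rightarrow> 'k) \<Rightarrow> 'k \<Rightarrow> 'k node" where
  "branch_restr r b a = (\<lambda>c. if olt r c a then Some (b c) else None)"

definition ascent_path :: "'k rel \<Rightarrow> 'k \<Rightarrow> 'k \<Rightarrow> 'k node set \<Rightarrow> 'k node set \<Rightarrow> ('k node \<Rightarrow> 'k \<Rightarrow> 'k node) \<Rightarrow> bool" where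
  "ascent_path r nu th U T f \<longleftrightarrow>
     (\<forall>u\<in>U. \<forall>i\<in>underS r th. f u i \<in> T \<and> dom (f u i) = dom u) \<and>
     (\<forall>u\<in>U. \<forall>v\<in>U. sless u v \<longrightarrow> {i\<in>underS r th. sless (f u i) (f v i)} \<in> filt r nu th) \<and>
     (\<forall>u\<in>U. \<forall>v\<in>U. u \<noteq> v \<and> dom u = dom v \<longrightarrow> {i\<in>underS r th. f u i \<noteq> f v i} \<in> filt r nu th)"

definition injective_ascent_path :: "'k rel \<Rightarrow> 'k \<Rightarrow> 'k \<Rightarrow> 'k node set \<Rightarrow> 'k node set \<Rightarrow> ('k node \<Rightarrow> 'k \<Rightarrow> 'k node) \<Rightarrow> bool" where
  "injective_ascent_path r nu th U T f \<longleftrightarrow> ascent_path r nu th U T f \<and>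
     (\<forall>b :: 'k \<Rightarrow> 'k. (\<forall>a. branch_restr r b a \<in> U) \<longrightarrow>
        (\<exists>a. \<exists>I\<in>filt r nu th. inj_on (f (branch_restr r b a)) I))"

definition respecting :: "'k rel \<Rightarrow> 'k \<Rightarrow> 'k \<Rightarrow> 'k node set \<Rightarrow> bool" where
  "respecting r nu e U \<longleftrightarrow> (\<exists>(St :: 'k set) (C :: 'k \<Rightarrow> 'k set) (bb :: 'k \<Rightarrow> 'k node \<Rightarrow> 'k node).
     (\<forall>a. \<forall>x\<in>restr_levels r U (C a). bb a x = Map.empty \<or> dom (bb a x) = underS r a) \<and>
     (\<forall>a\<in>St. level r U a \<subseteq> bb a ` restr_levels r U (C a)) \<and>
     P14_witness r nu (E_ge r e \<inter> St) C \<and>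
     (\<forall>a' a. \<forall>x\<in>restr_levels r U (C a').
        C a \<inter> (underS r a' - dom x) = C a' \<inter> (underS r a' - dom x) \<longrightarrow>
        bb a' x = (bb a x |` underS r a')))"

end

theory Submission
  imports Defs
begin

text \<open>Every node x of the tree carries its own ascent path: by recursion on the level g one
builds nodes F g v x i (v on level g of U, i below a cardinal that is at least nu), all extending x for
all but fewer than nu many i and increasing in v modulo fewer than nu many i. At a limit level g
whose club C g coheres with its initial segments, F g v x is the limit of a process running along C g,
which follows the earlier paths except for fewer than nu many i at each step, the exceptions being
moved into guessed dense sets. At the remaining limit levels C g has fewer than nu elements, so
the limits of the earlier paths exist for almost all i, since nu is regular. The nodes y of U with
branches b(y) serve as bounded names for the nodes of U at limit levels, so that all tuples of
nodes on a level which guesses correctly are sealed simultaneously.\<close>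

section \<open>Ordinals below a regular uncountable cardinal\<close>

text \<open>The obstacle is that every step along a long club may spoil fewer than nu indices, and
  these losses must not add up. They are reset at each accumulation point of a coherent club, since
  the path at that point is by definition the limit of the very process that is running. The two
  bounds on the length tau of a tuple act in different places. From tau < nu it follows that one
  sealing step moves fewer than nu indices. From tau < eta it follows that, at a level \<alpha> of
  cofinality at least eta, the names of all coordinates of a tuple lie below one bound d0 <
  \<alpha>. Such a tuple of names is a task; there are few tasks below d0, so if \<alpha> is closed
  enough the task is enumerated by some n < \<alpha>. This is why the proxy principle is used with
  kappa many cofinal sets: the set A n collects the levels at which task number n and the dense set
  are guessed together, and C \<alpha> meets A n beyond d0 for every n < \<alpha>.\<close>

locale kappa_order =
  fixes r :: "'k rel"
  assumes co: "card_order r" and reg: "regularCard r" and unc: "natLeq <o r"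
begin

abbreviation lt (infix "\<prec>" 50) where "a \<prec> b \<equiv> olt r a b"
abbreviation le (infix "\<preceq>" 50) where "a \<preceq> b \<equiv> (a, b) \<in> r"
abbreviation dn where "dn \<equiv> underS r"
abbreviation small where "small X \<equiv> |X| <o r"

lemma well_r: "well_order_on UNIV r"
  using co by (simp add: card_order_on_def)

text \<open>Opens the library facts on wellorders to the relation \<open>r\<close>, which is not the
  order of a class instance on the type.\<close>

lemma wellorder_r: "class.wellorder (\<lambda>a b. a \<preceq> b) (olt r)"
proof
  have lin: "linear_order_on UNIV r" and wf: "wf (r - Id)"
    using well_r by (auto simp: well_order_on_def)
  have refl: "refl r" and tr: "trans r" and anti: "antisym r" and tot: "total r"
    using lin by (auto simp: linear_order_on_def partial_order_on_def preorder_on_def)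
  show "x \<preceq> x" for x using refl by (auto simp: refl_on_def)
  show "x \<preceq> y \<Longrightarrow> y \<preceq> z \<Longrightarrow> x \<preceq> z" for x y z using tr by (rule transD)
  show "x \<preceq> y \<Longrightarrow> y \<preceq> x \<Longrightarrow> x = y" for x y using anti by (rule antisymD)
  show "x \<prec> y \<longleftrightarrow> x \<preceq> y \<and> \<not> y \<preceq> x" for x y
    using anti refl by (auto simp: olt_def antisym_def refl_on_def)
  show "x \<preceq> y \<or> y \<preceq> x" for x y
    using tot refl by (cases "x = y") (auto simp: total_on_def refl_on_def)
  show "P a" if *: "\<And>x. (\<And>y. y \<prec> x \<Longrightarrow> P y) \<Longrightarrow> P x" for P a
    using wf by (induction a rule: wf_induct_rule) (rule *, auto simp: olt_def)
qed

lemma preorder_r: "class.preorder (\<lambda>a b. a \<preceq> b) (olt r)"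
  and linorder_r: "class.linorder (\<lambda>a b. a \<preceq> b) (olt r)"
  using wellorder_r
  by (simp_all add: class.wellorder_def class.linorder_def class.order_def)

abbreviation least where "least P \<equiv> ord.Least (\<lambda>a b. a \<preceq> b) P"

lemmas wo_refl [simp] = preorder.order_refl[OF preorder_r]
lemmas wo_trans = preorder.order_trans[OF preorder_r]
lemma wo_antisym: "a \<preceq> b \<Longrightarrow> b \<preceq> a \<Longrightarrow> a = b"
  using well_r by (auto simp: well_order_on_def linear_order_on_def partial_order_on_def antisym_def)
lemmas wo_less_irrefl [simp] = preorder.less_irrefl[OF preorder_r]
lemmas wo_less_trans = preorder.less_trans[OF preorder_r]
lemmas wo_le_less_trans = preorder.le_less_trans[OF preorder_r]
lemmas wo_less_le_trans = preorder.less_le_trans[OF preorder_r]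
lemmas wo_less_imp_le = preorder.less_imp_le[OF preorder_r]
lemma wo_le_less: "a \<preceq> b \<longleftrightarrow> a \<prec> b \<or> a = b"
  by (auto simp: olt_def)
lemma wo_le_neq_trans: "a \<preceq> b \<Longrightarrow> a \<noteq> b \<Longrightarrow> a \<prec> b"
  by (auto simp: olt_def)
lemmas wo_not_le = linorder.not_le[OF linorder_r]
lemmas wo_not_less = linorder.not_less[OF linorder_r]
lemmas wo_leI = linorder.leI[OF linorder_r]
lemma wo_leD: "a \<preceq> b \<Longrightarrow> \<not> b \<prec> a"
  by (simp add: wo_not_less)
lemmas wo_linear = linorder.linear[OF linorder_r]
lemmas wo_less_induct = wellorder.less_induct[OF wellorder_r]
lemmas wo_LeastI = wellorder.LeastI[OF wellorder_r]
lemmas wo_Least_le = wellorder.Least_le[OF wellorder_r]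
lemmas wo_not_less_Least = wellorder.not_less_Least[OF wellorder_r]
lemmas wo_LeastI_ex = wellorder.LeastI_ex[OF wellorder_r]
lemmas wo_less_asym = preorder.less_asym[OF preorder_r]
lemmas wo_neq_iff = linorder.neq_iff[OF linorder_r]

lemma wf_lt: "wf {(a, b). a \<prec> b}"
proof -
  have "{(a, b). a \<prec> b} = r - Id" by (auto simp: olt_def)
  then show ?thesis using well_r by (simp add: well_order_on_def)
qed

lemma dn_iff [simp]: "k \<in> dn a \<longleftrightarrow> k \<prec> a"
  by (auto simp: underS_def olt_def)

lemma dn_subset [simp]: "dn a \<subseteq> dn b \<longleftrightarrow> a \<preceq> b"
  by (metis dn_iff subset_iff wo_less_le_trans wo_not_le wo_less_irrefl)

lemma dn_inj [simp]: "dn a = dn b \<longleftrightarrow> a = b"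
  by (metis dn_subset subset_refl wo_antisym)

lemma Field_r: "Field r = UNIV" using co by (rule Field_card_order)

lemma Card_r: "Card_order r" using co Field_r by simp

lemma inf_Field: "infinite (Field r)"
  by (metis Card_order_iff_ordLeq_card_of Card_r card_of_Field_ordIso infinite_iff_natLeq_ordLeq
      ordIso_symmetric ordLess_imp_ordLeq ordLess_ordIso_trans unc)

lemma Cinf: "Cinfinite r" using inf_Field Card_r by (simp add: cinfinite_def)

lemma stable_r: "stable r" using Card_r inf_Field reg by (rule regularCard_stable)

lemma small_dn [simp]: "small (dn a)"
  using card_of_underS[OF Card_r] Field_r by simp

lemma not_small_UNIV: "\<not> small (UNIV :: 'k set)"
  using card_of_Field_ordIso[OF Card_r] Field_r not_ordLess_ordIso by metis

lemma small_ordLeq: "|A| \<le>o |B| \<Longrightarrow> small B \<Longrightarrow> small A"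
  by (rule ordLeq_ordLess_trans)

lemma small_subset: "small B \<Longrightarrow> A \<subseteq> B \<Longrightarrow> small A"
  using small_ordLeq card_of_mono1 by blast

lemma small_image: "small A \<Longrightarrow> small (f ` A)"
  using small_ordLeq card_of_image by blast

lemma small_finite: "finite A \<Longrightarrow> small A"
  using finite_iff_ordLess_natLeq ordLess_transitive unc by blast

lemma small_countable: "small (range (f :: nat \<Rightarrow> _))"
proof -
  have "|UNIV :: nat set| <o r" using unc card_of_nat ordIso_ordLess_trans by blast
  then show ?thesis by (rule small_image)
qed

lemma small_UN: "small I \<Longrightarrow> (\<And>i. i \<in> I \<Longrightarrow> small (X i)) \<Longrightarrow> small (\<Union>i\<in>I. X i)"
  by (rule stable_UNION[OF stable_r])

lemma small_Un: "small A \<Longrightarrow> small B \<Longrightarrow> small (A \<union> B)"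
  by (rule Un_Cinfinite_bound_strict[OF _ _ Cinf])

lemma small_Sigma: "small A \<Longrightarrow> (\<And>a. a \<in> A \<Longrightarrow> small (B a)) \<Longrightarrow> small (Sigma A B)"
proof -
  assume "small A" "\<And>a. a \<in> A \<Longrightarrow> small (B a)"
  then have "small (\<Union>a\<in>A. Pair a ` B a)" by (intro small_UN small_image)
  moreover have "Sigma A B = (\<Union>a\<in>A. Pair a ` B a)" by auto
  ultimately show ?thesis by simp
qed

lemma small_inj_on: "inj_on f A \<Longrightarrow> f ` A \<subseteq> B \<Longrightarrow> small B \<Longrightarrow> small A"
  using card_of_ordLeqI small_ordLeq by (metis image_subset_iff)

text \<open>Regularity enters here: an unbounded X would cover kappa by the initial segments of its
  members, a small union of small sets.\<close>

lemma small_bdd: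
  assumes "small (X :: 'k set)"
  obtains a where "\<And>x. x \<in> X \<Longrightarrow> x \<prec> a"
proof -
  have "\<exists>a. \<forall>x\<in>X. x \<prec> a"
  proof (rule ccontr)
    assume *: "\<nexists>a. \<forall>x\<in>X. x \<prec> a"
    have "UNIV \<subseteq> (\<Union>x\<in>X. insert x (dn x))"
    proof
      fix a :: 'k
      from * obtain x where "x \<in> X" "a \<preceq> x" by (meson wo_not_le)
      then show "a \<in> (\<Union>x\<in>X. insert x (dn x))"
        by (auto simp: wo_le_less)
    qed
    moreover have "small (\<Union>x\<in>X. insert x (dn x))"
    proof (rule small_UN[OF assms])
      fix x show "small (insert x (dn x))"
        using small_Un[OF small_finite[of "{x}"] small_dn[of x]] by simp
    qed
    ultimately show False using small_subset not_small_UNIV by blast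
  qed
  then show thesis using that by blast
qed

lemma ex_gt: "\<exists>b. a \<prec> b"
  using small_bdd[OF small_finite[of "{a}"]] by blast

definition sc where "sc a = least (\<lambda>b. a \<prec> b)"

lemma lt_sc [simp]: "c \<prec> sc a \<longleftrightarrow> c \<preceq> a"
proof -
  have 1: "a \<prec> sc a" unfolding sc_def using ex_gt wo_LeastI_ex by metis
  have 2: "\<And>b. a \<prec> b \<Longrightarrow> sc a \<preceq> b" unfolding sc_def by (rule wo_Least_le)
  show ?thesis using 1 2 by (meson wo_leD wo_leI wo_le_less_trans)
qed

lemma sc_le [simp]: "sc a \<preceq> b \<longleftrightarrow> a \<prec> b"
  by (meson lt_sc wo_leD wo_leI)

lemma dn_sc: "dn (sc a) = insert a (dn a)"
  by (auto simp: wo_le_less)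

lemma sc_inj [simp]: "sc a = sc b \<longleftrightarrow> a = b"
  by (metis lt_sc wo_antisym wo_refl)

lemma is_successor_iff: "is_successor r g \<longleftrightarrow> (\<exists>b. g = sc b)"
proof -
  have "g = sc b" if "b \<prec> g" "\<nexists>c. b \<prec> c \<and> c \<prec> g" for b
    using that by (metis lt_sc sc_le wo_le_neq_trans wo_refl)
  moreover have "b \<prec> sc b \<and> (\<nexists>c. b \<prec> c \<and> c \<prec> sc b)" for b
    by (auto dest: wo_leD)
  ultimately show ?thesis unfolding is_successor_def by metis
qed

lemma is_limitD: "is_limit r g \<Longrightarrow> b \<prec> g \<Longrightarrow> sc b \<prec> g"
  unfolding is_limit_def by (metis sc_le wo_le_less_trans)

lemma limit_not_sc: "is_limit r g \<Longrightarrow> g \<noteq> sc b"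
  using is_limitD[of g b] by auto

lemma ord_cases:
  obtains (zero) "\<And>b. \<not> b \<prec> g" | (succ) b where "g = sc b" | (lim) "is_limit r g"
  unfolding is_limit_def by (metis is_successor_def is_successor_iff)

definition zr where "zr = least (\<lambda>_. True)"

lemma zr_le [simp]: "zr \<preceq> a" unfolding zr_def by (rule wo_Least_le) simp

lemma not_lt_zr [simp]: "\<not> a \<prec> zr" by (simp add: wo_not_less)

lemma dn_zr [simp]: "dn zr = {}" by auto

lemma limit_zr: "is_limit r g \<Longrightarrow> zr \<prec> g"
  unfolding is_limit_def by (metis wo_le_less_trans zr_le)

text \<open>Iterate a strictly increasing bound for f omega many times; uncountability keeps the
  iterates bounded, and their supremum is a limit closed under f.\<close>

lemma small_closed_ex:
  fixes f :: "'k \<Rightarrow> 'k"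
  obtains a where "b \<prec> a" "is_limit r a" "\<And>x. x \<prec> a \<Longrightarrow> f x \<prec> a"
proof -
  have "\<exists>h. \<forall>a. a \<prec> h a \<and> (\<forall>x. x \<preceq> a \<longrightarrow> f x \<prec> h a)"
  proof -
    have "\<exists>c. a \<prec> c \<and> (\<forall>x. x \<preceq> a \<longrightarrow> f x \<prec> c)" for a
    proof -
      have "small (insert a (f ` dn (sc a)))"
        using small_Un[OF small_finite[of "{a}"] small_image[OF small_dn]] by simp
      from small_bdd[OF this] obtain c where "\<And>x. x \<in> insert a (f ` dn (sc a)) \<Longrightarrow> x \<prec> c" by blast
      then show ?thesis by (intro exI[of _ c]) auto
    qed
    then show ?thesis by metis
  qed
  then obtain h where h: "\<And>a. a \<prec> h a" "\<And>a x. x \<preceq> a \<Longrightarrow> f x \<prec> h a" by blast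
  define s where "s n = (h ^^ n) (h b)" for n
  obtain c where c: "\<And>x. x \<in> range s \<Longrightarrow> x \<prec> c" using small_bdd[OF small_countable] by blast
  define a where "a = least (\<lambda>c. \<forall>n. s n \<prec> c)"
  have sa: "s n \<prec> a" for n
    using wo_LeastI[of "\<lambda>c. \<forall>n. s n \<prec> c" c] c unfolding a_def by blast
  have la: "\<exists>n. x \<preceq> s n" if "x \<prec> a" for x
    using wo_not_less_Least[OF that[unfolded a_def]] wo_leI by blast
  have ss: "h (s n) = s (Suc n)" for n by (simp add: s_def)
  show thesis
  proof
    show "b \<prec> a" using sa[of 0] h(1)[of b] by (simp add: s_def) (metis wo_less_trans)
    show "is_limit r a" unfolding is_limit_def
    proof (intro conjI allI impI)
      show "\<exists>b. b \<prec> a" using sa by blast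
      fix x assume "x \<prec> a"
      then obtain n where "x \<preceq> s n" using la by blast
      then have "x \<prec> s (Suc n)" using h(1)[of "s n"] ss by (metis wo_le_less_trans)
      then show "\<exists>c. x \<prec> c \<and> c \<prec> a" using sa by blast
    qed
    fix x assume "x \<prec> a"
    then obtain n where "x \<preceq> s n" using la by blast
    then have "f x \<prec> s (Suc n)" using h(2) ss by metis
    then show "f x \<prec> a" using sa wo_less_trans by blast
  qed
qed

lemma club_closed: "club_in r UNIV {a. b \<prec> a \<and> is_limit r a \<and> (\<forall>x. x \<prec> a \<longrightarrow> f x \<prec> a)}"
  (is "club_in r UNIV ?C")
  unfolding club_in_def
proof (intro conjI ballI impI)
  fix c :: 'k
  obtain a where "(if b \<preceq> c then c else b) \<prec> a" "is_limit r a" "\<And>x. x \<prec> a \<Longrightarrow> f x \<prec> a"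
    using small_closed_ex by blast
  moreover from this have "b \<prec> a" "c \<prec> a"
    by (auto split: if_splits intro: wo_le_less_trans dest: wo_less_trans wo_not_le[THEN iffD1])
  ultimately show "\<exists>a\<in>?C. c \<preceq> a"
    by (intro bexI[of _ a]) (auto intro: wo_less_imp_le)
next
  fix g assume *: "(\<exists>b. b \<prec> g) \<and> is_sup r (?C \<inter> dn g) g"
  have ex: "\<exists>c\<in>?C. x \<prec> c \<and> c \<prec> g" if "x \<prec> g" for x
  proof (rule ccontr)
    assume "\<not> ?thesis"
    then have "\<forall>c\<in>?C \<inter> dn g. c \<preceq> x" by (meson IntE dn_iff wo_not_less)
    then have "g \<preceq> x" using * unfolding is_sup_def by blast
    then show False using that by (simp add: wo_leD)
  qed
  from * ex have "b \<prec> g" by (blast intro: wo_less_trans)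
  moreover have "is_limit r g" unfolding is_limit_def using * ex by blast
  moreover have "f x \<prec> g" if "x \<prec> g" for x using ex[OF that] by (blast intro: wo_less_trans)
  ultimately show "g \<in> ?C" by blast
qed auto

text \<open>Closure points of f form a club. Guesses can thus be taken at limit levels closed under
  any prescribed function, which replaces elementary submodels in the argument.\<close>

lemma stationary_closed:
  assumes "stationary r S"
  obtains a where "a \<in> S" "b \<prec> a" "is_limit r a" "\<And>x. x \<prec> a \<Longrightarrow> f x \<prec> a"
  using assms club_closed[of b f] unfolding stationary_def by blast

text \<open>A level closed under \<open>g\<close> lies above the rank \<open>rho\<close> of every
  object that belongs to an index below the level.\<close>

lemma bounding_function:
  assumes "\<And>a. small (P a)"
  obtains g :: "'k \<Rightarrow> 'k" where "\<And>a x. x \<in> P a \<Longrightarrow> rho x \<prec> g a"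
proof -
  have "\<exists>c. \<forall>x\<in>P a. rho x \<prec> c" for a
    using small_bdd[OF small_image[OF assms, of rho]] by (metis imageI)
  then show thesis using that by metis
qed

lemma ex_pairing: "\<exists>pr :: 'k \<Rightarrow> 'k \<Rightarrow> 'k. \<forall>a b c d. pr a b = pr c d \<longrightarrow> a = c \<and> b = d"
proof -
  have "infinite (UNIV :: 'k set)" using inf_Field Field_r by simp
  then have "|(UNIV :: 'k set) \<times> (UNIV :: 'k set)| \<le>o |UNIV :: 'k set|"
    using card_of_Times_same_infinite ordIso_iff_ordLeq by blast
  then obtain f :: "'k \<times> 'k \<Rightarrow> 'k" where "inj f"
    using card_of_ordLeq[of "UNIV \<times> UNIV" "UNIV :: 'k set"] by (auto simp flip: UNIV_Times_UNIV)
  then show ?thesis by (intro exI[of _ "\<lambda>a b. f (a, b)"]) (auto dest: injD)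
qed

definition pr where "pr = (SOME p :: 'k \<Rightarrow> 'k \<Rightarrow> 'k. \<forall>a b c d. p a b = p c d \<longrightarrow> a = c \<and> b = d)"

lemma pr_inj [simp]: "pr a b = pr c d \<longleftrightarrow> a = c \<and> b = d"
  using someI_ex[OF ex_pairing] unfolding pr_def by blast

lemma small_finite_ords: "small {j. finite (dn j)}"
proof (rule small_inj_on)
  show "inj_on (\<lambda>j. card (dn j)) {j. finite (dn j)}"
  proof (rule inj_onI, rule ccontr)
    fix j k assume *: "j \<in> {j. finite (dn j)}" "k \<in> {j. finite (dn j)}" "card (dn j) = card (dn k)" "j \<noteq> k"
    have "dn j \<subseteq> dn k \<or> dn k \<subseteq> dn j" using wo_linear[of j k] by simp
    then have "dn j = dn k" using * card_subset_eq by (metis mem_Collect_eq)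
    then show False using * by simp
  qed
  show "small (range (\<lambda>n::nat. n))" by (rule small_countable)
qed simp

end

section \<open>The recursive construction\<close>

text \<open>The union of a chain of partial maps. For a chain the choice of z is immaterial, because
  its members agree wherever two of them are defined.\<close>

definition mU :: "('a \<rightharpoonup> 'b) set \<Rightarrow> ('a \<rightharpoonup> 'b)" where
  "mU S = (\<lambda>k. if \<exists>z\<in>S. k \<in> dom z then (SOME z. z \<in> S \<and> k \<in> dom z) k else None)"

lemma mU_chain:
  assumes "\<And>x y. x \<in> S \<Longrightarrow> y \<in> S \<Longrightarrow> x \<subseteq>\<^sub>m y \<or> y \<subseteq>\<^sub>m x"
  shows "z \<in> S \<Longrightarrow> z \<subseteq>\<^sub>m mU S" and "dom (mU S) = \<Union> (dom ` S)"
proof -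
  have *: "z k = mU S k" if z: "z \<in> S" "k \<in> dom z" for z k
  proof -
    let ?y = "SOME z. z \<in> S \<and> k \<in> dom z"
    have y: "?y \<in> S \<and> k \<in> dom ?y" by (rule someI[of _ z]) (simp add: z)
    have "z \<subseteq>\<^sub>m ?y \<or> ?y \<subseteq>\<^sub>m z" using y z by (intro assms) simp_all
    then have "z k = ?y k"
    proof
      assume "z \<subseteq>\<^sub>m ?y" then show ?thesis using z(2) unfolding map_le_def by blast
    next
      assume "?y \<subseteq>\<^sub>m z" then show ?thesis using y unfolding map_le_def by simp
    qed
    moreover have "\<exists>z\<in>S. k \<in> dom z" using z by blast
    ultimately show ?thesis unfolding mU_def by (simp only: if_True)
  qed
  then show "z \<in> S \<Longrightarrow> z \<subseteq>\<^sub>m mU S" by (simp add: map_le_def)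
  show "dom (mU S) = \<Union> (dom ` S)"
  proof (intro equalityI subsetI)
    fix k assume k: "k \<in> dom (mU S)"
    have "\<exists>z\<in>S. k \<in> dom z"
    proof (rule ccontr)
      assume "\<not> (\<exists>z\<in>S. k \<in> dom z)"
      then have "mU S k = None" unfolding mU_def by (simp only: if_False)
      then show False using k by (simp add: domIff)
    qed
    then show "k \<in> \<Union> (dom ` S)" by blast
  next
    fix k assume "k \<in> \<Union> (dom ` S)"
    then obtain z where z: "z \<in> S" "k \<in> dom z" by blast
    then show "k \<in> dom (mU S)" using *[OF z] by (simp add: domIff)
  qed
qed

lemma map_le_restrict:
  assumes "x \<subseteq>\<^sub>m y" "dom x = A"
  shows "y |` A = x"
proof
  fix k
  show "(y |` A) k = x k"
  proof (cases "k \<in> A")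
    case True
    then show ?thesis using assms by (simp add: map_le_def)
  next
    case False
    then have "x k = None" using assms(2) by (metis domIff)
    then show ?thesis using False by simp
  qed
qed

lemma map_le_dom_eq: "x \<subseteq>\<^sub>m y \<Longrightarrow> dom x = dom y \<Longrightarrow> x = y"
  by (rule map_le_antisym) (simp_all add: map_le_def)

lemma restrict_map_le: "x |` A \<subseteq>\<^sub>m x"
  by (simp add: map_le_def)

lemma map_le_comparable:
  assumes "x \<subseteq>\<^sub>m z" "y \<subseteq>\<^sub>m z" "dom x \<subseteq> dom y"
  shows "x \<subseteq>\<^sub>m y"
  unfolding map_le_def
proof
  fix k assume "k \<in> dom x"
  moreover from this have "k \<in> dom y" using assms(3) by blast
  ultimately show "x k = y k" using assms(1,2) by (simp add: map_le_def)
qed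

type_synonym 'k branches = "'k node \<Rightarrow> 'k node"
type_synonym 'k path = "'k node \<Rightarrow> 'k node \<Rightarrow> 'k \<Rightarrow> 'k node"

text \<open>The predicate es stands for the lengths below eta together with the finite ones. At level g the
task gt g (a sequence of triples (y, x, i), naming the path of index i above x along the branch b y)
and the family gD g are guesses; their correctness only matters for the locale souslin_setup below.\<close>

locale ascent_setup = kappa_order r for r :: "'k rel" +
  fixes nu th :: 'k and es :: "'k \<Rightarrow> bool" and U :: "'k node set"
    and C :: "'k \<Rightarrow> 'k set" and bb :: "'k \<Rightarrow> 'k branches"
    and gt :: "'k \<Rightarrow> 'k \<Rightarrow> ('k node \<times> 'k node \<times> 'k) option"
    and gD :: "'k \<Rightarrow> ('k \<Rightarrow> 'k node) set"
  assumes nu_reg: "regular_cardinal r nu"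
    and th_ge: "|dn nu| \<le>o |dn th|"
    and es_ex: "\<exists>t. es t"
    and es_pow: "\<And>l. small (SIGMA t:Collect es. dn t \<rightarrow>\<^sub>E dn l)"
    and U_down: "down_closed r U" and U_tree: "kappa_tree r U"
    and C_sub: "\<And>a. C a \<subseteq> dn a"
    and C_club: "\<And>a. is_limit r a \<Longrightarrow> club_in r (dn a) (C a)"
    and C_coh: "\<And>a a'. a' \<in> acc r (C a) \<Longrightarrow> sqleq r nu (C a') (C a)"
    and bb_coh: "\<And>a a' x. x \<in> restr_levels r U (C a') \<Longrightarrow>
        C a \<inter> (dn a' - dom x) = C a' \<inter> (dn a' - dom x) \<Longrightarrow> bb a' x = bb a x |` dn a'"
begin

abbreviation lv where "lv a \<equiv> level r U a"
abbreviation nusmall where "nusmall X \<equiv> |X| <o |dn nu|"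

text \<open>At limit levels where this fails, \<open>sqleq\<close> leaves only its second
  alternative: few points, and successor ordinals as non-accumulation points (see
  \<open>bad_sqleq\<close>).\<close>

definition good where "good g \<longleftrightarrow> (\<forall>a\<in>acc r (C g). C a = C g \<inter> dn a)"

text \<open>The limit levels at which completeness forces every branch into the tree. Level zero is
  included through the empty cofinal set.\<close>

definition cofs where
  "cofs g \<longleftrightarrow> (\<exists>t X. es t \<and> cofinal_in r X g \<and> |X| \<le>o |dn t| )"

text \<open>The point \<open>g\<close> itself is not asked to lie in c, so the notion depends only
  on the part of c below \<open>g\<close>.\<close>

definition pd where "pd c g d \<longleftrightarrow> d \<in> c \<and> d \<prec> g \<and> (\<forall>e\<in>c. e \<prec> g \<longrightarrow> e \<preceq> d)"

definition pc where "pc g = (THE b. g = sc b)"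

lemma pc_sc [simp]: "pc (sc b) = b" by (simp add: pc_def)

text \<open>The labels pr i (u b) make the path injective in i and separate the nodes of U on a level.\<close>

definition labels where
  "labels b = {j. finite (dn j) \<or> j \<prec> b} \<union> {pr i (the (u b)) |i u. i \<prec> th \<and> u \<in> lv (sc b)}"

text \<open>Stated by pairs of points of \<open>C g\<close>, so that at a bad level its failure is a
  union over fewer than nu many pairs.\<close>

definition incr :: "('k \<Rightarrow> 'k path) \<Rightarrow> 'k \<Rightarrow> 'k node \<Rightarrow> 'k node \<Rightarrow> 'k \<Rightarrow> bool" where
  "incr Fp g v x i \<longleftrightarrow> (\<forall>d\<in>C g. \<forall>e\<in>C g. d \<preceq> e \<and> dom x \<subseteq> dn d \<longrightarrow>
      Fp d (v |` dn d) x i \<subseteq>\<^sub>m Fp e (v |` dn e) x i)"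

text \<open>At bad levels every index has to produce a node of the tree. The exceptional indices,
  whose values form no chain, borrow the path of an index that works.\<close>

definition sel where
  "sel Fp g v x i = (if incr Fp g v x i then i else SOME j. j \<prec> th \<and> incr Fp g v x j)"

text \<open>The first case starts the path above x at x itself for all i at once. Almost coherence
  of the paths then makes every node extendable to all higher levels.\<close>

definition stepF :: "('k \<Rightarrow> 'k path) \<Rightarrow> ('k \<Rightarrow> 'k set \<Rightarrow> 'k branches \<Rightarrow> 'k path) \<Rightarrow> 'k \<Rightarrow> 'k path" where
  "stepF Fp Gp g v x i =
    (if dom x = dn g then x
     else if \<exists>b. g = sc b then (Fp (pc g) (v |` dn (pc g)) x i)(pc g \<mapsto> pr i (the (v (pc g))))
     else if good g then mU ((\<lambda>d. Gp d (C g) (bb g) (v |` dn d) x i) ` {d\<in>C g. dom x \<subseteq> dn d})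
     else mU ((\<lambda>d. Fp d (v |` dn d) x (sel Fp g v x i)) ` {d\<in>C g. dom x \<subseteq> dn d}))"

definition stepT :: "('k \<Rightarrow> 'k node set) \<Rightarrow> 'k path \<Rightarrow> 'k \<Rightarrow> 'k node set" where
  "stepT Tp Fg g =
    (if \<exists>b. g = sc b then {t(pc g \<mapsto> j) |t j. t \<in> Tp (pc g) \<and> j \<in> labels (pc g)}
     else if cofs g then {z. dom z = dn g \<and> (\<forall>b. b \<prec> g \<longrightarrow> z |` dn b \<in> Tp b)}
     else {Fg v x i |v x i. v \<in> lv g \<and> x \<in> (\<Union>b\<in>dn g. Tp b) \<and> i \<prec> th})"

text \<open>Guessed tuples that extend, on all coordinates of the task simultaneously, the values
  which the process has reached at d.\<close>

definition choices :: "('k \<Rightarrow> 'k node set) \<Rightarrow> 'k path \<Rightarrow> 'k \<Rightarrow> 'k branches \<Rightarrow> 'k \<Rightarrow> ('k \<Rightarrow> 'k node) set" where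
  "choices Tp Gd d b g = {z\<in>gD g. \<forall>j y x i. gt g j = Some (y, x, i) \<longrightarrow>
      z j \<in> (\<Union>a\<in>dn g. Tp a) \<and> Gd (b y |` dn d) x i \<subseteq>\<^sub>m z j}"

text \<open>The first condition limits the number of indices that a task disturbs. The second one
  restricts the task to branches on which coherent clubs agree, as \<open>G_cong\<close>
  requires.\<close>

definition active :: "'k set \<Rightarrow> 'k \<Rightarrow> bool" where
  "active c g \<longleftrightarrow> nusmall (dom (gt g)) \<and>
      (\<forall>j y x i. gt g j = Some (y, x, i) \<longrightarrow> y \<in> restr_levels r U (c \<inter> dn g))"

text \<open>The coordinate j of the task whose named path, cut at level \<open>g\<close>, is the
  path of index i above x along v.\<close>

definition index :: "'k branches \<Rightarrow> 'k \<Rightarrow> 'k node \<Rightarrow> 'k node \<Rightarrow> 'k \<Rightarrow> 'k \<Rightarrow> bool" where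
  "index b g v x i j \<longleftrightarrow> (\<exists>y. gt g j = Some (y, x, i) \<and> b y |` dn g = v)"

definition extn where "extn Tg t = (SOME e. e \<in> Tg \<and> t \<subseteq>\<^sub>m e)"

text \<open>The process along a club c: at a point with predecessor d in c it extends its value at d into
the guessed family if (v, x, i) is listed in the task, and otherwise follows F if possible. It uses
only the part of c up to g, hence the processes along coherent clubs agree.\<close>

definition stepG :: "('k \<Rightarrow> 'k node set) \<Rightarrow> ('k \<Rightarrow> 'k set \<Rightarrow> 'k branches \<Rightarrow> 'k path) \<Rightarrow>
    'k node set \<Rightarrow> 'k path \<Rightarrow> 'k \<Rightarrow> 'k set \<Rightarrow> 'k branches \<Rightarrow> 'k path" where
  "stepG Tp Gp Tg Fg g c b v x i =
    (if \<exists>d. pd c g d \<and> dom x \<subseteq> dn d then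
       let d = (SOME d. pd c g d); t = Gp d c b (v |` dn d) x i; Q = choices Tp (Gp d c b) d b g in
       if active c g \<and> Q \<noteq> {} \<and> (\<exists>j. index b g v x i j)
       then extn Tg ((SOME z. z \<in> Q) (SOME j. index b g v x i j))
       else if t \<subseteq>\<^sub>m Fg v x i then Fg v x i else extn Tg t
     else Fg v x i)"

text \<open>At one level the order matters: F comes first and uses G only below g, then T uses F at
  g, and G uses both. Thus a single recursion on levels defines the three families.\<close>

definition Psi where
  "Psi = wfrec {(a, b). a \<prec> b} (\<lambda>f g.
     let Tp = (\<lambda>d. fst (f d)); Fp = (\<lambda>d. fst (snd (f d))); Gp = (\<lambda>d. snd (snd (f d)));
         Fg = stepF Fp Gp g; Tg = stepT Tp Fg g
     in (Tg, Fg, stepG Tp Gp Tg Fg g))"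

definition T where "T g = fst (Psi g)"
definition F where "F g = fst (snd (Psi g))"
definition G where "G g = snd (snd (Psi g))"

lemma pd_unique: "pd c g d \<Longrightarrow> pd c g d' \<Longrightarrow> d = d'"
  unfolding pd_def by (meson wo_antisym)

lemma pd_some: "pd c g d \<Longrightarrow> (SOME d. pd c g d) = d"
  by (meson pd_unique someI)

text \<open>Together with the two rules that follow, this removes the cut in \<open>wfrec\<close>:
  each step reads the recursively defined families only at levels below g.\<close>

lemma stepF_cong:
  assumes "\<And>d. d \<prec> g \<Longrightarrow> Fp d = Fp' d" "\<And>d. d \<prec> g \<Longrightarrow> Gp d = Gp' d"
  shows "stepF Fp Gp g = stepF Fp' Gp' g"
proof (rule ext, rule ext, rule ext)
  fix v x i
  have [simp]: "d \<in> C g \<Longrightarrow> Fp d = Fp' d" "d \<in> C g \<Longrightarrow> Gp d = Gp' d" for d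
    using C_sub[of g] assms by auto
  have inc: "incr Fp g v x = incr Fp' g v x"
    unfolding incr_def by (intro ext) simp
  have s: "sel Fp g v x i = sel Fp' g v x i" by (simp add: sel_def inc)
  have p: "\<exists>b. g = sc b \<Longrightarrow> Fp (pc g) = Fp' (pc g)" using assms by auto
  show "stepF Fp Gp g v x i = stepF Fp' Gp' g v x i"
  proof -
    have m1: "(\<lambda>d. Gp d (C g) (bb g) (v |` dn d) x i) ` {d\<in>C g. dom x \<subseteq> dn d} =
        (\<lambda>d. Gp' d (C g) (bb g) (v |` dn d) x i) ` {d\<in>C g. dom x \<subseteq> dn d}"
      by (rule image_cong) simp_all
    have m2: "(\<lambda>d. Fp d (v |` dn d) x (sel Fp' g v x i)) ` {d\<in>C g. dom x \<subseteq> dn d} =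
        (\<lambda>d. Fp' d (v |` dn d) x (sel Fp' g v x i)) ` {d\<in>C g. dom x \<subseteq> dn d}"
      by (rule image_cong) simp_all
    show ?thesis unfolding stepF_def s m1 m2 using p by (simp cong: if_cong)
  qed
qed

lemma stepT_cong:
  assumes "\<And>d. d \<prec> g \<Longrightarrow> Tp d = Tp' d"
  shows "stepT Tp Fg g = stepT Tp' Fg g"
proof -
  have p: "\<exists>b. g = sc b \<Longrightarrow> Tp (pc g) = Tp' (pc g)" using assms by auto
  have u: "(\<Union>b\<in>dn g. Tp b) = (\<Union>b\<in>dn g. Tp' b)" using assms by auto
  have b: "{z. dom z = dn g \<and> (\<forall>b. b \<prec> g \<longrightarrow> z |` dn b \<in> Tp b)} =
      {z. dom z = dn g \<and> (\<forall>b. b \<prec> g \<longrightarrow> z |` dn b \<in> Tp' b)}"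
    using assms by (intro Collect_cong) simp
  show ?thesis unfolding stepT_def u b using p by (simp cong: if_cong)
qed

lemma stepG_cong:
  assumes "\<And>d. d \<prec> g \<Longrightarrow> Tp d = Tp' d" "\<And>d. d \<prec> g \<Longrightarrow> Gp d = Gp' d"
  shows "stepG Tp Gp Tg Fg g = stepG Tp' Gp' Tg Fg g"
proof (rule ext, rule ext, rule ext, rule ext, rule ext)
  fix c b v x i
  have u: "(\<Union>b\<in>dn g. Tp b) = (\<Union>b\<in>dn g. Tp' b)" using assms by auto
  show "stepG Tp Gp Tg Fg g c b v x i = stepG Tp' Gp' Tg Fg g c b v x i"
  proof (cases "\<exists>d. pd c g d \<and> dom x \<subseteq> dn d")
    case True
    then obtain d where d: "pd c g d" by blast
    then have "d \<prec> g" by (simp add: pd_def)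
    then have gg: "Gp d = Gp' d" by (rule assms)
    have ch: "choices Tp Gd d b g = choices Tp' Gd d b g" for Gd unfolding choices_def u by (rule refl)
    show ?thesis unfolding stepG_def Let_def pd_some[OF d] ch gg by (rule refl)
  next
    case False
    then show ?thesis unfolding stepG_def by (simp only: if_False)
  qed
qed

lemma Psi_eq: "Psi g = (T g, F g, G g)"
  by (simp add: T_def F_def G_def)

lemma TFG_eq:
  shows F_eq: "F g = stepF F G g" and T_eq: "T g = stepT T (F g) g"
    and G_eq: "G g = stepG T G (T g) (F g) g"
proof -
  let ?R = "{(a, b). a \<prec> b}"
  let ?f = "cut Psi ?R g"
  let ?T = "\<lambda>d. fst (?f d)" and ?F = "\<lambda>d. fst (snd (?f d))" and ?G = "\<lambda>d. snd (snd (?f d))"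
  have TT: "\<And>d. d \<prec> g \<Longrightarrow> ?T d = T d" and FF: "\<And>d. d \<prec> g \<Longrightarrow> ?F d = F d"
    and GG: "\<And>d. d \<prec> g \<Longrightarrow> ?G d = G d"
    by (simp_all add: cut_apply T_def F_def G_def)
  have *: "Psi g = (let Fg = stepF ?F ?G g; Tg = stepT ?T Fg g in (Tg, Fg, stepG ?T ?G Tg Fg g))"
    unfolding Psi_def by (subst wfrec[OF wf_lt]) (simp add: Let_def)
  have sF: "stepF ?F ?G g = stepF F G g" by (rule stepF_cong) (fact FF, fact GG)
  have sT: "stepT ?T Fg g = stepT T Fg g" for Fg by (rule stepT_cong) (fact TT)
  have sG: "stepG ?T ?G Tg Fg g = stepG T G Tg Fg g" for Tg Fg by (rule stepG_cong) (fact TT, fact GG)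
  note * = *[unfolded Let_def sF sT sG]
  show 1: "F g = stepF F G g" using * by (simp add: Psi_eq)
  then show 2: "T g = stepT T (F g) g" using * by (simp add: Psi_eq)
  show "G g = stepG T G (T g) (F g) g" using * 1 2 by (simp add: Psi_eq)
qed

end

section \<open>Order types versus cardinalities, and accumulation points of clubs\<close>

context kappa_order
begin

lemma Field_Restr [simp]: "Field (Restr r X) = X"
proof -
  have "refl r" using well_r
    by (simp add: well_order_on_def linear_order_on_def partial_order_on_def preorder_on_def)
  then have "X \<subseteq> Domain (Restr r X)" by (intro subsetI DomainI) (auto simp: refl_on_def)
  then show ?thesis by (auto simp: Field_def)
qed

lemma Well_Restr: "Well_order (Restr r X)"
  using Well_order_Restr[of r X] well_r Field_r by simp

lemma well_on_Restr: "well_order_on X (Restr r X)"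
  using Well_Restr[of X] by simp

lemma Card_Restr:
  assumes "is_cardinal r e"
  shows "Card_order (Restr r (dn e))"
proof -
  let ?s = "Restr r (dn e)"
  have "Restr ?s (underS ?s a) <o |Field ?s|" if a: "a \<in> Field ?s" for a
  proof -
    have ae: "a \<prec> e" using a by simp
    have "underS ?s a = dn a"
      using ae by (auto simp: underS_def olt_def intro: wo_trans wo_antisym)
    then have eq: "Restr ?s (underS ?s a) = Restr r (dn a)"
      using ae by (auto intro: wo_less_trans)
    have "|dn a| <o |dn e|" using assms ae by (simp add: is_cardinal_def)
    moreover have "|dn e| \<le>o |dn a|" if "|dn e| \<le>o Restr r (dn a)"
      using card_of_mono2[OF that] by (simp add: Field_card_of)
    ultimately have "\<not> |dn e| \<le>o Restr r (dn a)" using not_ordLess_ordLeq by blast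
    then have "Restr r (dn a) <o |dn e|"
      using not_ordLeq_iff_ordLess[OF Well_Restr card_of_Well_order] by blast
    then show ?thesis by (simp add: eq)
  qed
  then show ?thesis using Card_order_iff_Restr_underS[OF Well_Restr] by blast
qed

lemma Restr_dn_iso: "is_cardinal r e \<Longrightarrow> |dn e| =o Restr r (dn e)"
  using card_of_Field_ordIso[OF Card_Restr, of e] by simp

text \<open>Cofinality and \<open>sqleq\<close> are formulated by order types. Against a cardinal
  these comparisons reduce to cardinalities, which is how they are used from here on.\<close>

lemma Restr_less_iff:
  assumes "is_cardinal r e"
  shows "Restr r X <o Restr r (dn e) \<longleftrightarrow> |X| <o |dn e|"
proof
  assume "Restr r X <o Restr r (dn e)"
  then have "|X| <o Restr r (dn e)" using card_of_least[OF well_on_Restr] ordLeq_ordLess_trans by blast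
  then show "|X| <o |dn e|" using Restr_dn_iso[OF assms] ordIso_symmetric ordLess_ordIso_trans by blast
next
  assume a: "|X| <o |dn e|"
  have "|dn e| \<le>o |X|" if "Restr r (dn e) \<le>o Restr r X"
    using card_of_mono2[OF that] by simp
  then have "\<not> Restr r (dn e) \<le>o Restr r X" using a not_ordLess_ordLeq by blast
  then show "Restr r X <o Restr r (dn e)"
    using not_ordLeq_iff_ordLess[OF Well_Restr Well_Restr] by blast
qed

text \<open>Used for nu: a union of fewer than nu exceptional sets, each with fewer than nu
  elements, is again such a set.\<close>

lemma stable_regular:
  assumes "regular_cardinal r e"
  shows "stable |dn e|"
proof -
  let ?s = "Restr r (dn e)"
  have c: "is_cardinal r e" and inf: "infinite (dn e)" and cf: "cf_ge r e e"
    using assms by (auto simp: regular_cardinal_def)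
  have "regularCard ?s" unfolding regularCard_def
  proof (intro allI impI)
    fix K assume K: "K \<subseteq> Field ?s \<and> cofinal K ?s"
    have "cofinal_in r K e" unfolding cofinal_in_def
    proof (intro conjI allI impI)
      show "K \<subseteq> dn e" using K by simp
      fix b assume "b \<prec> e"
      then have "\<exists>k\<in>K. b \<noteq> k \<and> (b, k) \<in> ?s" using K unfolding cofinal_def Field_Restr by simp
      then show "\<exists>x\<in>K. b \<preceq> x" by blast
    qed
    then have "\<not> |K| <o |dn e|" using cf Restr_less_iff[OF c] by (auto simp: cf_ge_def)
    then have "|dn e| \<le>o |K|"
      using not_ordLess_iff_ordLeq[OF card_of_Well_order card_of_Well_order] by blast
    moreover have "|K| \<le>o |dn e|" using K by (intro card_of_mono1) simp
    ultimately have "|K| =o |dn e|" by (simp add: ordIso_iff_ordLeq)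
    then show "|K| =o ?s" using Restr_dn_iso[OF c] ordIso_transitive by blast
  qed
  then have "stable ?s" using regularCard_stable[OF Card_Restr[OF c]] inf by simp
  then show ?thesis using stable_ordIso1 Restr_dn_iso[OF c] by blast
qed

lemma dom_restrict_dn: "dom v = dn g \<Longrightarrow> d \<preceq> g \<Longrightarrow> dom (v |` dn d) = dn d"
  using dn_subset[of d g] by (simp add: dom_restrict Int_absorb1)

lemma restrict_dn [simp]: "d \<preceq> e \<Longrightarrow> (v |` dn e) |` dn d = v |` dn d"
  by (simp add: Int_absorb1)

lemma restrict_dn_dom [simp]: "dom v = dn g \<Longrightarrow> v |` dn g = v"
  by (rule map_le_restrict[OF map_le_refl])

lemma accD:
  assumes "d \<in> acc r c"
  shows "is_limit r d" "d \<in> c" "e \<prec> d \<Longrightarrow> \<exists>f\<in>c. e \<prec> f \<and> f \<prec> d"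
proof -
  have s: "is_sup r (c \<inter> dn d) d" and ex: "\<exists>b. b \<prec> d" and "d \<in> c"
    using assms by (auto simp: acc_def)
  then show "d \<in> c" by simp
  show 1: "\<exists>f\<in>c. e \<prec> f \<and> f \<prec> d" if e: "e \<prec> d" for e
  proof (rule ccontr)
    assume "\<not> ?thesis"
    then have "\<forall>f\<in>c \<inter> dn d. f \<preceq> e" by (meson IntE dn_iff wo_not_less)
    then have "d \<preceq> e" using s unfolding is_sup_def by blast
    then show False using e wo_leD by blast
  qed
  show "is_limit r d" unfolding is_limit_def using 1 ex by blast
qed

lemma accI:
  assumes "d \<in> c" "\<exists>b. b \<prec> d" "\<And>e. e \<prec> d \<Longrightarrow> \<exists>f\<in>c. e \<prec> f \<and> f \<prec> d"
  shows "d \<in> acc r c"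
proof -
  have "d \<preceq> y" if "\<forall>x\<in>c \<inter> dn d. x \<preceq> y" for y
  proof (rule wo_leI[rule_format])
    show "\<not> y \<prec> d" using assms(3)[of y] that wo_leD by (metis IntI dn_iff)
  qed
  then show ?thesis using assms(1,2) by (auto simp: acc_def is_sup_def intro: wo_less_imp_le)
qed

lemma acc_Int: "d \<in> acc r (c \<inter> dn a) \<Longrightarrow> d \<in> acc r c \<and> d \<prec> a"
  using accD[of d "c \<inter> dn a"] by (intro conjI accI) (auto simp: is_limit_def)

lemma acc_Int': "d \<in> acc r c \<Longrightarrow> d \<prec> a \<Longrightarrow> d \<in> acc r (c \<inter> dn a)"
  using accD[of d c] unfolding is_limit_def
  by (intro accI) (simp, blast, metis IntI dn_iff wo_less_trans)

lemma club_unbounded: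
  assumes "club_in r (dn g) c" "is_limit r g" "e \<prec> g"
  shows "\<exists>d\<in>c. e \<prec> d"
proof -
  have "sc e \<prec> g" using assms is_limitD by blast
  then have "\<exists>d\<in>c. sc e \<preceq> d" using assms(1) unfolding club_in_def dn_iff[symmetric] by blast
  then show ?thesis by simp
qed

text \<open>Let s be the supremum of the points of c below d. If none of them is largest and s < d,
  then s belongs to c by closure and would be a largest one; hence s = d and d is an accumulation
  point.\<close>

lemma club_cases:
  assumes c: "club_in r (dn g) c" and d: "d \<in> c"
  obtains (first) "\<And>e. e \<in> c \<Longrightarrow> d \<preceq> e" | (pred) e where "e \<in> c" "e \<prec> d" "\<And>f. f \<in> c \<Longrightarrow> f \<prec> d \<Longrightarrow> f \<preceq> e"
    | (acc) "d \<in> acc r c"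
proof (cases "\<exists>e\<in>c. e \<prec> d")
  case False
  then show ?thesis using first wo_not_less by blast
next
  case True
  then obtain e0 where e0: "e0 \<in> c" "e0 \<prec> d" by blast
  show ?thesis
  proof (cases "\<exists>e\<in>c. e \<prec> d \<and> (\<forall>f\<in>c. f \<prec> d \<longrightarrow> f \<preceq> e)")
    case True
    then show ?thesis using pred by blast
  next
    case False
    then have nm: "\<exists>f\<in>c. e \<prec> f \<and> f \<prec> d" if "e \<in> c" "e \<prec> d" for e
      using that wo_not_le by blast
    define s where "s = least (\<lambda>s. \<forall>f\<in>c. f \<prec> d \<longrightarrow> f \<preceq> s)"
    have s1: "f \<in> c \<Longrightarrow> f \<prec> d \<Longrightarrow> f \<preceq> s" for f
      using wo_LeastI[of "\<lambda>s. \<forall>f\<in>c. f \<prec> d \<longrightarrow> f \<preceq> s" d] wo_less_imp_le unfolding s_def by blast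
    have s2: "(\<forall>f\<in>c. f \<prec> d \<longrightarrow> f \<preceq> y) \<Longrightarrow> s \<preceq> y" for y
      unfolding s_def by (rule wo_Least_le)
    have sd: "s \<preceq> d" using s2 wo_less_imp_le by blast
    have s3: "f \<in> c \<Longrightarrow> f \<prec> d \<Longrightarrow> f \<prec> s" for f using nm[of f] s1 wo_less_le_trans by blast
    have "\<not> s \<prec> d"
    proof
      assume lt: "s \<prec> d"
      have "d \<prec> g" using c d by (auto simp: club_in_def)
      have "is_sup r (c \<inter> dn s) s" unfolding is_sup_def
      proof (intro conjI ballI allI impI)
        fix x assume "x \<in> c \<inter> dn s" then show "x \<preceq> s" by (auto intro: wo_less_imp_le)
      next
        fix y assume "\<forall>x\<in>c \<inter> dn s. x \<preceq> y"
        then show "s \<preceq> y" using s2 s3 by (metis IntI dn_iff)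
      qed
      moreover have "s \<in> dn g" using wo_less_trans[OF lt \<open>d \<prec> g\<close>] by simp
      moreover have "\<exists>b. b \<prec> s" using s3[OF e0] by blast
      ultimately have "s \<in> c" using c unfolding club_in_def by blast
      then show False using s3[of s] lt by simp
    qed
    then have sd: "s = d" using sd wo_le_less by blast
    have "d \<in> acc r c"
    proof (rule accI[OF d])
      show "\<exists>b. b \<prec> d" using e0 by blast
      fix e assume "e \<prec> d"
      then have "\<not> (\<forall>f\<in>c. f \<prec> d \<longrightarrow> f \<preceq> e)" using s2[of e] sd wo_leD by blast
      then show "\<exists>f\<in>c. e \<prec> f \<and> f \<prec> d" using wo_not_le by blast
    qed
    then show ?thesis by (rule acc)
  qed
qed

end

section \<open>Sets of fewer than nu indices, and single steps of the process\<close>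

context ascent_setup
begin

lemma inf_nu: "infinite (dn nu)" and card_nu: "is_cardinal r nu"
  using nu_reg by (auto simp: regular_cardinal_def)

lemma stable_nu: "stable |dn nu|" using nu_reg by (rule stable_regular)

lemma nusmall_UN: "nusmall I \<Longrightarrow> (\<And>i. i \<in> I \<Longrightarrow> nusmall (X i)) \<Longrightarrow> nusmall (\<Union>i\<in>I. X i)"
  by (rule stable_UNION[OF stable_nu])

lemma nusmall_finite:
  assumes "finite A"
  shows "nusmall A"
proof -
  have "|A| <o natLeq" using assms finite_iff_ordLess_natLeq[of A] by simp
  moreover have "natLeq \<le>o |dn nu|" using inf_nu infinite_iff_natLeq_ordLeq[of "dn nu"] by simp
  ultimately show ?thesis by (rule ordLess_ordLeq_trans)
qed

lemma nusmall_subset: "nusmall B \<Longrightarrow> A \<subseteq> B \<Longrightarrow> nusmall A"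
  by (rule ordLeq_ordLess_trans[OF card_of_mono1])

lemma nusmall_image: "nusmall B \<Longrightarrow> nusmall (f ` B)"
  by (rule ordLeq_ordLess_trans[OF card_of_image])

lemma nusmall_Un: "nusmall A \<Longrightarrow> nusmall B \<Longrightarrow> nusmall (A \<union> B)"
  by (rule card_of_Un_ordLess_infinite[OF inf_nu])

lemma nusmall_Times: "nusmall A \<Longrightarrow> nusmall B \<Longrightarrow> nusmall (A \<times> B)"
proof -
  assume "nusmall A" "nusmall B"
  then have "nusmall (\<Union>a\<in>A. Pair a ` B)" by (intro nusmall_UN nusmall_image)
  moreover have "A \<times> B = (\<Union>a\<in>A. Pair a ` B)" by auto
  ultimately show ?thesis by simp
qed

text \<open>This rests on th being at least nu: an exceptional set cannot exhaust all
  indices.\<close>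

lemma nusmall_missing:
  assumes "nusmall {i \<in> dn th. \<not> P i}"
  shows "\<exists>i. i \<prec> th \<and> P i"
proof (rule ccontr)
  assume "\<not> ?thesis"
  then have "{i \<in> dn th. \<not> P i} = dn th" by auto
  then show False using assms th_ge not_ordLess_ordLeq by auto
qed

lemma lv_dom: "v \<in> lv g \<Longrightarrow> dom v = dn g" and lv_U: "v \<in> lv g \<Longrightarrow> v \<in> U"
  by (auto simp: level_def)

lemma lv_restrict: "v \<in> lv g \<Longrightarrow> d \<preceq> g \<Longrightarrow> v |` dn d \<in> lv d"
  using U_down dom_restrict_dn[of v g d]
  by (auto simp: down_closed_def level_def seqs_def restrict_map_le)

lemma lv_nonempty: "\<exists>v. v \<in> lv g" and lv_small: "small (lv g)"
  using U_tree unfolding kappa_tree_def kappa_tree_gen_def level_def by blast+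

lemma C_lt: "d \<in> C g \<Longrightarrow> d \<prec> g"
  using C_sub[of g] by auto

text \<open>Take an accumulation point a at which coherence fails. As C a is unbounded in a and
  omits a, it can only be an initial segment of C g cut at a itself, which is excluded; so the
  second alternative of \<open>sqleq\<close> holds.\<close>

lemma bad_sqleq:
  assumes "\<not> good g"
  shows "nusmall (C g) \<and> (\<forall>a\<in>nacc r (C g). is_successor r a)"
proof -
  obtain a where a: "a \<in> acc r (C g)" and ne: "C a \<noteq> C g \<inter> dn a"
    using assms by (auto simp: good_def)
  have lim: "is_limit r a" and ag: "a \<in> C g" using accD[OF a] by auto
  have nC: "a \<notin> C a" using C_lt[of a a] by auto
  consider "C a = C g" | b where "C a = C g \<inter> dn b" 
    | "Restr r (C g) <o Restr r (dn nu)" "\<forall>a\<in>nacc r (C g). is_successor r a"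
    using C_coh[OF a] by (auto simp: sqleq_def)
  then show ?thesis
  proof cases
    case 1
    then show ?thesis using nC ag by simp
  next
    case 2
    have "\<not> a \<prec> b" using 2 nC ag by auto
    moreover have "\<not> b \<prec> a"
    proof
      assume "b \<prec> a"
      then obtain d where "d \<in> C a" "b \<prec> d" using club_unbounded[OF C_club lim] lim by blast
      then show False using 2 wo_less_asym by auto
    qed
    ultimately have "a = b" using wo_neq_iff by blast
    then show ?thesis using 2 ne by simp
  next
    case 3
    then show ?thesis by (simp add: Restr_less_iff[OF card_nu])
  qed
qed

lemmas bad_small = conjunct1[OF bad_sqleq] and bad_nacc = conjunct2[OF bad_sqleq]

lemma good_acc:
  assumes "good g" "a \<in> acc r (C g)"
  shows "C a = C g \<inter> dn a" "good a"
proof -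
  show 1: "C a = C g \<inter> dn a" using assms by (auto simp: good_def)
  have "C d = C a \<inter> dn d" if d: "d \<in> acc r (C a)" for d
  proof -
    have "d \<in> acc r (C g)" "d \<prec> a" using acc_Int d 1 by auto
    then show ?thesis using assms(1) 1 by (auto simp: good_def intro: wo_less_trans)
  qed
  then show "good a" by (simp add: good_def)
qed

text \<open>Branches need to agree only for y on levels in c below g, since active tasks mention no
  other y. This locality makes the processes along coherent clubs coincide.\<close>

lemma G_cong:
  assumes "c \<inter> dn g = c' \<inter> dn g"
    and "\<And>y. y \<in> restr_levels r U (c \<inter> dn g) \<Longrightarrow> b y |` dn g = b' y |` dn g"
  shows "G g c b = G g c' b'"
  using assms
proof (induction g rule: wo_less_induct)
  case (1 g)
  have pd: "pd c g d \<longleftrightarrow> pd c' g d" for d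
    unfolding pd_def using 1(2) by (metis Int_iff dn_iff)
  show ?case
  proof (rule ext, rule ext, rule ext)
    fix v x i
    show "G g c b v x i = G g c' b' v x i"
    proof (cases "\<exists>d. pd c g d \<and> dom x \<subseteq> dn d")
      case False
      then show ?thesis unfolding G_eq[of g] stepG_def pd by (simp only: if_False)
    next
      case True
      then obtain d where d: "pd c g d" by blast
      then have dg: "d \<prec> g" by (simp add: pd_def)
      have sub: "dn d \<subseteq> dn g" using dg by (simp add: wo_less_imp_le)
      have cd: "c \<inter> dn d = c' \<inter> dn d" using 1(2) sub by blast
      have eq: "b y |` dn d = b' y |` dn d" if "y \<in> restr_levels r U (c \<inter> dn g)" for y
        using 1(3)[OF that] dg by (metis restrict_dn wo_less_imp_le)
      have Gd: "G d c b = G d c' b'"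
      proof (rule 1(1)[OF dg cd])
        fix y assume "y \<in> restr_levels r U (c \<inter> dn d)"
        then have "y \<in> restr_levels r U (c \<inter> dn g)" using sub unfolding restr_levels_def by blast
        then show "b y |` dn d = b' y |` dn d" by (rule eq)
      qed
      have act: "active c g \<longleftrightarrow> active c' g" unfolding active_def 1(2) ..
      \<comment> \<open>Agreement of the two branch maps is available only for the nodes of an
        active task, hence the side condition and the final case distinction.\<close>
      have ch: "choices T (G d c' b') d b g = choices T (G d c' b') d b' g" if "active c g"
        unfolding choices_def using that eq unfolding active_def by (intro Collect_cong) metis
      have ind: "index b g v x i = index b' g v x i" if "active c g"
        unfolding index_def using that 1(3) unfolding active_def by (intro ext) metis
      show ?thesis
        unfolding G_eq[of g] stepG_def pd pd_some[OF d[unfolded pd]] Gd act[symmetric] Let_def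
        by (cases "active c g") (simp_all only: ch ind simp_thms if_False)
    qed
  qed
qed

lemma G_F: "\<not> (\<exists>d. pd c g d \<and> dom x \<subseteq> dn d) \<Longrightarrow> G g c b v x i = F g v x i"
  unfolding G_eq[of g] stepG_def by (simp only: if_False)

lemma G_pd:
  assumes "pd c g d" "dom x \<subseteq> dn d"
  shows "G g c b v x i = (if active c g \<and> choices T (G d c b) d b g \<noteq> {} \<and> (\<exists>j. index b g v x i j)
       then extn (T g) ((SOME z. z \<in> choices T (G d c b) d b g) (SOME j. index b g v x i j))
       else if G d c b (v |` dn d) x i \<subseteq>\<^sub>m F g v x i then F g v x i
       else extn (T g) (G d c b (v |` dn d) x i))"
proof -
  have "\<exists>d. pd c g d \<and> dom x \<subseteq> dn d" using assms by blast
  then show ?thesis unfolding G_eq[of g] stepG_def pd_some[OF assms(1)] Let_def by (simp only: if_True)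
qed

definition extendable where
  "extendable g \<longleftrightarrow> (\<forall>a t. a \<prec> g \<longrightarrow> t \<in> T a \<longrightarrow> (\<exists>e\<in>T g. t \<subseteq>\<^sub>m e))"

lemma extnD:
  assumes "extendable g" "t \<in> T a" "a \<prec> g"
  shows "extn (T g) t \<in> T g" "t \<subseteq>\<^sub>m extn (T g) t"
proof -
  have "\<exists>e. e \<in> T g \<and> t \<subseteq>\<^sub>m e" using assms unfolding extendable_def by blast
  from someI_ex[OF this] show "extn (T g) t \<in> T g" "t \<subseteq>\<^sub>m extn (T g) t"
    by (simp_all add: extn_def)
qed

lemma choicesD:
  assumes "z \<in> choices Tp Gd d b g" "gt g j = Some (y, x, i)"
  shows "\<exists>a. a \<prec> g \<and> z j \<in> Tp a" "Gd (b y |` dn d) x i \<subseteq>\<^sub>m z j"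
  using assms unfolding choices_def by fastforce+

lemma G_step:
  assumes pd: "pd c g d" "dom x \<subseteq> dn d" and ext: "extendable g"
    and t: "G d c b (v |` dn d) x i \<in> T d" and F: "F g v x i \<in> T g"
  shows "G g c b v x i \<in> T g" "G d c b (v |` dn d) x i \<subseteq>\<^sub>m G g c b v x i"
proof -
  have dg: "d \<prec> g" using pd by (simp add: pd_def)
  let ?t = "G d c b (v |` dn d) x i"
  have "G g c b v x i \<in> T g \<and> ?t \<subseteq>\<^sub>m G g c b v x i"
  proof (cases "active c g \<and> choices T (G d c b) d b g \<noteq> {} \<and> (\<exists>j. index b g v x i j)")
    case True
    let ?z = "SOME z. z \<in> choices T (G d c b) d b g" and ?j = "SOME j. index b g v x i j"
    have z: "?z \<in> choices T (G d c b) d b g" using True by (simp only: some_in_eq simp_thms)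
    have "index b g v x i ?j" by (rule someI_ex) (use True in blast)
    then obtain y where y: "gt g ?j = Some (y, x, i)" "b y |` dn g = v" by (auto simp: index_def)
    have "b y |` dn d = v |` dn d" using y(2) restrict_dn[OF wo_less_imp_le[OF dg], of "b y"] by simp
    then have zj: "?t \<subseteq>\<^sub>m ?z ?j" using choicesD(2)[OF z y(1)] by simp
    have G: "G g c b v x i = extn (T g) (?z ?j)"
      unfolding G_pd[OF pd, of b v i] if_P[OF True] by (rule refl)
    obtain a where "a \<prec> g" "?z ?j \<in> T a" using choicesD(1)[OF z y(1)] by blast
    from extnD[OF ext this(2,1)] show ?thesis unfolding G using zj by (blast intro: map_le_trans)
  next
    case False
    show ?thesis
    proof (cases "?t \<subseteq>\<^sub>m F g v x i")
      case True
      then show ?thesis unfolding G_pd[OF pd, of b v i] if_not_P[OF False] using F by simp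
    next
      case nle: False
      show ?thesis unfolding G_pd[OF pd, of b v i] if_not_P[OF False] if_not_P[OF nle]
        using extnD[OF ext t dg] by simp
    qed
  qed
  then show "G g c b v x i \<in> T g" "?t \<subseteq>\<^sub>m G g c b v x i" by auto
qed

text \<open>If the path extends the previous value, the process leaves it only at an index occurring
  in the task, and an active task has fewer than nu entries.\<close>

lemma G_step_small:
  assumes pd: "pd c g d" "dom x \<subseteq> dn d"
  shows "nusmall {i. G g c b v x i \<noteq> F g v x i \<and> G d c b (v |` dn d) x i \<subseteq>\<^sub>m F g v x i}"
proof (cases "active c g")
  case True
  then have "nusmall ((\<lambda>j. snd (snd (the (gt g j)))) ` dom (gt g))"
    by (intro nusmall_image) (simp add: active_def)
  moreover have "{i. G g c b v x i \<noteq> F g v x i \<and> G d c b (v |` dn d) x i \<subseteq>\<^sub>m F g v x i}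
      \<subseteq> (\<lambda>j. snd (snd (the (gt g j)))) ` dom (gt g)"
  proof
    fix i assume "i \<in> {i. G g c b v x i \<noteq> F g v x i \<and> G d c b (v |` dn d) x i \<subseteq>\<^sub>m F g v x i}"
    then have i: "G g c b v x i \<noteq> F g v x i" "G d c b (v |` dn d) x i \<subseteq>\<^sub>m F g v x i" by auto
    have "\<exists>j. index b g v x i j"
    proof (rule ccontr)
      assume "\<not> ?thesis"
      then have "\<not> (active c g \<and> choices T (G d c b) d b g \<noteq> {} \<and> (\<exists>j. index b g v x i j))" by blast
      then have "G g c b v x i = F g v x i"
        unfolding G_pd[OF pd, of b v i] if_P[OF i(2)] by (simp only: if_False)
      then show False using i(1) by simp
    qed
    then obtain j y where "gt g j = Some (y, x, i)" unfolding index_def by blast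
    then show "i \<in> (\<lambda>j. snd (snd (the (gt g j)))) ` dom (gt g)"
      by (intro image_eqI[of _ _ j]) auto
  qed
  ultimately show ?thesis by (rule nusmall_subset)
next
  case False
  then have "{i. G g c b v x i \<noteq> F g v x i \<and> G d c b (v |` dn d) x i \<subseteq>\<^sub>m F g v x i} = {}"
    unfolding G_pd[OF pd, of b v] by simp
  then show ?thesis by (simp only: nusmall_finite[OF finite.emptyI])
qed

text \<open>Two coordinates with the same path could not be sent to different members of the tuple
  z. The premise \<open>un\<close> rules this out, so the choice in \<open>stepG\<close> returns
  j.\<close>

lemma G_seal:
  assumes pd: "pd c g d" "dom x \<subseteq> dn d" and ext: "extendable g" and act: "active c g"
    and ne: "choices T (G d c b) d b g \<noteq> {}" and j: "gt g j = Some (y, x, i)"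
    and un: "\<And>j' y'. gt g j' = Some (y', x, i) \<Longrightarrow> b y' |` dn g = b y |` dn g \<Longrightarrow> j' = j"
  shows "(SOME z. z \<in> choices T (G d c b) d b g) j \<subseteq>\<^sub>m G g c b (b y |` dn g) x i"
proof -
  let ?z = "SOME z. z \<in> choices T (G d c b) d b g"
  have ind: "index b g (b y |` dn g) x i j" using j by (auto simp: index_def)
  have un': "(SOME j. index b g (b y |` dn g) x i j) = j"
    using ind un by (intro some_equality) (auto simp: index_def)
  have z: "?z \<in> choices T (G d c b) d b g" using ne by (simp only: some_in_eq simp_thms)
  obtain a where "a \<prec> g" "?z j \<in> T a" using choicesD(1)[OF z j] by blast
  moreover have "active c g \<and> choices T (G d c b) d b g \<noteq> {} \<and> (\<exists>j. index b g (b y |` dn g) x i j)"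
    using act ne ind by blast
  ultimately show ?thesis
    unfolding G_pd[OF pd, of b "b y |` dn g" i] by (simp only: if_True simp_thms un' extnD(2)[OF ext])
qed

end

section \<open>Coherence of the ascent paths\<close>

context ascent_setup
begin

lemma F_self: "dom x = dn g \<Longrightarrow> F g v x i = x"
  unfolding F_eq[of g] stepF_def by (simp only: if_True simp_thms)

lemma F_sc:
  assumes "dom x \<noteq> dn (sc b)"
  shows "F (sc b) v x i = (F b (v |` dn b) x i)(b \<mapsto> pr i (the (v b)))"
proof -
  have "\<exists>b'. sc b = sc b'" by blast
  then show ?thesis unfolding F_eq[of "sc b"] stepF_def using assms by (simp only: if_False if_True pc_sc)
qed

lemma F_good:
  assumes "is_limit r g" "good g" "dom x \<noteq> dn g"
  shows "F g v x i = mU ((\<lambda>d. G d (C g) (bb g) (v |` dn d) x i) ` {d\<in>C g. dom x \<subseteq> dn d})"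
proof -
  have "\<not> (\<exists>b. g = sc b)" using assms(1) limit_not_sc by blast
  then show ?thesis unfolding F_eq[of g] stepF_def using assms by (simp only: if_False if_True)
qed

lemma F_bad:
  assumes "is_limit r g" "\<not> good g" "dom x \<noteq> dn g"
  shows "F g v x i = mU ((\<lambda>d. F d (v |` dn d) x (sel F g v x i)) ` {d\<in>C g. dom x \<subseteq> dn d})"
proof -
  have "\<not> (\<exists>b. g = sc b)" using assms(1) limit_not_sc by blast
  then show ?thesis unfolding F_eq[of g] stepF_def using assms by (simp only: if_False if_True)
qed

lemma T_sc: "T (sc b) = {t(b \<mapsto> j) |t j. t \<in> T b \<and> j \<in> labels b}"
proof -
  have "\<exists>b'. sc b = sc b'" by blast
  then show ?thesis unfolding T_eq[of "sc b"] stepT_def by (simp only: if_True pc_sc)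
qed

lemma T_cofs:
  assumes "\<And>b. g \<noteq> sc b" "cofs g"
  shows "T g = {z. dom z = dn g \<and> (\<forall>b. b \<prec> g \<longrightarrow> z |` dn b \<in> T b)}"
proof -
  have "\<not> (\<exists>b. g = sc b)" using assms by blast
  then show ?thesis unfolding T_eq[of g] stepT_def using assms(2) by (simp only: if_True if_False)
qed

lemma T_not_cofs:
  assumes "is_limit r g" "\<not> cofs g"
  shows "T g = {F g v x i |v x i. v \<in> lv g \<and> x \<in> (\<Union>b\<in>dn g. T b) \<and> i \<prec> th}"
proof -
  have "\<not> (\<exists>b. g = sc b)" using assms(1) limit_not_sc by blast
  then show ?thesis unfolding T_eq[of g] stepT_def using assms(2) by (simp only: if_False)
qed

lemma cofs_zr: "cofs zr"
proof -
  obtain t where "es t" using es_ex by blast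
  moreover have "cofinal_in r {} zr" by (simp add: cofinal_in_def)
  moreover have "|{} :: 'k set| \<le>o |dn t|" by (rule card_of_empty)
  ultimately show ?thesis unfolding cofs_def by blast
qed

lemma T_zr: "T zr = {Map.empty}"
proof -
  have "zr \<noteq> sc b" for b by (metis lt_sc not_lt_zr wo_refl)
  then show ?thesis using T_cofs[OF _ cofs_zr] by auto
qed

definition Tle where "Tle g = (\<Union>a\<in>{a. a \<preceq> g}. T a)"

lemma Tle_I: "x \<in> T a \<Longrightarrow> a \<preceq> g \<Longrightarrow> x \<in> Tle g"
  by (auto simp: Tle_def)

lemma Tle_mono: "x \<in> Tle a \<Longrightarrow> a \<preceq> g \<Longrightarrow> x \<in> Tle g"
  by (auto simp: Tle_def intro: wo_trans)

text \<open>The last clause concerns the paths above all x. When x lies on level b, where the path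
  takes the value x, it says that almost all values at g extend x.\<close>

definition inv where
  "inv g \<longleftrightarrow> (\<forall>z\<in>T g. dom z = dn g \<and> (\<forall>b. b \<preceq> g \<longrightarrow> z |` dn b \<in> T b)) \<and>
    (\<forall>v\<in>lv g. \<forall>x\<in>Tle g. \<forall>i. i \<prec> th \<longrightarrow> F g v x i \<in> T g) \<and>
    (\<forall>b. b \<preceq> g \<longrightarrow> (\<forall>v\<in>lv g. \<forall>x\<in>Tle b.
       nusmall {i\<in>dn th. \<not> F b (v |` dn b) x i \<subseteq>\<^sub>m F g v x i}))"

lemma inv_dom: "inv g \<Longrightarrow> z \<in> T g \<Longrightarrow> dom z = dn g"
  and inv_restrict: "inv g \<Longrightarrow> z \<in> T g \<Longrightarrow> b \<preceq> g \<Longrightarrow> z |` dn b \<in> T b"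
  unfolding inv_def by simp_all

lemma inv_F: "inv g \<Longrightarrow> v \<in> lv g \<Longrightarrow> x \<in> Tle g \<Longrightarrow> i \<prec> th \<Longrightarrow> F g v x i \<in> T g"
  unfolding inv_def by simp

lemma inv_small:
  assumes "inv g" "b \<preceq> g" "v \<in> lv g" "x \<in> Tle b"
  shows "nusmall {i\<in>dn th. \<not> F b (v |` dn b) x i \<subseteq>\<^sub>m F g v x i}"
proof -
  note 1 = conjunct2[OF conjunct2[OF assms(1)[unfolded inv_def]]]
  note 2 = mp[OF spec[OF 1, of b] assms(2)]
  show ?thesis by (rule bspec[OF bspec[OF 2 assms(3)] assms(4)])
qed

text \<open>The path above t equals t at the level of t and increases for almost all i, so at least
  one index gives an extension at g.\<close>

lemma inv_extendable:
  assumes inv: "inv g" "\<And>b. b \<prec> g \<Longrightarrow> inv b"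
  shows "extendable g"
  unfolding extendable_def
proof (intro allI impI)
  fix a t assume a: "a \<prec> g" and t: "t \<in> T a"
  obtain v where v: "v \<in> lv g" using lv_nonempty by blast
  have ta: "t \<in> Tle a" using Tle_I t by simp
  obtain i where i: "i \<prec> th" "F a (v |` dn a) t i \<subseteq>\<^sub>m F g v t i"
    using nusmall_missing[OF inv_small[OF inv(1) wo_less_imp_le[OF a] v ta]] by blast
  have "F a (v |` dn a) t i = t" using inv_dom[OF inv(2)[OF a] t] by (rule F_self)
  moreover have "F g v t i \<in> T g"
    using inv_F[OF inv(1) v Tle_mono[OF ta wo_less_imp_le[OF a]] i(1)] .
  ultimately show "\<exists>e\<in>T g. t \<subseteq>\<^sub>m e" using i(2) by auto
qed

text \<open>The recursion tests heights by domains and the invariant by membership in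
  \<open>Tle\<close>; this translates between the two.\<close>

lemma dom_Tle_iff:
  assumes "\<And>b. b \<preceq> g \<Longrightarrow> inv b" "x \<in> Tle g" "e \<preceq> g"
  shows "dom x \<subseteq> dn e \<longleftrightarrow> x \<in> Tle e"
proof -
  obtain a where a: "a \<preceq> g" "x \<in> T a" using assms(2) by (auto simp: Tle_def)
  have d: "dom x = dn a" using inv_dom[OF assms(1)[OF a(1)] a(2)] .
  show ?thesis
  proof
    assume "dom x \<subseteq> dn e"
    then show "x \<in> Tle e" using a d by (simp add: Tle_I)
  next
    assume "x \<in> Tle e"
    then obtain a' where a': "a' \<preceq> e" "x \<in> T a'" by (auto simp: Tle_def)
    have "dom x = dn a'" using inv_dom[OF assms(1) a'(2)] a'(1) assms(3) wo_trans by blast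
    then show "dom x \<subseteq> dn e" using a'(1) by simp
  qed
qed

lemma inv_zr: "inv zr"
proof -
  have z: "z \<preceq> zr \<longleftrightarrow> z = zr" for z using wo_antisym[of z zr] by auto
  have T: "x \<in> Tle zr \<Longrightarrow> x = Map.empty" for x by (auto simp: Tle_def z T_zr)
  have F: "F zr v Map.empty i = Map.empty" for v i by (rule F_self) simp
  have e: "nusmall {}" by (rule nusmall_finite) simp
  show ?thesis unfolding inv_def using e by (auto simp: z T_zr F dest!: T)
qed

lemma inv_sc:
  assumes inv: "\<And>a. a \<preceq> b \<Longrightarrow> inv a"
  shows "inv (sc b)"
proof -
  let ?g = "sc b"
  have ib: "inv b" using inv by simp
  have le: "a \<preceq> ?g \<longleftrightarrow> a \<preceq> b \<or> a = ?g" for a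
    by (metis lt_sc wo_le_less)
  have Tg: "dom z = dn ?g \<and> (\<forall>a. a \<preceq> ?g \<longrightarrow> z |` dn a \<in> T a)" if "z \<in> T ?g" for z
  proof -
    obtain t j where z: "z = t(b \<mapsto> j)" and t: "t \<in> T b" using \<open>z \<in> T ?g\<close> unfolding T_sc by blast
    have dt: "dom t = dn b" using inv_dom[OF ib t] .
    have dz: "dom z = dn ?g" by (simp add: z dt dn_sc)
    moreover have "z |` dn a \<in> T a" if "a \<preceq> b" for a
    proof -
      have "b \<notin> dn a" using that wo_leD by simp
      then have "z |` dn a = t |` dn a" unfolding z by simp
      then show ?thesis using inv_restrict[OF ib t that] by simp
    qed
    moreover have "z |` dn ?g \<in> T ?g" using dz \<open>z \<in> T ?g\<close> by simp
    ultimately show ?thesis using le by blast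
  qed
  have old: "dom x \<noteq> dn ?g" if "x \<in> Tle b" for x
  proof -
    obtain a where a: "a \<preceq> b" "x \<in> T a" using \<open>x \<in> Tle b\<close> by (auto simp: Tle_def)
    have "dom x = dn a" using inv_dom[OF inv[OF a(1)] a(2)] .
    moreover have "a \<noteq> ?g" using a(1) wo_leD[of ?g b] by auto
    ultimately show ?thesis by simp
  qed
  have F: "F ?g v x i \<in> T ?g" if v: "v \<in> lv ?g" and x: "x \<in> Tle ?g" and i: "i \<prec> th" for v x i
  proof (cases "x \<in> T ?g")
    case True
    then show ?thesis using Tg F_self by metis
  next
    case False
    then have xb: "x \<in> Tle b" using x le by (auto simp: Tle_def)
    have "v |` dn b \<in> lv b" using lv_restrict[OF v, of b] wo_less_imp_le by simp
    then have "F b (v |` dn b) x i \<in> T b" using inv_F[OF ib _ xb i] by blast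
    moreover have "pr i (the (v b)) \<in> labels b" unfolding labels_def using v i by blast
    ultimately show ?thesis unfolding F_sc[OF old[OF xb]] T_sc by blast
  qed
  have "nusmall {i\<in>dn th. \<not> F a (v |` dn a) x i \<subseteq>\<^sub>m F ?g v x i}"
    if a: "a \<preceq> ?g" and v: "v \<in> lv ?g" and x: "x \<in> Tle a" for a v x
  proof (cases "a = ?g")
    case True
    have "v |` dn ?g = v" using lv_dom[OF v] by simp
    then have "{i\<in>dn th. \<not> F a (v |` dn a) x i \<subseteq>\<^sub>m F ?g v x i} = {}" using True by simp
    then show ?thesis by (simp only: nusmall_finite[OF finite.emptyI])
  next
    case False
    then have ab: "a \<preceq> b" using a le by blast
    have bg: "b \<preceq> ?g" by (simp add: wo_less_imp_le)
    have xb: "x \<in> Tle b" using x ab by (rule Tle_mono)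
    have vb: "v |` dn b \<in> lv b" using lv_restrict[OF v bg] .
    have "nusmall {i\<in>dn th. \<not> F a ((v |` dn b) |` dn a) x i \<subseteq>\<^sub>m F b (v |` dn b) x i}"
      using inv_small[OF ib ab vb x] .
    moreover have "{i\<in>dn th. \<not> F a (v |` dn a) x i \<subseteq>\<^sub>m F ?g v x i} \<subseteq>
        {i\<in>dn th. \<not> F a ((v |` dn b) |` dn a) x i \<subseteq>\<^sub>m F b (v |` dn b) x i}"
    proof clarify
      fix i assume i: "i \<in> dn th" and n: "\<not> F a (v |` dn a) x i \<subseteq>\<^sub>m F ?g v x i"
        and h: "F a ((v |` dn b) |` dn a) x i \<subseteq>\<^sub>m F b (v |` dn b) x i"
      have "F b (v |` dn b) x i \<in> T b" using inv_F[OF ib vb xb] i by simp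
      then have "b \<notin> dom (F b (v |` dn b) x i)" using inv_dom[OF ib] by simp
      then have "F b (v |` dn b) x i \<subseteq>\<^sub>m F ?g v x i"
        unfolding F_sc[OF old[OF xb]] by (simp add: map_le_def)
      then show False using n h restrict_dn[OF ab] by (metis map_le_trans)
    qed
    ultimately show ?thesis by (rule nusmall_subset)
  qed
  then show ?thesis unfolding inv_def using Tg F by blast
qed

section \<open>Limits of the process and of the paths\<close>

lemma glue:
  assumes inv: "\<And>d. d \<prec> g \<Longrightarrow> inv d"
    and c: "c \<subseteq> dn g" "\<And>e. e \<prec> g \<Longrightarrow> \<exists>d\<in>c. e \<prec> d"
    and h: "\<And>d. d \<in> c \<Longrightarrow> h d \<in> T d"
      "\<And>d e. d \<in> c \<Longrightarrow> e \<in> c \<Longrightarrow> d \<prec> e \<Longrightarrow> h d \<subseteq>\<^sub>m h e"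
  shows "dom (mU (h ` c)) = dn g"
    and "\<And>b. b \<prec> g \<Longrightarrow> mU (h ` c) |` dn b \<in> T b"
    and "\<And>d. d \<in> c \<Longrightarrow> h d \<subseteq>\<^sub>m mU (h ` c)"
proof -
  have cg: "d \<in> c \<Longrightarrow> d \<prec> g" for d using c(1) by auto
  have dom_h: "dom (h d) = dn d" if "d \<in> c" for d using inv_dom[OF inv[OF cg[OF that]] h(1)[OF that]] .
  have chain: "x \<subseteq>\<^sub>m y \<or> y \<subseteq>\<^sub>m x" if xy: "x \<in> h ` c" "y \<in> h ` c" for x y
  proof -
    obtain d e where de: "d \<in> c" "e \<in> c" "x = h d" "y = h e" using xy by blast
    then show ?thesis using h(2)[of d e] h(2)[of e d] wo_neq_iff[of d e] by auto
  qed
  show sub: "h d \<subseteq>\<^sub>m mU (h ` c)" if "d \<in> c" for d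
    by (rule mU_chain(1)) (use chain that in blast)+
  have "dom (mU (h ` c)) = \<Union> (dom ` h ` c)" by (rule mU_chain(2)) (use chain in blast)
  also have "\<dots> = (\<Union>d\<in>c. dn d)" using dom_h by auto
  also have "\<dots> = dn g" using c cg wo_less_trans by fastforce
  finally show "dom (mU (h ` c)) = dn g" .
  show "mU (h ` c) |` dn b \<in> T b" if b: "b \<prec> g" for b
  proof -
    obtain d where d: "d \<in> c" "b \<prec> d" using c(2)[OF b] by blast
    have "mU (h ` c) |` dn d = h d" by (rule map_le_restrict[OF sub[OF d(1)] dom_h[OF d(1)]])
    then have "mU (h ` c) |` dn b = h d |` dn b" using restrict_dn[OF wo_less_imp_le[OF d(2)]] by metis
    then show ?thesis using inv_restrict[OF inv[OF cg[OF d(1)]] h(1)[OF d(1)] wo_less_imp_le[OF d(2)]] by simp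
  qed
qed

text \<open>The clause on the maps b for coherent clubs is made for this: C d and C g agree below d,
  hence so do the branches through nodes y on levels in C d, and \<open>G_cong\<close>
  applies.\<close>

lemma G_coherent:
  assumes g: "good g" and d: "d \<in> acc r (C g)" and e: "e \<prec> d"
  shows "G e (C d) (bb d) = G e (C g) (bb g)"
proof (rule G_cong)
  have Cd: "C d = C g \<inter> dn d" using good_acc[OF g d] by blast
  have sub: "dn e \<subseteq> dn d" using e by (simp add: wo_less_imp_le)
  show "C d \<inter> dn e = C g \<inter> dn e" using Cd sub by blast
  fix y assume "y \<in> restr_levels r U (C d \<inter> dn e)"
  then have "y \<in> restr_levels r U (C d)" by (auto simp: restr_levels_def)
  moreover have "C g \<inter> (dn d - dom y) = C d \<inter> (dn d - dom y)" using Cd by blast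
  ultimately have "bb d y = bb g y |` dn d" by (rule bb_coh)
  then show "bb d y |` dn e = bb g y |` dn e" using restrict_dn[OF wo_less_imp_le[OF e]] by simp
qed

text \<open>Induction on d. After a predecessor e the exceptions come from three sets of fewer than
  nu indices: those at e, those whose path does not increase from e to d, and those moved by the
  task. At an accumulation point d there are none: without a predecessor the process copies
  \<open>F d\<close>, and \<open>F d\<close> is the limit of the process along C d, which by
  coherence is the present process.\<close>

lemma G_along:
  assumes lim: "is_limit r g" and good: "good g" and inv: "\<And>d. d \<prec> g \<Longrightarrow> inv d"
    and "d \<in> C g" "v \<in> lv d" "x \<in> Tle d"
  shows "(\<forall>i. i \<prec> th \<longrightarrow> G d (C g) (bb g) v x i \<in> T d) \<and>
    nusmall {i\<in>dn th. G d (C g) (bb g) v x i \<noteq> F d v x i} \<and>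
    (\<forall>e\<in>C g. e \<prec> d \<longrightarrow> x \<in> Tle e \<longrightarrow> (\<forall>i. i \<prec> th \<longrightarrow>
       G e (C g) (bb g) (v |` dn e) x i \<subseteq>\<^sub>m G d (C g) (bb g) v x i))"
  using assms(4-)
proof (induction d arbitrary: v x rule: wo_less_induct)
  case (1 d)
  let ?c = "C g" and ?b = "bb g"
  note d = \<open>d \<in> C g\<close> and v = \<open>v \<in> lv d\<close> and x = \<open>x \<in> Tle d\<close>
  have dg: "d \<prec> g" using C_lt d by blast
  have invd: "\<And>b. b \<preceq> d \<Longrightarrow> inv b" using inv dg wo_le_less_trans by blast
  have extd: "extendable d" using inv_extendable[of d] invd wo_less_imp_le by auto
  have Fd: "\<And>i. i \<prec> th \<Longrightarrow> F d v x i \<in> T d" using inv_F[OF invd v x] by simp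
  have same: "(\<forall>i. i \<prec> th \<longrightarrow> G d ?c ?b v x i \<in> T d) \<and> nusmall {i\<in>dn th. G d ?c ?b v x i \<noteq> F d v x i}"
    if "\<not> (\<exists>e. pd ?c d e \<and> dom x \<subseteq> dn e)"
  proof -
    have "G d ?c ?b v x i = F d v x i" for i using that by (rule G_F)
    then show ?thesis using Fd nusmall_finite[OF finite.emptyI] by simp
  qed
  from C_club[OF lim] d show ?case
  proof (cases rule: club_cases)
    case first
    then have no: "e \<in> ?c \<Longrightarrow> \<not> e \<prec> d" for e using wo_leD by blast
    then have "\<not> (\<exists>e. pd ?c d e \<and> dom x \<subseteq> dn e)" unfolding pd_def by blast
    then show ?thesis using same no by blast
  next
    case (pred e)
    then have pd: "pd ?c d e" by (auto simp: pd_def)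
    have ed: "e \<preceq> d" using pred wo_less_imp_le by blast
    show ?thesis
    proof (cases "x \<in> Tle e")
      case False
      have nx: "\<not> dom x \<subseteq> dn e" using False dom_Tle_iff[OF invd x ed] by blast
      then have "\<not> (\<exists>e. pd ?c d e \<and> dom x \<subseteq> dn e)" using pd pd_unique by blast
      moreover have "x \<notin> Tle f" if "f \<in> ?c" "f \<prec> d" for f
        using False pred(3)[OF that] Tle_mono by blast
      ultimately show ?thesis using same by blast
    next
      case True
      have dx: "dom x \<subseteq> dn e" using True dom_Tle_iff[OF invd x ed] by blast
      have ve: "v |` dn e \<in> lv e" using lv_restrict[OF v ed] .
      note IH = 1(1)[OF pred(2,1) ve True]
      have step: "G d ?c ?b v x i \<in> T d" "G e ?c ?b (v |` dn e) x i \<subseteq>\<^sub>m G d ?c ?b v x i" if "i \<prec> th" for i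
        using G_step[OF pd dx extd _ Fd[OF that]] IH that by blast+
      have "nusmall {i\<in>dn th. G d ?c ?b v x i \<noteq> F d v x i}"
      proof (rule nusmall_subset)
        show "nusmall ({i. G d ?c ?b v x i \<noteq> F d v x i \<and> G e ?c ?b (v |` dn e) x i \<subseteq>\<^sub>m F d v x i} \<union>
          ({i\<in>dn th. G e ?c ?b (v |` dn e) x i \<noteq> F e (v |` dn e) x i} \<union>
           {i\<in>dn th. \<not> F e (v |` dn e) x i \<subseteq>\<^sub>m F d v x i}))"
          using G_step_small[OF pd dx] IH inv_small[OF invd ed v True] by (intro nusmall_Un) auto
      qed (auto simp del: dn_iff)
      moreover have "G f ?c ?b (v |` dn f) x i \<subseteq>\<^sub>m G d ?c ?b v x i"
        if f: "f \<in> ?c" "f \<prec> d" "x \<in> Tle f" and i: "i \<prec> th" for f i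
      proof (cases "f = e")
        case True
        then show ?thesis using step(2)[OF i] by simp
      next
        case False
        then have fe: "f \<prec> e" using pred(3)[OF f(1,2)] wo_le_neq_trans by blast
        then have "G f ?c ?b ((v |` dn e) |` dn f) x i \<subseteq>\<^sub>m G e ?c ?b (v |` dn e) x i"
          using IH f i by blast
        then show ?thesis
          unfolding restrict_dn[OF wo_less_imp_le[OF fe]] using step(2)[OF i] by (rule map_le_trans)
      qed
      ultimately show ?thesis using step(1) by blast
    qed
  next
    case acc
    have limd: "is_limit r d" using accD(1)[OF acc] .
    have nopd: "\<not> (\<exists>e. pd ?c d e \<and> dom x \<subseteq> dn e)"
    proof
      assume "\<exists>e. pd ?c d e \<and> dom x \<subseteq> dn e"
      then obtain e where "e \<prec> d" "\<And>f. f \<in> ?c \<Longrightarrow> f \<prec> d \<Longrightarrow> f \<preceq> e" unfolding pd_def by blast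
      then show False using accD(3)[OF acc] wo_leD by blast
    qed
    have Cd: "C d = ?c \<inter> dn d" and goodd: "good d" using good_acc[OF good acc] by auto
    have "G e ?c ?b (v |` dn e) x i \<subseteq>\<^sub>m G d ?c ?b v x i"
      if e: "e \<in> ?c" "e \<prec> d" "x \<in> Tle e" and i: "i \<prec> th" for e i
    proof -
      have dxe: "dom x \<subseteq> dn e" using e dom_Tle_iff[OF invd x wo_less_imp_le[OF e(2)]] by blast
      have dx: "dom x \<noteq> dn d" using dxe e(2) wo_leD by auto
      let ?h = "\<lambda>f. G f (C d) (bb d) (v |` dn f) x i" and ?D = "{f\<in>C d. dom x \<subseteq> dn f}"
      have Gh: "?h f = G f ?c ?b (v |` dn f) x i" if "f \<in> ?D" for f
        using G_coherent[OF good acc, of f] that Cd by simp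
      have ch: "?h f \<subseteq>\<^sub>m ?h f'" if ff: "f \<in> ?D" "f' \<in> ?D" "f \<prec> f'" for f f'
      proof -
        have f: "f' \<prec> d" "f' \<in> ?c" "f \<in> ?c" using ff Cd by auto
        have "f \<prec> d" using ff(3) f(1) wo_less_trans by blast
        then have "x \<in> Tle f" "x \<in> Tle f'"
          using ff f dom_Tle_iff[OF invd x] wo_less_imp_le by auto
        moreover have "v |` dn f' \<in> lv f'" using lv_restrict[OF v] f(1) wo_less_imp_le by blast
        ultimately have "G f ?c ?b ((v |` dn f') |` dn f) x i \<subseteq>\<^sub>m G f' ?c ?b (v |` dn f') x i"
          using 1(1)[OF f(1,2)] f(3) ff(3) i by blast
        then show ?thesis
          unfolding restrict_dn[OF wo_less_imp_le[OF ff(3)]] Gh[OF ff(1)] Gh[OF ff(2)] .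
      qed
      have eD: "e \<in> ?D" using e dxe Cd by simp
      have "?h e \<subseteq>\<^sub>m mU (?h ` ?D)"
      proof (rule mU_chain(1))
        fix p q assume "p \<in> ?h ` ?D" "q \<in> ?h ` ?D"
        then obtain f f' where ff: "f \<in> ?D" "f' \<in> ?D" "p = ?h f" "q = ?h f'" by blast
        then show "p \<subseteq>\<^sub>m q \<or> q \<subseteq>\<^sub>m p" using ch[OF ff(1,2)] ch[OF ff(2,1)] wo_neq_iff[of f f'] by auto
      qed (use eD in blast)
      then show ?thesis using Gh[OF eD] F_good[OF limd goodd dx, of v i] G_F[OF nopd, of ?b v i] by simp
    qed
    then show ?thesis using same[OF nopd] by blast
  qed
qed

text \<open>A level b below g is compared with g through a point d of the club above b. From b to d
  the paths are known to increase almost everywhere, and from d to g the limit extends its own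
  stages for all i.\<close>

lemma limit_core:
  assumes lim: "is_limit r g" and inv: "\<And>d. d \<prec> g \<Longrightarrow> inv d"
    and v: "v \<in> lv g" and x: "x \<in> Tle a" and a: "a \<prec> g"
  shows "i \<prec> th \<Longrightarrow> dom (F g v x i) = dn g \<and> (\<forall>b. b \<prec> g \<longrightarrow> F g v x i |` dn b \<in> T b)"
    and "b \<prec> g \<Longrightarrow> x \<in> Tle b \<Longrightarrow> nusmall {i\<in>dn th. \<not> F b (v |` dn b) x i \<subseteq>\<^sub>m F g v x i}"
proof -
  define c where "c = {d\<in>C g. dom x \<subseteq> dn d}"
  have inv_le: "\<And>b. b \<preceq> a \<Longrightarrow> inv b" using inv a wo_le_less_trans by blast
  obtain a' where a': "a' \<preceq> a" "x \<in> T a'" using x by (auto simp: Tle_def)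
  have dx: "dom x = dn a'" using inv_dom[OF inv_le[OF a'(1)] a'(2)] .
  have a'g: "a' \<prec> g" using a'(1) a by (rule wo_le_less_trans)
  have ne: "dom x \<noteq> dn g" using dx a'g by auto
  have c_sub: "c \<subseteq> dn g" using C_sub[of g] by (auto simp: c_def)
  have c_le: "d \<preceq> g" "d \<prec> g" if "d \<in> c" for d
    using that c_sub wo_less_imp_le by auto
  have c_Tle: "x \<in> Tle d" if "d \<in> c" for d
  proof -
    have "a' \<preceq> d" using that dx by (simp add: c_def)
    then show ?thesis using a'(2) by (rule Tle_I[rotated])
  qed
  have c_unb: "\<exists>d\<in>c. e \<prec> d" if "e \<prec> g" for e
  proof -
    define m where "m = (if a' \<preceq> e then e else a')"
    have "m \<prec> g" using that a'g by (simp add: m_def)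
    then obtain d where "d \<in> C g" "m \<prec> d" using club_unbounded[OF C_club[OF lim] lim] by blast
    moreover have "e \<preceq> m" "a' \<preceq> m" using wo_linear[of e a'] by (auto simp: m_def)
    ultimately show ?thesis
      using dx wo_le_less_trans wo_less_imp_le by (intro bexI[of _ d]) (auto simp: c_def)
  qed
  have c_lv: "v |` dn d \<in> lv d" if "d \<in> c" for d using lv_restrict[OF v c_le(1)[OF that]] .
  show "i \<prec> th \<Longrightarrow> dom (F g v x i) = dn g \<and> (\<forall>b. b \<prec> g \<longrightarrow> F g v x i |` dn b \<in> T b)"
    and "b \<prec> g \<Longrightarrow> x \<in> Tle b \<Longrightarrow> nusmall {i\<in>dn th. \<not> F b (v |` dn b) x i \<subseteq>\<^sub>m F g v x i}"
  proof (atomize (full), cases "good g")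
    case True
    let ?h = "\<lambda>i d. G d (C g) (bb g) (v |` dn d) x i"
    have Fg: "F g v x i = mU (?h i ` c)" for i
      unfolding c_def by (rule F_good[OF lim True ne])
    have al: "(\<forall>i. i \<prec> th \<longrightarrow> ?h i d \<in> T d) \<and>
        nusmall {i\<in>dn th. ?h i d \<noteq> F d (v |` dn d) x i} \<and>
        (\<forall>e\<in>C g. e \<prec> d \<longrightarrow> x \<in> Tle e \<longrightarrow> (\<forall>i. i \<prec> th \<longrightarrow>
           G e (C g) (bb g) ((v |` dn d) |` dn e) x i \<subseteq>\<^sub>m ?h i d))" if "d \<in> c" for d
      using G_along[OF lim True inv _ c_lv[OF that] c_Tle[OF that]] that unfolding c_def by blast
    have chain: "?h i d \<subseteq>\<^sub>m ?h i e" if "d \<in> c" "e \<in> c" "d \<prec> e" "i \<prec> th" for d e i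
    proof -
      have "d \<in> C g" using that by (simp add: c_def)
      then have "G d (C g) (bb g) ((v |` dn e) |` dn d) x i \<subseteq>\<^sub>m ?h i e"
        using al[OF that(2)] c_Tle[OF that(1)] that(3,4) by blast
      then show ?thesis unfolding restrict_dn[OF wo_less_imp_le[OF that(3)]] .
    qed
    have gl: "dom (mU (?h i ` c)) = dn g" "\<And>b. b \<prec> g \<Longrightarrow> mU (?h i ` c) |` dn b \<in> T b"
      "\<And>d. d \<in> c \<Longrightarrow> ?h i d \<subseteq>\<^sub>m mU (?h i ` c)" if "i \<prec> th" for i
    proof -
      have m: "?h i d \<in> T d" if "d \<in> c" for d using al[OF that] \<open>i \<prec> th\<close> by blast
      have ch: "?h i d \<subseteq>\<^sub>m ?h i e" if "d \<in> c" "e \<in> c" "d \<prec> e" for d e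
        using chain[OF that \<open>i \<prec> th\<close>] .
      note g = glue[of g c "?h i", OF inv c_sub c_unb m ch]
      show "dom (mU (?h i ` c)) = dn g" by (rule g(1))
      show "\<And>b. b \<prec> g \<Longrightarrow> mU (?h i ` c) |` dn b \<in> T b" by (rule g(2))
      show "\<And>d. d \<in> c \<Longrightarrow> ?h i d \<subseteq>\<^sub>m mU (?h i ` c)" by (rule g(3))
    qed
    have "nusmall {i\<in>dn th. \<not> F b (v |` dn b) x i \<subseteq>\<^sub>m F g v x i}" if b: "b \<prec> g" "x \<in> Tle b" for b
    proof -
      obtain d where d: "d \<in> c" "b \<prec> d" using c_unb[OF b(1)] by blast
      note bd = wo_less_imp_le[OF d(2)]
      have 1: "nusmall {i\<in>dn th. \<not> F b (v |` dn b) x i \<subseteq>\<^sub>m F d (v |` dn d) x i}"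
        using inv_small[OF inv[OF c_le(2)[OF d(1)]] bd c_lv[OF d(1)] b(2)] unfolding restrict_dn[OF bd] .
      have 2: "nusmall {i\<in>dn th. ?h i d \<noteq> F d (v |` dn d) x i}" using al[OF d(1)] by blast
      show ?thesis
      proof (rule nusmall_subset[OF nusmall_Un[OF 1 2]], rule subsetI)
        fix i assume "i \<in> {i\<in>dn th. \<not> F b (v |` dn b) x i \<subseteq>\<^sub>m F g v x i}"
        then have i: "i \<prec> th" "\<not> F b (v |` dn b) x i \<subseteq>\<^sub>m F g v x i" by auto
        have "?h i d \<subseteq>\<^sub>m F g v x i" unfolding Fg by (rule gl(3)[OF i(1) d(1)])
        then have "\<not> F b (v |` dn b) x i \<subseteq>\<^sub>m ?h i d" using i(2) map_le_trans by blast
        then show "i \<in> {i\<in>dn th. \<not> F b (v |` dn b) x i \<subseteq>\<^sub>m F d (v |` dn d) x i} \<union>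
            {i\<in>dn th. ?h i d \<noteq> F d (v |` dn d) x i}" using i(1) by auto
      qed
    qed
    then show "(i \<prec> th \<longrightarrow> dom (F g v x i) = dn g \<and> (\<forall>b. b \<prec> g \<longrightarrow> F g v x i |` dn b \<in> T b)) \<and>
      (b \<prec> g \<longrightarrow> x \<in> Tle b \<longrightarrow> nusmall {i\<in>dn th. \<not> F b (v |` dn b) x i \<subseteq>\<^sub>m F g v x i})"
      using gl unfolding Fg by blast
  next
    case False
    let ?s = "sel F g v x"
    let ?h = "\<lambda>i d. F d (v |` dn d) x (?s i)"
    have Fg: "F g v x i = mU (?h i ` c)" for i
      unfolding c_def by (rule F_bad[OF lim False ne])
    \<comment> \<open>Here C g has fewer than nu points, hence fewer than nu pairs, and each pair
      contributes fewer than nu exceptions.\<close>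
    have bad: "nusmall {i\<in>dn th. \<not> incr F g v x i}"
    proof (rule nusmall_subset)
      let ?P = "{p\<in>C g \<times> C g. fst p \<preceq> snd p \<and> dom x \<subseteq> dn (fst p)}"
      show "nusmall (\<Union>p\<in>?P. {i\<in>dn th. \<not> F (fst p) (v |` dn (fst p)) x i \<subseteq>\<^sub>m F (snd p) (v |` dn (snd p)) x i})"
      proof (rule nusmall_UN)
        show "nusmall ?P"
          by (rule nusmall_subset[OF nusmall_Times[OF bad_small[OF False] bad_small[OF False]]]) blast
        fix p assume "p \<in> ?P"
        then obtain d e where p: "p = (d, e)" "d \<in> c" "e \<in> C g" "d \<preceq> e" by (auto simp: c_def)
        have "dn d \<subseteq> dn e" using p(4) by simp
        then have e: "e \<in> c" using p(2,3) unfolding c_def by blast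
        show "nusmall {i\<in>dn th. \<not> F (fst p) (v |` dn (fst p)) x i \<subseteq>\<^sub>m F (snd p) (v |` dn (snd p)) x i}"
          using inv_small[OF inv[OF c_le(2)[OF e]] p(4) c_lv[OF e] c_Tle[OF p(2)]]
          unfolding restrict_dn[OF p(4)] p(1) fst_conv snd_conv .
      qed
      show "{i\<in>dn th. \<not> incr F g v x i} \<subseteq>
        (\<Union>p\<in>?P. {i\<in>dn th. \<not> F (fst p) (v |` dn (fst p)) x i \<subseteq>\<^sub>m F (snd p) (v |` dn (snd p)) x i})"
      proof
        fix i assume "i \<in> {i\<in>dn th. \<not> incr F g v x i}"
        then obtain d e where "i \<in> dn th" "d \<in> C g" "e \<in> C g" "d \<preceq> e" "dom x \<subseteq> dn d"
          "\<not> F d (v |` dn d) x i \<subseteq>\<^sub>m F e (v |` dn e) x i" unfolding incr_def by blast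
        then show "i \<in> (\<Union>p\<in>?P. {i\<in>dn th. \<not> F (fst p) (v |` dn (fst p)) x i \<subseteq>\<^sub>m F (snd p) (v |` dn (snd p)) x i})"
          by (intro UN_I[of "(d, e)"]) simp_all
      qed
    qed
    \<comment> \<open>Shows that the default index chosen in \<open>sel\<close> exists.\<close>
    have ex: "\<exists>i. i \<prec> th \<and> incr F g v x i" by (rule nusmall_missing[OF bad])
    have s: "?s i \<prec> th" "incr F g v x (?s i)" if "i \<prec> th" for i
      using someI_ex[OF ex] that unfolding sel_def by (cases "incr F g v x i"; simp)+
    have gl: "dom (mU (?h i ` c)) = dn g" "\<And>b. b \<prec> g \<Longrightarrow> mU (?h i ` c) |` dn b \<in> T b"
      "\<And>d. d \<in> c \<Longrightarrow> ?h i d \<subseteq>\<^sub>m mU (?h i ` c)" if "i \<prec> th" for i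
    proof -
      have m: "?h i d \<in> T d" if "d \<in> c" for d
        using inv_F[OF inv[OF c_le(2)[OF that]] c_lv[OF that] c_Tle[OF that] s(1)[OF \<open>i \<prec> th\<close>]] .
      have ch: "?h i d \<subseteq>\<^sub>m ?h i e" if "d \<in> c" "e \<in> c" "d \<prec> e" for d e
        using s(2)[OF \<open>i \<prec> th\<close>] that wo_less_imp_le[OF that(3)] unfolding incr_def c_def by blast
      note g = glue[of g c "?h i", OF inv c_sub c_unb m ch]
      show "dom (mU (?h i ` c)) = dn g" by (rule g(1))
      show "\<And>b. b \<prec> g \<Longrightarrow> mU (?h i ` c) |` dn b \<in> T b" by (rule g(2))
      show "\<And>d. d \<in> c \<Longrightarrow> ?h i d \<subseteq>\<^sub>m mU (?h i ` c)" by (rule g(3))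
    qed
    have "nusmall {i\<in>dn th. \<not> F b (v |` dn b) x i \<subseteq>\<^sub>m F g v x i}" if b: "b \<prec> g" "x \<in> Tle b" for b
    proof -
      obtain d where d: "d \<in> c" "b \<prec> d" using c_unb[OF b(1)] by blast
      note bd = wo_less_imp_le[OF d(2)]
      have 1: "nusmall {i\<in>dn th. \<not> F b (v |` dn b) x i \<subseteq>\<^sub>m F d (v |` dn d) x i}"
        using inv_small[OF inv[OF c_le(2)[OF d(1)]] bd c_lv[OF d(1)] b(2)] unfolding restrict_dn[OF bd] .
      show ?thesis
      proof (rule nusmall_subset[OF nusmall_Un[OF 1 bad]], rule subsetI)
        fix i assume "i \<in> {i\<in>dn th. \<not> F b (v |` dn b) x i \<subseteq>\<^sub>m F g v x i}"
        then have i: "i \<prec> th" "\<not> F b (v |` dn b) x i \<subseteq>\<^sub>m F g v x i" by auto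
        have "?h i d \<subseteq>\<^sub>m F g v x i" unfolding Fg by (rule gl(3)[OF i(1) d(1)])
        then have n: "\<not> F b (v |` dn b) x i \<subseteq>\<^sub>m ?h i d" using i(2) map_le_trans by blast
        show "i \<in> {i\<in>dn th. \<not> F b (v |` dn b) x i \<subseteq>\<^sub>m F d (v |` dn d) x i} \<union>
            {i\<in>dn th. \<not> incr F g v x i}"
        proof (cases "incr F g v x i")
          case True
          then have "?s i = i" by (simp add: sel_def)
          then show ?thesis using n i(1) by simp
        qed (use i(1) in simp)
      qed
    qed
    then show "(i \<prec> th \<longrightarrow> dom (F g v x i) = dn g \<and> (\<forall>b. b \<prec> g \<longrightarrow> F g v x i |` dn b \<in> T b)) \<and>
      (b \<prec> g \<longrightarrow> x \<in> Tle b \<longrightarrow> nusmall {i\<in>dn th. \<not> F b (v |` dn b) x i \<subseteq>\<^sub>m F g v x i})"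
      using gl unfolding Fg by blast
  qed
qed

lemma inv_limit:
  assumes lim: "is_limit r g" and inv: "\<And>d. d \<prec> g \<Longrightarrow> inv d"
  shows "inv g"
proof -
  have nsc: "g \<noteq> sc b" for b using lim limit_not_sc by blast
  have T1: "dom z = dn g \<and> (\<forall>b. b \<prec> g \<longrightarrow> z |` dn b \<in> T b)" if z: "z \<in> T g" for z
  proof (cases "cofs g")
    case True
    then show ?thesis using z unfolding T_cofs[OF nsc True] by simp
  next
    case False
    then obtain v x i a where *: "z = F g v x i" "v \<in> lv g" "a \<prec> g" "x \<in> T a" "i \<prec> th"
      using z unfolding T_not_cofs[OF lim False] by auto
    show ?thesis unfolding *(1)
      by (rule limit_core(1)[OF lim inv *(2) Tle_I[OF *(4) wo_refl] *(3,5)])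
  qed
  have T2: "z |` dn b \<in> T b" if z: "z \<in> T g" and b: "b \<preceq> g" for z b
  proof (cases "b = g")
    case True
    then show ?thesis using z T1[OF z] by simp
  next
    case False
    then show ?thesis using T1[OF z] wo_le_neq_trans[OF b] by blast
  qed
  have F: "F g v x i \<in> T g" if v: "v \<in> lv g" and x: "x \<in> Tle g" and i: "i \<prec> th" for v x i
  proof (cases "x \<in> T g")
    case True
    then show ?thesis using F_self[of x g v i] T1 by simp
  next
    case False
    then obtain a where a: "a \<prec> g" "x \<in> T a" using x wo_le_neq_trans by (auto simp: Tle_def)
    show ?thesis
    proof (cases "cofs g")
      case True
      show ?thesis unfolding T_cofs[OF nsc True]
        using limit_core(1)[OF lim inv v Tle_I[OF a(2) wo_refl] a(1) i] by simp
    next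
      case False
      have "x \<in> (\<Union>b\<in>dn g. T b)" using a by auto
      then show ?thesis unfolding T_not_cofs[OF lim False] using v i by blast
    qed
  qed
  have "nusmall {i\<in>dn th. \<not> F b (v |` dn b) x i \<subseteq>\<^sub>m F g v x i}"
    if b: "b \<preceq> g" and v: "v \<in> lv g" and x: "x \<in> Tle b" for b v x
  proof (cases "b = g")
    case True
    have "v |` dn g = v" using lv_dom[OF v] by simp
    then have "{i\<in>dn th. \<not> F b (v |` dn b) x i \<subseteq>\<^sub>m F g v x i} = {}" using True by simp
    then show ?thesis by (simp only: nusmall_finite[OF finite.emptyI])
  next
    case False
    then have bg: "b \<prec> g" using b wo_le_neq_trans by blast
    show ?thesis by (rule limit_core(2)[OF lim inv v x bg bg x])
  qed
  then show ?thesis unfolding inv_def using T1 T2 F by simp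
qed

theorem inv_all: "inv g"
proof (induction g rule: wo_less_induct)
  case (1 g)
  show ?case
  proof (cases g rule: ord_cases)
    case zero
    then have "g = zr" using wo_le_less[of zr g] by auto
    then show ?thesis by (simp add: inv_zr)
  next
    case (succ b)
    then show ?thesis using 1 by (simp add: inv_sc)
  next
    case lim
    then show ?thesis using 1 by (rule inv_limit)
  qed
qed

lemmas T_dom = inv_dom[OF inv_all]
  and T_restrict = inv_restrict[OF inv_all]
  and F_in_T = inv_F[OF inv_all]
  and F_incr = inv_small[OF inv_all]

lemma T_extendable: "extendable g"
  by (rule inv_extendable) (rule inv_all)+

lemma T_extend:
  assumes "t \<in> T a" "a \<preceq> g"
  shows "\<exists>e\<in>T g. t \<subseteq>\<^sub>m e"
proof (cases "a = g")
  case True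
  then show ?thesis using assms(1) map_le_refl by blast
next
  case False
  then show ?thesis using T_extendable[of g] assms wo_le_neq_trans unfolding extendable_def by blast
qed

lemma T_nonempty: "T g \<noteq> {}"
  using T_extend[of Map.empty zr g] by (auto simp: T_zr)

section \<open>Sizes of the levels\<close>

lemma small_labels: "small (labels b)"
proof -
  have "small {j. finite (dn j)}" by (rule small_finite_ords)
  moreover have "small {j. j \<prec> b}" using small_dn[of b] by (simp add: underS_def olt_def conj_commute)
  moreover have "small {pr i (the (u b)) |i u. i \<prec> th \<and> u \<in> lv (sc b)}"
  proof -
    have "small ((\<lambda>(i, u). pr i (the (u b))) ` (dn th \<times> lv (sc b)))"
      by (intro small_image small_Sigma small_dn lv_small)
    moreover have "{pr i (the (u b)) |i u. i \<prec> th \<and> u \<in> lv (sc b)} \<subseteq> (\<lambda>(i, u). pr i (the (u b))) ` (dn th \<times> lv (sc b))"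
      by auto
    ultimately show ?thesis by (rule small_subset)
  qed
  ultimately show ?thesis unfolding labels_def Collect_disj_eq by (intro small_Un)
qed

text \<open>The arithmetic assumption counts functions into initial segments; a small X is
  equinumerous with one of them, and the functions are transported along a bijection.\<close>

lemma es_pow_small:
  assumes "small X"
  shows "small (SIGMA t:Collect es. dn t \<rightarrow>\<^sub>E X)"
proof -
  obtain l where "|X| =o |dn l|"
  proof -
    have "\<exists>p. |X| =o Restr r (underS r p) \<and> p \<in> Field r"
      using assms ordLess_iff_ordIso_Restr[OF _ card_of_Well_order, of r X] Card_r
        Card_order_iff_ordLeq_card_of[of r] by (auto simp: card_order_on_def)
    then obtain p where p: "|X| =o Restr r (dn p)" by blast
    have "|Field |X| | =o |Field (Restr r (dn p))|" using p by (rule card_of_cong)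
    then show thesis using that[of p] by (simp add: Field_card_of)
  qed
  then obtain e where e: "bij_betw e X (dn l)" using card_of_ordIso by blast
  show ?thesis
  proof (rule small_inj_on[OF _ _ es_pow[of l]])
    let ?f = "\<lambda>(t, h). (t, restrict (\<lambda>k. e (h k)) (dn t))"
    show "inj_on ?f (SIGMA t:Collect es. dn t \<rightarrow>\<^sub>E X)"
    proof (rule inj_onI)
      fix p q assume pq: "p \<in> (SIGMA t:Collect es. dn t \<rightarrow>\<^sub>E X)" "q \<in> (SIGMA t:Collect es. dn t \<rightarrow>\<^sub>E X)" "?f p = ?f q"
      obtain t h h' where *: "p = (t, h)" "q = (t, h')" using pq(3) by (cases p, cases q) auto
      have h: "h \<in> dn t \<rightarrow>\<^sub>E X" "h' \<in> dn t \<rightarrow>\<^sub>E X" using pq * by auto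
      have "h = h'"
      proof (rule PiE_ext[OF h])
        fix k assume k: "k \<in> dn t"
        have "restrict (\<lambda>k. e (h k)) (dn t) k = restrict (\<lambda>k. e (h' k)) (dn t) k"
          using pq(3) * by simp
        then have "e (h k) = e (h' k)" using k by simp
        then show "h k = h' k" using bij_betw_imp_inj_on[OF e] h k by (meson PiE_mem inj_onD)
      qed
      then show "p = q" using * by simp
    qed
    show "?f ` (SIGMA t:Collect es. dn t \<rightarrow>\<^sub>E X) \<subseteq> (SIGMA t:Collect es. dn t \<rightarrow>\<^sub>E dn l)"
      using bij_betw_imp_surj_on[OF e] by (auto simp: PiE_def Pi_def)
  qed
qed

text \<open>A node on a level in \<open>cofs\<close> is determined by its restrictions to a cofinal
  set, which amounts to a function on some length in \<open>es\<close>. On the other limit levels a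
  triple (v, x, i) determines the node.\<close>

lemma small_T: "small (T g)"
proof (induction g rule: wo_less_induct)
  case (1 g)
  have un: "small (\<Union>b\<in>dn g. T b)" using 1 by (intro small_UN small_dn) simp
  show ?case
  proof (cases "\<exists>b. g = sc b")
    case True
    then obtain b where b: "g = sc b" by blast
    have "small ((\<lambda>(t, j). t(b \<mapsto> j)) ` (T b \<times> labels b))"
      using 1[of b] b by (intro small_image small_Sigma small_labels) simp
    moreover have "T g \<subseteq> (\<lambda>(t, j). t(b \<mapsto> j)) ` (T b \<times> labels b)" unfolding b T_sc by auto
    ultimately show ?thesis by (rule small_subset)
  next
    case nsc: False
    show ?thesis
    proof (cases "cofs g")
      case True
      obtain t X where X: "es t" "cofinal_in r X g" "|X| \<le>o |dn t|" using True unfolding cofs_def by blast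
      obtain e where e: "inj_on e X" "e ` X \<subseteq> dn t" using iffD2[OF card_of_ordLeq X(3)] by blast
      let ?f = "\<lambda>z. (t, restrict (\<lambda>k. if k \<in> e ` X then z |` dn (inv_into X e k) else Map.empty) (dn t))"
      show ?thesis
      proof (rule small_inj_on[OF _ _ es_pow_small[OF small_Un[OF un small_finite[of "{Map.empty}"]]]])
        show "inj_on ?f (T g)"
        proof (rule inj_onI)
          fix z z' assume z: "z \<in> T g" "z' \<in> T g" "?f z = ?f z'"
          have *: "z |` dn x = z' |` dn x" if x: "x \<in> X" for x
          proof -
            have "e x \<in> dn t" using x e by blast
            moreover have "restrict (\<lambda>k. if k \<in> e ` X then z |` dn (inv_into X e k) else Map.empty) (dn t) (e x) =
                restrict (\<lambda>k. if k \<in> e ` X then z' |` dn (inv_into X e k) else Map.empty) (dn t) (e x)"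
              using z(3) by simp
            ultimately show ?thesis using x by (simp add: inv_into_f_f[OF e(1) x])
          qed
          have "z k = z' k" if k: "k \<prec> g" for k
          proof -
            have "sc k \<prec> g" using k nsc sc_le[of k g] wo_le_neq_trans by blast
            then obtain x where "x \<in> X" "k \<prec> x" using X(2) unfolding cofinal_in_def by auto
            then show ?thesis using *[of x] by (metis dn_iff restrict_in)
          qed
          moreover have "z k = z' k" if "\<not> k \<prec> g" for k
            using that T_dom[OF z(1)] T_dom[OF z(2)] by (metis dn_iff domIff)
          ultimately show "z = z'" by blast
        qed
        have "z |` dn (inv_into X e k) \<in> (\<Union>b\<in>dn g. T b)" if "z \<in> T g" "k \<in> e ` X" for z k
        proof -
          have "inv_into X e k \<prec> g" using inv_into_into[OF that(2)] X(2) unfolding cofinal_in_def by auto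
          then show ?thesis using T_restrict[OF that(1)] wo_less_imp_le dn_iff by blast
        qed
        then have "(if k \<in> e ` X then z |` dn (inv_into X e k) else Map.empty) \<in> (\<Union>b\<in>dn g. T b) \<union> {Map.empty}"
          if "z \<in> T g" for z k using that by simp
        then show "?f ` T g \<subseteq> (SIGMA t:Collect es. dn t \<rightarrow>\<^sub>E (\<Union>b\<in>dn g. T b) \<union> {Map.empty})"
          using X(1) by (intro image_subsetI SigmaI restrict_PiE_iff[THEN iffD2] ballI) simp_all
      qed simp
    next
      case False
      have lim: "is_limit r g"
      proof (cases g rule: ord_cases)
        case zero
        then have "g = zr" using wo_le_less[of zr g] by auto
        then show ?thesis using False cofs_zr by simp
      qed (use nsc in auto)
      have "small ((\<lambda>(v, x, i). F g v x i) ` (lv g \<times> (\<Union>b\<in>dn g. T b) \<times> dn th))"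
        by (intro small_image small_Sigma un lv_small small_dn)
      moreover have "T g \<subseteq> (\<lambda>(v, x, i). F g v x i) ` (lv g \<times> (\<Union>b\<in>dn g. T b) \<times> dn th)"
      proof
        fix z assume "z \<in> T g"
        then obtain v x i where "z = F g v x i" "v \<in> lv g" "x \<in> (\<Union>b\<in>dn g. T b)" "i \<prec> th"
          unfolding T_not_cofs[OF lim False] by blast
        then show "z \<in> (\<lambda>(v, x, i). F g v x i) ` (lv g \<times> (\<Union>b\<in>dn g. T b) \<times> dn th)"
          by (intro image_eqI[of _ _ "(v, x, i)"]) simp_all
      qed
      ultimately show ?thesis by (rule small_subset)
    qed
  qed
qed

end

section \<open>The tree and its ascent path\<close>

context ascent_setup
begin

definition TT where "TT = (\<Union>g. T g)"

lemma TT_I: "x \<in> T g \<Longrightarrow> x \<in> TT"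
  by (auto simp: TT_def)

lemma TT_dom: "x \<in> TT \<Longrightarrow> dom x = dn g \<Longrightarrow> x \<in> T g"
  unfolding TT_def using T_dom by (metis UN_E dn_inj)

lemma TT_level: "level r TT a = T a"
  unfolding level_def using TT_dom TT_I T_dom by blast

lemma TT_ex: "x \<in> TT \<Longrightarrow> \<exists>a. x \<in> T a \<and> dom x = dn a"
  unfolding TT_def using T_dom by blast

lemma TT_down: "down_closed r TT"
  unfolding down_closed_def
proof (intro conjI ballI impI subsetI)
  fix x assume "x \<in> TT"
  then show "x \<in> seqs r" using TT_ex[of x] unfolding seqs_def by blast
next
  fix y x assume y: "y \<in> TT" and x: "x \<in> seqs r" and le: "x \<subseteq>\<^sub>m y"
  obtain g where g: "y \<in> T g" "dom y = dn g" using TT_ex[OF y] by blast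
  obtain a where a: "dom x = dn a" using x by (auto simp: seqs_def)
  have "dom x \<subseteq> dom y" by (rule map_le_implies_dom_le[OF le])
  then have "a \<preceq> g" using a g by simp
  then have "y |` dn a \<in> T a" using T_restrict[OF g(1)] by blast
  then show "x \<in> TT" using map_le_restrict[OF le a] TT_I by simp
qed

lemma TT_tree: "kappa_tree r TT"
proof -
  have "{x \<in> TT. dom x = dn a} = T a" for a using TT_level[of a] by (simp add: level_def)
  then show ?thesis unfolding kappa_tree_def kappa_tree_gen_def using T_nonempty small_T by simp
qed

lemma TT_extend_label: "x \<in> T a \<Longrightarrow> finite (dn i) \<or> i \<prec> a \<Longrightarrow> x(a \<mapsto> i) \<in> T (sc a)"
  unfolding T_sc labels_def by blast

lemma TT_prolific: "prolific r TT"
  unfolding prolific_def TT_level using TT_extend_label TT_I by blast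

text \<open>Unless some member has the largest level, the supremum of the levels has a cofinal
  subset of size at most d. It is therefore a level in \<open>cofs\<close>, and the union of the
  sequence is one of its nodes.\<close>

lemma TT_complete:
  assumes es: "es d" and s: "\<And>i. i \<prec> d \<Longrightarrow> s i \<in> TT"
    and mono: "\<And>i j. i \<prec> d \<Longrightarrow> j \<prec> d \<Longrightarrow> i \<prec> j \<Longrightarrow> s i \<subseteq>\<^sub>m s j"
  shows "\<exists>t\<in>TT. \<forall>i\<in>dn d. s i \<subseteq>\<^sub>m t"
proof -
  define l where "l i = (SOME a. s i \<in> T a \<and> dom (s i) = dn a)" for i
  have l: "s i \<in> T (l i)" "dom (s i) = dn (l i)" if "i \<prec> d" for i
    using someI_ex[OF TT_ex[OF s[OF that]]] unfolding l_def by blast+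
  have cmp: "s i \<subseteq>\<^sub>m s j" if "i \<prec> d" "j \<prec> d" "l i \<preceq> l j" for i j
  proof -
    consider "i \<prec> j" | "i = j" | "j \<prec> i" using wo_neq_iff by blast
    then show ?thesis
    proof cases
      case 3
      then have ji: "s j \<subseteq>\<^sub>m s i" using mono that by blast
      have "dom (s j) \<subseteq> dom (s i)" by (rule map_le_implies_dom_le[OF ji])
      then have "l j = l i" using l that wo_antisym by simp
      then have "s j = s i" using map_le_dom_eq[OF ji] l that by simp
      then show ?thesis by simp
    qed (use mono that in auto)
  qed
  show ?thesis
  proof (cases "\<exists>m. m \<prec> d \<and> (\<forall>i. i \<prec> d \<longrightarrow> l i \<preceq> l m)")
    case True
    then obtain m where "m \<prec> d" "\<And>i. i \<prec> d \<Longrightarrow> l i \<preceq> l m" by blast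
    then show ?thesis using cmp s by (intro bexI[of _ "s m"]) auto
  next
    case False
    then have nomax: "\<exists>j. j \<prec> d \<and> l i \<prec> l j" if "i \<prec> d" for i using that wo_not_le by blast
    obtain b where b: "\<And>x. x \<in> l ` dn d \<Longrightarrow> x \<prec> b" using small_bdd[OF small_image[OF small_dn]] by blast
    define g where "g = least (\<lambda>g. \<forall>i. i \<prec> d \<longrightarrow> l i \<prec> g)"
    have lg: "l i \<prec> g" if "i \<prec> d" for i
      using wo_LeastI[of "\<lambda>g. \<forall>i. i \<prec> d \<longrightarrow> l i \<prec> g" b] b that unfolding g_def by simp
    have unb: "\<exists>i. i \<prec> d \<and> e \<prec> l i" if e: "e \<prec> g" for e
    proof -
      have "\<not> (\<forall>i. i \<prec> d \<longrightarrow> l i \<prec> e)"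
        using wo_not_less_Least[OF e[unfolded g_def]] .
      then obtain i where "i \<prec> d" "e \<preceq> l i" using wo_not_less by blast
      then show ?thesis using nomax[of i] wo_le_less_trans by blast
    qed
    have nsc: "g \<noteq> sc c" for c
    proof
      assume "g = sc c"
      then obtain i where "i \<prec> d" "c \<prec> l i" using unb[of c] by auto
      then show False using lg[of i] \<open>g = sc c\<close> wo_leD by auto
    qed
    have "cofinal_in r (l ` dn d) g"
      unfolding cofinal_in_def using lg unb wo_less_imp_le by fastforce
    then have "cofs g" unfolding cofs_def using es card_of_image by blast
    note Tg = T_cofs[OF nsc this]
    \<comment> \<open>The sequence may repeat nodes, so it is reindexed by levels; members on the
      same level coincide by \<open>cmp\<close>.\<close>
    define h where "h a = s (SOME i. i \<prec> d \<and> l i = a)" for a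
    have h: "h (l i) = s i" if "i \<prec> d" for i
    proof -
      let ?k = "SOME k. k \<prec> d \<and> l k = l i"
      have k: "?k \<prec> d \<and> l ?k = l i" by (rule someI[of _ i]) (simp add: that)
      have "s ?k \<subseteq>\<^sub>m s i" using cmp k that by simp
      moreover have "dom (s ?k) = dom (s i)" using l(2)[of ?k] l(2)[OF that] k by simp
      ultimately show ?thesis unfolding h_def by (rule map_le_dom_eq)
    qed
    have c: "l ` dn d \<subseteq> dn g" using lg by auto
    have u: "\<exists>x\<in>l ` dn d. e \<prec> x" if "e \<prec> g" for e using unb[OF that] by auto
    have m: "h a \<in> T a" if "a \<in> l ` dn d" for a using that h l(1) by auto
    have ch: "h a \<subseteq>\<^sub>m h a'" if "a \<in> l ` dn d" "a' \<in> l ` dn d" "a \<prec> a'" for a a'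
      using that h cmp wo_less_imp_le by auto
    note gl = glue[of g "l ` dn d" h, OF inv_all c u m ch]
    have "mU (h ` l ` dn d) \<in> T g" unfolding Tg using gl(1,2) by simp
    moreover have "s i \<subseteq>\<^sub>m mU (h ` l ` dn d)" if "i \<in> dn d" for i
      using gl(3)[of "l i"] h[of i] that by simp
    ultimately show ?thesis using TT_I by blast
  qed
qed

section \<open>The ascent path above the root\<close>

definition lev where "lev u = (THE a. dom u = dn a)"

lemma lev: "dom u = dn a \<Longrightarrow> lev u = a"
  unfolding lev_def by (rule the_equality) simp_all

definition ascent where "ascent u i = F (lev u) u Map.empty i"

lemma empty_Tle: "Map.empty \<in> Tle g"
  by (rule Tle_I[of _ zr]) (simp_all add: T_zr)

lemma U_lv: "u \<in> U \<Longrightarrow> \<exists>a. u \<in> lv a"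
  using U_down by (auto simp: down_closed_def seqs_def level_def)

lemma ascent_lv: "u \<in> lv a \<Longrightarrow> ascent u i = F a u Map.empty i"
  using lv_dom lev unfolding ascent_def by metis

lemma filt_I:
  assumes "t \<preceq> th" "Z \<subseteq> dn t" "nusmall {i\<in>dn th. i \<notin> Z \<and> i \<prec> t}"
  shows "Z \<in> filt r nu t"
proof -
  have "dn t \<subseteq> dn th" using assms(1) by simp
  then have "dn t - Z = {i\<in>dn th. i \<notin> Z \<and> i \<prec> t}" unfolding dn_iff[symmetric] by blast
  then show ?thesis using assms(2,3) unfolding filt_def by simp
qed

text \<open>Let k be the first place where u and v differ. The labels appended at k record u(k) and
  v(k), and for almost all i they are still visible at level a.\<close>

lemma ascent_distinct:
  assumes u: "u \<in> lv a" and v: "v \<in> lv a" and ne: "u \<noteq> v"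
  shows "nusmall {i\<in>dn th. ascent u i = ascent v i}"
proof -
  define k where "k = least (\<lambda>k. u k \<noteq> v k)"
  have "\<exists>k. u k \<noteq> v k" using ne by (simp add: fun_eq_iff)
  then have k1: "u k \<noteq> v k" unfolding k_def by (rule wo_LeastI_ex)
  have k2: "u j = v j" if "j \<prec> k" for j
    using wo_not_less_Least[of j "\<lambda>k. u k \<noteq> v k"] that unfolding k_def by blast
  note k = k1 k2
  have "k \<in> dn a" using k(1) lv_dom[OF u] lv_dom[OF v] by (metis domIff)
  then have ska: "sc k \<preceq> a" by simp
  have eq: "u |` dn k = v |` dn k"
  proof
    fix j show "(u |` dn k) j = (v |` dn k) j" using k(2) by (cases "j \<in> dn k") simp_all
  qed
  have ks: "k \<prec> sc k" by simp
  have uk: "\<exists>p. u k = Some p" "\<exists>p. v k = Some p"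
    using \<open>k \<in> dn a\<close> lv_dom[OF u] lv_dom[OF v] by blast+
  then have the_ne: "the (u k) \<noteq> the (v k)" using k(1) by auto
  have Fs: "F (sc k) (w |` dn (sc k)) Map.empty i k = Some (pr i (the (w k)))" for w i
  proof -
    have "dom (Map.empty :: 'k node) \<noteq> dn (sc k)" using ks by (metis dn_iff dom_empty empty_iff)
    from F_sc[OF this] show ?thesis by simp
  qed
  have ns: "nusmall ({i\<in>dn th. \<not> F (sc k) (u |` dn (sc k)) Map.empty i \<subseteq>\<^sub>m F a u Map.empty i} \<union>
      {i\<in>dn th. \<not> F (sc k) (v |` dn (sc k)) Map.empty i \<subseteq>\<^sub>m F a v Map.empty i})"
    using F_incr[OF ska u empty_Tle] F_incr[OF ska v empty_Tle] by (rule nusmall_Un)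
  show ?thesis
  proof (rule nusmall_subset[OF ns], rule subsetI, rule ccontr)
    fix i assume i: "i \<in> {i\<in>dn th. ascent u i = ascent v i}"
    assume "i \<notin> {i\<in>dn th. \<not> F (sc k) (u |` dn (sc k)) Map.empty i \<subseteq>\<^sub>m F a u Map.empty i} \<union>
      {i\<in>dn th. \<not> F (sc k) (v |` dn (sc k)) Map.empty i \<subseteq>\<^sub>m F a v Map.empty i}"
    then have "F (sc k) (u |` dn (sc k)) Map.empty i \<subseteq>\<^sub>m F a u Map.empty i"
      "F (sc k) (v |` dn (sc k)) Map.empty i \<subseteq>\<^sub>m F a v Map.empty i" using i by blast+
    then have "F a u Map.empty i k = Some (pr i (the (u k)))" "F a v Map.empty i k = Some (pr i (the (v k)))"
      using Fs[of u i] Fs[of v i] unfolding map_le_def by (metis domI)+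
    moreover have "F a u Map.empty i = F a v Map.empty i"
      using i ascent_lv[OF u] ascent_lv[OF v] by simp
    ultimately show False using the_ne by simp
  qed
qed

lemma ascent_sless:
  assumes u: "u \<in> U" and v: "v \<in> U" and uv: "sless u v"
  shows "nusmall {i\<in>dn th. \<not> sless (ascent u i) (ascent v i)}"
proof -
  obtain a b where a: "u \<in> lv a" and b: "v \<in> lv b" using U_lv u v by blast
  have da: "dom u = dn a" and db: "dom v = dn b" using a b lv_dom by blast+
  have le: "u \<subseteq>\<^sub>m v" "u \<noteq> v" using uv by (auto simp: sless_def)
  have "dom u \<subseteq> dom v" by (rule map_le_implies_dom_le[OF le(1)])
  then have ab: "a \<preceq> b" using da db by simp
  have "a \<noteq> b" using map_le_dom_eq[OF le(1)] le(2) da db by auto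
  have r: "v |` dn a = u" by (rule map_le_restrict[OF le(1) da])
  have "{i\<in>dn th. \<not> sless (ascent u i) (ascent v i)} \<subseteq>
      {i\<in>dn th. \<not> F a (v |` dn a) Map.empty i \<subseteq>\<^sub>m F b v Map.empty i}"
  proof (intro subsetI)
    fix i assume i: "i \<in> {i\<in>dn th. \<not> sless (ascent u i) (ascent v i)}"
    then have "F a u Map.empty i \<in> T a" "F b v Map.empty i \<in> T b"
      using F_in_T[OF a empty_Tle] F_in_T[OF b empty_Tle] by simp_all
    then have "F a u Map.empty i \<noteq> F b v Map.empty i" using T_dom \<open>a \<noteq> b\<close> by (metis dn_inj)
    then show "i \<in> {i\<in>dn th. \<not> F a (v |` dn a) Map.empty i \<subseteq>\<^sub>m F b v Map.empty i}"
      using i unfolding r ascent_lv[OF a] ascent_lv[OF b] sless_def by simp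
  qed
  then show ?thesis by (rule nusmall_subset[OF F_incr[OF ab b empty_Tle]])
qed

text \<open>The path was built for th many indices; on an initial segment t the exceptional sets
  only shrink, also when t is smaller than nu.\<close>

theorem TT_ascent:
  assumes t: "t \<preceq> th"
  shows "injective_ascent_path r nu t U TT ascent"
  unfolding injective_ascent_path_def ascent_path_def
proof (intro conjI ballI allI impI)
  fix u i assume u: "u \<in> U" and i: "i \<in> dn t"
  obtain a where a: "u \<in> lv a" using U_lv u by blast
  have "i \<prec> th" using i t wo_less_le_trans by auto
  then have "ascent u i \<in> T a" using F_in_T[OF a empty_Tle] ascent_lv[OF a] by simp
  then show "ascent u i \<in> TT" "dom (ascent u i) = dom u" using TT_I T_dom lv_dom[OF a] by simp_all
next
  fix u v assume "u \<in> U" "v \<in> U" "sless u v"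
  note sl = ascent_sless[OF this]
  show "{i\<in>dn t. sless (ascent u i) (ascent v i)} \<in> filt r nu t"
    by (intro filt_I[OF t] nusmall_subset[OF sl]) auto
next
  fix u v assume u: "u \<in> U" and v: "v \<in> U" and *: "u \<noteq> v \<and> dom u = dom v"
  obtain a where a: "u \<in> lv a" using U_lv u by blast
  have "v \<in> lv a" using v * lv_dom[OF a] by (simp add: level_def)
  from ascent_distinct[OF a this] * have di: "nusmall {i\<in>dn th. ascent u i = ascent v i}" by blast
  show "{i\<in>dn t. ascent u i \<noteq> ascent v i} \<in> filt r nu t"
    by (intro filt_I[OF t] nusmall_subset[OF di]) auto
next
  fix b :: "'k \<Rightarrow> 'k" assume b: "\<forall>a. branch_restr r b a \<in> U"
  \<comment> \<open>At level one the values consist of a single label, which contains i; there the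
    path is injective without exceptions.\<close>
  let ?u = "branch_restr r b (sc zr)"
  have "dom ?u = dn (sc zr)" by (auto simp: branch_restr_def split: if_splits)
  then have u: "?u \<in> lv (sc zr)" using b by (simp add: level_def)
  have "inj_on (ascent ?u) (dn t)"
  proof (rule inj_onI)
    fix i j assume ij: "ascent ?u i = ascent ?u j"
    have "zr \<in> dn (sc zr)" by simp
    then have ne: "dom (Map.empty :: 'k node) \<noteq> dn (sc zr)" by (metis dom_empty empty_iff)
    have "ascent ?u i zr = Some (pr i (the (?u zr)))" for i
      unfolding ascent_lv[OF u] F_sc[OF ne] by simp
    then show "i = j" using ij by (metis option.inject pr_inj)
  qed
  moreover have "dn t \<in> filt r nu t"
    by (intro filt_I[OF t]) (auto intro: nusmall_finite)
  ultimately show "\<exists>a. \<exists>I\<in>filt r nu t. inj_on (ascent (branch_restr r b a)) I" by blast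
qed

end

section \<open>Sealing antichains of derived trees\<close>

text \<open>\<open>hitting\<close> is the proxy principle at levels that are also closed under f and
  outside \<open>cofs\<close>. \<open>guessing\<close> yields only the members of D with code below
  g; closure of g under bounds on codes brings in those that are wanted.\<close>

locale souslin_setup = ascent_setup r nu th es U C bb gt gD
  for r :: "'k rel" and nu th es U C bb gt gD +
  fixes St :: "'k set" and code :: "('k \<Rightarrow> 'k node) \<Rightarrow> 'k"
    and en :: "'k \<Rightarrow> 'k \<Rightarrow> ('k node \<times> 'k node \<times> 'k) option"
  assumes St_range: "\<And>a. a \<in> St \<Longrightarrow> lv a \<subseteq> bb a ` restr_levels r U (C a)"
    and hitting: "\<And>A f b. (\<And>i b. \<exists>c\<in>A i. b \<preceq> c) \<Longrightarrow>
      \<exists>a\<in>St. b \<prec> a \<and> is_limit r a \<and> (\<forall>x. x \<prec> a \<longrightarrow> f x \<prec> a) \<and> \<not> cofs a \<and>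
        (\<forall>i. i \<prec> a \<longrightarrow> is_sup r {b\<in>C a. succ_omega r {c\<in>C a. b \<preceq> c} \<subseteq> A i} a)"
    and guessing: "\<And>s D f b t t'. dom s = dn t \<Longrightarrow> ran s \<subseteq> seqs r \<times> seqs r \<times> UNIV \<Longrightarrow>
      (\<And>z j. z \<in> D \<Longrightarrow> z j \<in> seqs r) \<Longrightarrow> (\<And>z j. z \<in> D \<Longrightarrow> j \<notin> dn t' \<Longrightarrow> z j = Map.empty) \<Longrightarrow>
      \<exists>g. b \<prec> g \<and> is_limit r g \<and> (\<forall>x. x \<prec> g \<longrightarrow> f x \<prec> g) \<and>
        gt g = s \<and> gD g = {z\<in>D. code z \<prec> g}"
    and en_surj: "\<And>s t. dom s = dn t \<Longrightarrow> ran s \<subseteq> seqs r \<times> seqs r \<times> UNIV \<Longrightarrow> s \<in> range en"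
begin

lemma T_seqs: "x \<in> T a \<Longrightarrow> x \<in> seqs r"
  using T_dom by (auto simp: seqs_def)

text \<open>Whatever the process has sealed at a point of the club is retained in the path at g,
  since that path is the union of the stages.\<close>

lemma G_below_F:
  assumes lim: "is_limit r g" and good: "good g" and d: "d \<in> C g" and v: "v \<in> lv g"
    and x: "x \<in> Tle d" and i: "i \<prec> th"
  shows "G d (C g) (bb g) (v |` dn d) x i \<in> T d"
    and "G d (C g) (bb g) (v |` dn d) x i \<subseteq>\<^sub>m F g v x i"
proof -
  have dg: "d \<prec> g" using C_lt d by blast
  have al: "\<And>e. e \<in> C g \<Longrightarrow> x \<in> Tle e \<Longrightarrow> (\<forall>i. i \<prec> th \<longrightarrow> G e (C g) (bb g) (v |` dn e) x i \<in> T e) \<and>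
    nusmall {i\<in>dn th. G e (C g) (bb g) (v |` dn e) x i \<noteq> F e (v |` dn e) x i} \<and>
    (\<forall>f\<in>C g. f \<prec> e \<longrightarrow> x \<in> Tle f \<longrightarrow> (\<forall>i. i \<prec> th \<longrightarrow>
       G f (C g) (bb g) ((v |` dn e) |` dn f) x i \<subseteq>\<^sub>m G e (C g) (bb g) (v |` dn e) x i))"
    using G_along[OF lim good inv_all] lv_restrict[OF v] C_lt wo_less_imp_le by blast
  show "G d (C g) (bb g) (v |` dn d) x i \<in> T d" using al[OF d x] i by blast
  have Tle: "dom x \<subseteq> dn e \<longleftrightarrow> x \<in> Tle e" if "e \<in> C g" for e
    using dom_Tle_iff[OF inv_all Tle_mono[OF x wo_less_imp_le[OF dg]] wo_less_imp_le[OF C_lt[OF that]]] .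
  have ne: "dom x \<noteq> dn g"
  proof
    assume "dom x = dn g"
    then have "dn g \<subseteq> dn d" using Tle[OF d] x by simp
    then show False using dg wo_leD by simp
  qed
  let ?h = "\<lambda>e. G e (C g) (bb g) (v |` dn e) x i" and ?c = "{e\<in>C g. dom x \<subseteq> dn e}"
  have ch: "?h e \<subseteq>\<^sub>m ?h f" if ef: "e \<in> ?c" "f \<in> ?c" "e \<prec> f" for e f
  proof -
    have "e \<in> C g" "f \<in> C g" "x \<in> Tle e" "x \<in> Tle f" using ef Tle by blast+
    then have "G e (C g) (bb g) ((v |` dn f) |` dn e) x i \<subseteq>\<^sub>m ?h f" using al ef(3) i by blast
    then show ?thesis unfolding restrict_dn[OF wo_less_imp_le[OF ef(3)]] .
  qed
  have "?h d \<subseteq>\<^sub>m mU (?h ` ?c)"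
  proof (rule mU_chain(1))
    fix p q assume "p \<in> ?h ` ?c" "q \<in> ?h ` ?c"
    then obtain e f where ef: "e \<in> ?c" "f \<in> ?c" "p = ?h e" "q = ?h f" by blast
    then show "p \<subseteq>\<^sub>m q \<or> q \<subseteq>\<^sub>m p" using ch[OF ef(1,2)] ch[OF ef(2,1)] wo_neq_iff[of e f] by auto
  next
    have "d \<in> ?c" using d Tle[OF d] x by blast
    then show "?h d \<in> ?h ` ?c" by blast
  qed
  then show "G d (C g) (bb g) (v |` dn d) x i \<subseteq>\<^sub>m F g v x i" unfolding F_good[OF lim good ne] .
qed

text \<open>Otherwise the values of h would form a cofinal subset of a of size at most a length in
  \<open>es\<close>.\<close>

lemma not_cofs_bound:
  assumes "\<not> cofs a" "es t" "\<And>j. j \<prec> t \<Longrightarrow> h j \<prec> a"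
  shows "\<exists>b. b \<prec> a \<and> (\<forall>j. j \<prec> t \<longrightarrow> h j \<prec> b)"
proof -
  have "\<not> cofinal_in r (h ` dn t) a" using assms(1,2) card_of_image unfolding cofs_def by blast
  moreover have "h ` dn t \<subseteq> dn a" using assms(3) by auto
  ultimately obtain b where "b \<prec> a" "\<And>x. x \<in> h ` dn t \<Longrightarrow> \<not> b \<preceq> x" unfolding cofinal_in_def by blast
  then show ?thesis using wo_not_le by (intro exI[of _ b]) auto
qed

end

section \<open>A fixed derived tree and its dense sets\<close>

locale derived = souslin_setup +
  fixes t b0 :: 'a and w :: "'a \<Rightarrow> 'a node"
  assumes t_pos: "zr \<prec> t" and t_es: "es t" and t_nu: "t \<prec> nu"
    and w_T: "\<And>j. j \<prec> t \<Longrightarrow> w j \<in> T b0" and w_inj: "inj_on w (dn t)"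
begin

abbreviation X where "X \<equiv> derived_tree r TT t w"

definition below where "below f h \<longleftrightarrow> (\<forall>j. j \<prec> t \<longrightarrow> f j \<subseteq>\<^sub>m h j)"
definition XL where "XL a = {f\<in>X. \<forall>j. j \<prec> t \<longrightarrow> f j \<in> T a}"
definition lvl where "lvl f = lev (f zr)"

lemma X_ex: assumes "f \<in> X" shows "\<exists>a. f \<in> XL a"
proof -
  obtain a where a: "\<And>j. j \<prec> t \<Longrightarrow> f j \<in> TT \<and> dom (f j) = dn a"
    using assms unfolding derived_tree_def by auto
  then have "f \<in> XL a" unfolding XL_def using assms TT_dom by blast
  then show ?thesis by blast
qed

lemma XL_dom: "f \<in> XL a \<Longrightarrow> j \<prec> t \<Longrightarrow> dom (f j) = dn a"
  and XL_T: "f \<in> XL a \<Longrightarrow> j \<prec> t \<Longrightarrow> f j \<in> T a"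
  and XL_X: "f \<in> XL a \<Longrightarrow> f \<in> X"
  unfolding XL_def using T_dom by blast+

lemma XL_lvl: "f \<in> XL a \<Longrightarrow> lvl f = a"
  unfolding lvl_def by (rule lev[OF XL_dom[OF _ t_pos]])

lemma X_lvl:
  assumes "f \<in> X"
  shows "f \<in> XL (lvl f)"
proof -
  obtain a where "f \<in> XL a" using X_ex[OF assms] by blast
  then show ?thesis using XL_lvl by simp
qed

lemma X_level:
  assumes "f \<in> X"
  shows "derived_level r t f a \<longleftrightarrow> f \<in> XL a"
proof
  assume "derived_level r t f a"
  then have "dom (f zr) = dn a" using t_pos by (simp add: derived_level_def)
  then have "lvl f = a" unfolding lvl_def by (rule lev)
  then show "f \<in> XL a" using X_lvl[OF assms] by simp
qed (simp add: derived_level_def XL_dom)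

lemma X_off: "f \<in> X \<Longrightarrow> \<not> j \<prec> t \<Longrightarrow> f j = Map.empty"
  unfolding derived_tree_def by auto

lemma X_w: "f \<in> X \<Longrightarrow> j \<prec> t \<Longrightarrow> f j \<subseteq>\<^sub>m w j \<or> w j \<subseteq>\<^sub>m f j"
  unfolding derived_tree_def by auto

lemma w_dom: "j \<prec> t \<Longrightarrow> dom (w j) = dn b0"
  using w_T T_dom by blast

lemma XL_I:
  assumes "\<And>j. j \<prec> t \<Longrightarrow> f j \<in> T a" "\<And>j. \<not> j \<prec> t \<Longrightarrow> f j = Map.empty"
    "\<And>j. j \<prec> t \<Longrightarrow> f j \<subseteq>\<^sub>m w j \<or> w j \<subseteq>\<^sub>m f j"
  shows "f \<in> XL a"
proof -
  have "\<forall>i\<in>dn t. f i \<in> TT \<and> dom (f i) = dn a" using assms(1) TT_I[of _ a] T_dom[of _ a] by simp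
  then have "f \<in> X" unfolding derived_tree_def using assms(2,3) by auto
  then show ?thesis unfolding XL_def using assms(1) by blast
qed

lemma XL_above_w:
  assumes "f \<in> XL a" "b0 \<preceq> a" "j \<prec> t"
  shows "w j \<subseteq>\<^sub>m f j"
proof -
  have "w j = f j" if "f j \<subseteq>\<^sub>m w j"
  proof -
    have "dom (f j) \<subseteq> dom (w j)" by (rule map_le_implies_dom_le[OF that])
    then have "a \<preceq> b0" using XL_dom[OF assms(1,3)] w_dom[OF assms(3)] by simp
    then have "dom (f j) = dom (w j)" using wo_antisym assms(2) XL_dom[OF assms(1,3)] w_dom[OF assms(3)] by blast
    then show ?thesis using map_le_dom_eq[OF that] by simp
  qed
  then show ?thesis using X_w[OF XL_X[OF assms(1)] assms(3)] map_le_refl by metis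
qed

text \<open>From level b0 on the coordinates extend the distinct nodes w j. This separation supplies
  the uniqueness premise of \<open>G_seal\<close>.\<close>

lemma XL_inj:
  assumes "f \<in> XL a" "b0 \<preceq> a" "j \<prec> t" "k \<prec> t" "f j = f k"
  shows "j = k"
proof -
  have "f j |` dn b0 = w j" by (rule map_le_restrict[OF XL_above_w[OF assms(1,2,3)] w_dom[OF assms(3)]])
  moreover have "f k |` dn b0 = w k"
    by (rule map_le_restrict[OF XL_above_w[OF assms(1,2,4)] w_dom[OF assms(4)]])
  ultimately have "w j = w k" using assms(5) by simp
  then show ?thesis using w_inj assms(3,4) unfolding inj_on_def by simp
qed

lemma small_XL: "small (XL a)"
proof (rule small_inj_on[OF _ _ es_pow_small[OF small_T]])
  let ?f = "\<lambda>f. (t, restrict f (dn t))"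
  show "inj_on ?f (XL a)"
  proof (rule inj_onI)
    fix f h assume *: "f \<in> XL a" "h \<in> XL a" "?f f = ?f h"
    show "f = h"
    proof
      fix j show "f j = h j"
      proof (cases "j \<prec> t")
        case True
        have "restrict f (dn t) j = restrict h (dn t) j" using *(3) by simp
        then show ?thesis using True by simp
      next
        case False
        then show ?thesis using X_off[OF XL_X[OF *(1)] False] X_off[OF XL_X[OF *(2)] False] by simp
      qed
    qed
  qed
  show "?f ` XL a \<subseteq> (SIGMA s:Collect es. dn s \<rightarrow>\<^sub>E T a)"
    using t_es XL_T by (intro image_subsetI SigmaI restrict_PiE_iff[THEN iffD2] ballI) simp_all
qed

lemma XL_restrict:
  assumes "f \<in> XL a" "d \<preceq> a" "\<And>j. j \<prec> t \<Longrightarrow> h j = f j |` dn d" "\<And>j. \<not> j \<prec> t \<Longrightarrow> h j = Map.empty"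
  shows "h \<in> XL d"
proof (rule XL_I)
  fix j assume j: "j \<prec> t"
  show "h j \<in> T d" unfolding assms(3)[OF j] by (rule T_restrict[OF XL_T[OF assms(1) j] assms(2)])
  have hf: "h j \<subseteq>\<^sub>m f j" unfolding assms(3)[OF j] by (rule restrict_map_le)
  have dh: "dom (h j) = dn d" unfolding assms(3)[OF j] by (rule dom_restrict_dn[OF XL_dom[OF assms(1) j] assms(2)])
  from X_w[OF XL_X[OF assms(1)] j] show "h j \<subseteq>\<^sub>m w j \<or> w j \<subseteq>\<^sub>m h j"
  proof
    assume "f j \<subseteq>\<^sub>m w j"
    then show ?thesis using map_le_trans[OF hf] by blast
  next
    assume wf: "w j \<subseteq>\<^sub>m f j"
    have "dom (h j) \<subseteq> dom (w j) \<or> dom (w j) \<subseteq> dom (h j)"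
      using wo_linear[of d b0] dh w_dom[OF j] by simp
    then show ?thesis using map_le_comparable[OF hf wf] map_le_comparable[OF wf hf] by blast
  qed
qed (rule assms(4))

lemma below_XL:
  assumes f: "f \<in> XL a" and h: "h \<in> XL b" and "below f h"
  shows "a \<preceq> b"
proof -
  have "dom (f zr) \<subseteq> dom (h zr)"
    by (rule map_le_implies_dom_le) (use assms(3) t_pos below_def in blast)
  then show ?thesis using XL_dom[OF f t_pos] XL_dom[OF h t_pos] by simp
qed

lemma below_less:
  assumes f: "f \<in> XL a" and h: "h \<in> XL b" and "below f h" "a \<noteq> b"
  shows "derived_less r t f h"
  unfolding derived_less_def sless_def
proof (intro ballI conjI)
  fix j assume "j \<in> dn t"
  then have j: "j \<prec> t" by simp
  then show "f j \<subseteq>\<^sub>m h j" using assms(3) by (simp add: below_def)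
  show "f j \<noteq> h j" using XL_dom[OF f j] XL_dom[OF h j] assms(4) by auto
qed

lemma less_below: "derived_less r t f h \<Longrightarrow> below f h"
  unfolding derived_less_def below_def sless_def by simp

text \<open>The coordinates of a tuple f on a suitable level al are path values F al u x i with u =
  bb al y, and the triples (y, x, i) form a task bounded below al. At some point of C al this task
  and D are guessed together. There the process moved all coordinates into one member of D, which f
  therefore extends.\<close>

lemma sealing:
  assumes D: "D \<subseteq> X" and dense: "\<And>f. f \<in> X \<Longrightarrow> \<exists>z\<in>D. below f z"
  shows "\<exists>a. \<forall>f\<in>XL a. \<exists>z\<in>D. lvl z \<prec> a \<and> below z f"
proof -
  define de where "de f = (SOME z. z \<in> D \<and> below f z)" for f
  have de: "de f \<in> D \<and> below f (de f)" if "f \<in> X" for f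
    using someI_ex[of "\<lambda>z. z \<in> D \<and> below f z"] dense[OF that] unfolding de_def by blast
  obtain g1 where g1: "\<And>a f. f \<in> XL a \<Longrightarrow> lvl (de f) \<prec> g1 a"
    using bounding_function[of XL "\<lambda>f. lvl (de f)", OF small_XL] by blast
  obtain g2 where g2: "\<And>a f. f \<in> XL a \<Longrightarrow> code f \<prec> g2 a"
    using bounding_function[of XL code, OF small_XL] by blast
  \<comment> \<open>The pointwise maximum: one closure condition controls both the levels of the
    extensions \<open>de f\<close> and the codes of tuples.\<close>
  define g12 where "g12 x = (if g1 x \<preceq> g2 x then g2 x else g1 x)" for x
  have g12: "g12 x \<prec> g \<Longrightarrow> g1 x \<prec> g \<and> g2 x \<prec> g" for x g
    unfolding g12_def using wo_le_less_trans wo_less_trans wo_not_le by (auto split: if_splits)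
  define tasks :: "('a \<Rightarrow> ('a node \<times> 'a node \<times> 'a) option) set"
    where "tasks = {s. (\<exists>t. dom s = dn t) \<and> ran s \<subseteq> seqs r \<times> seqs r \<times> UNIV}"
  define A where "A n = (if en n \<in> tasks then {g. is_limit r g \<and> (\<forall>x. x \<prec> g \<longrightarrow> g12 x \<prec> g) \<and>
      gt g = en n \<and> gD g = {z\<in>D. code z \<prec> g}} else UNIV)" for n
  have A: "\<exists>c\<in>A n. b \<preceq> c" for n b
  proof (cases "en n \<in> tasks")
    case True
    then obtain t' where t': "dom (en n) = dn t'" "ran (en n) \<subseteq> seqs r \<times> seqs r \<times> UNIV"
      unfolding tasks_def by blast
    have 1: "z j \<in> seqs r" if "z \<in> D" for z j
    proof (cases "j \<prec> t")
      case True
      have "z \<in> X" using that D by blast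
      from T_seqs[OF XL_T[OF X_lvl[OF this] True]] show ?thesis .
    next
      case False
      have "z \<in> X" using that D by blast
      then show ?thesis using X_off[OF _ False] T_seqs[of Map.empty zr] T_zr by simp
    qed
    have 2: "z j = Map.empty" if "z \<in> D" "j \<notin> dn t" for z j
      using X_off[of z j] that D by auto
    have "\<exists>g. b \<prec> g \<and> is_limit r g \<and> (\<forall>x. x \<prec> g \<longrightarrow> g12 x \<prec> g) \<and>
        gt g = en n \<and> gD g = {z\<in>D. code z \<prec> g}"
      by (rule guessing[OF t']) (fact 1, fact 2)
    then obtain g where "b \<prec> g" "is_limit r g"
      "\<forall>x. x \<prec> g \<longrightarrow> g12 x \<prec> g" "gt g = en n" "gD g = {z\<in>D. code z \<prec> g}" by blast
    then show ?thesis unfolding A_def using True wo_less_imp_le by (intro bexI[of _ g]) simp_all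
  next
    case False
    then show ?thesis unfolding A_def by (intro bexI[of _ b]) simp_all
  qed
  \<comment> \<open>All tasks whose entries lie below d. There are few of them, so
    \<open>g4 d\<close> bounds their numbers in the enumeration.\<close>
  define R :: "'a \<Rightarrow> ('a \<Rightarrow> ('a node \<times> 'a node \<times> 'a) option) set"
    where "R d = (\<lambda>(s, h). \<lambda>j. if j \<prec> s then Some (h j) else None) `
      (SIGMA s:Collect es. dn s \<rightarrow>\<^sub>E ((\<Union>a\<in>dn d. lv a) \<times> (\<Union>a\<in>dn d. T a) \<times> dn th))" for d
  have "small (R d)" for d
    unfolding R_def by (intro small_image es_pow_small small_Sigma small_UN small_T lv_small small_dn)
  then obtain g4 where g4: "\<And>d s. s \<in> R d \<Longrightarrow> (SOME n. en n = s) \<prec> g4 d"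
    using bounding_function[of R "\<lambda>s. SOME n. en n = s"] by blast
  obtain al where al: "al \<in> St" "b0 \<prec> al" "is_limit r al" "\<And>x. x \<prec> al \<Longrightarrow> g4 x \<prec> al" "\<not> cofs al"
    and hit: "\<And>i. i \<prec> al \<Longrightarrow> is_sup r {b\<in>C al. succ_omega r {c\<in>C al. b \<preceq> c} \<subseteq> A i} al"
    using hitting[of A b0 g4, OF A] by blast
  have "\<exists>z\<in>D. lvl z \<prec> al \<and> below z f" if f: "f \<in> XL al" for f
  proof -
    \<comment> \<open>The name of a coordinate, with its branch v replaced by a node y on a level e
      in C al; unlike v, the node y lies below al.\<close>
    let ?P = "\<lambda>j (u, x, i, y, e, a). f j = F al u x i \<and> u \<in> lv al \<and> x \<in> T a \<and> a \<prec> al \<and> i \<prec> th \<and>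
        u = bb al y \<and> y \<in> lv e \<and> e \<in> C al"
    have "\<exists>p. ?P j p" if j: "j \<prec> t" for j
    proof -
      obtain u x i a where *: "f j = F al u x i" "u \<in> lv al" "x \<in> T a" "a \<prec> al" "i \<prec> th"
        using XL_T[OF f j] unfolding T_not_cofs[OF al(3,5)] by auto
      obtain y where "u = bb al y" "y \<in> restr_levels r U (C al)" using St_range[OF al(1)] *(2) by blast
      then obtain e where "u = bb al y" "y \<in> lv e" "e \<in> C al"
        unfolding restr_levels_def level_def by blast
      then show ?thesis using * by (intro exI[of _ "(u, x, i, y, e, a)"]) simp
    qed
    then have "\<forall>j\<in>dn t. \<exists>p. ?P j p" by simp
    from bchoice[OF this] obtain q where q: "\<forall>j\<in>dn t. ?P j (q j)" by blast
    define u x i y e a where "u j = fst (q j)" and "x j = fst (snd (q j))" and "i j = fst (snd (snd (q j)))"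
      and "y j = fst (snd (snd (snd (q j))))" and "e j = fst (snd (snd (snd (snd (q j)))))"
      and "a j = snd (snd (snd (snd (snd (q j)))))" for j
    note defs = u_def x_def i_def y_def e_def a_def
    have f_eq: "f j = F al (u j) (x j) (i j)"
      and u: "u j \<in> lv al" and x: "x j \<in> T (a j)" and a: "a j \<prec> al" and i: "i j \<prec> th"
      and uy: "u j = bb al (y j)" and y: "y j \<in> lv (e j)" and e: "e j \<in> C al" if "j \<prec> t" for j
    proof -
      have "?P j (u j, x j, i j, y j, e j, a j)" using q that unfolding defs prod.collapse by simp
      then show "f j = F al (u j) (x j) (i j)" "u j \<in> lv al" "x j \<in> T (a j)" "a j \<prec> al" "i j \<prec> th"
        "u j = bb al (y j)" "y j \<in> lv (e j)" "e j \<in> C al" unfolding prod.case by blast+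
    qed
    have e_al: "\<And>j. j \<prec> t \<Longrightarrow> e j \<prec> al" using e C_lt by blast
    \<comment> \<open>Here al is outside \<open>cofs\<close> and t is a length in \<open>es\<close>,
      so the levels of all names are bounded below al.\<close>
    obtain d1 where d1: "d1 \<prec> al" "\<And>j. j \<prec> t \<Longrightarrow> a j \<prec> d1"
      using not_cofs_bound[OF al(5) t_es, of a, OF a] by blast
    obtain d2 where d2: "d2 \<prec> al" "\<And>j. j \<prec> t \<Longrightarrow> e j \<prec> d2"
      using not_cofs_bound[OF al(5) t_es, of e, OF e_al] by blast
    define d3 where "d3 = (if d1 \<preceq> d2 then d2 else d1)"
    have d3: "d3 \<prec> al" "d1 \<preceq> d3" "d2 \<preceq> d3"
      using d1 d2 wo_linear[of d1 d2] by (auto simp: d3_def)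
    \<comment> \<open>Taking b0 into account makes the coordinates of f distinct already at level
      d.\<close>
    define d0 where "d0 = (if d3 \<preceq> b0 then b0 else d3)"
    have d0: "d0 \<prec> al" "d3 \<preceq> d0" "b0 \<preceq> d0"
      using d3 al(2) wo_linear[of d3 b0] by (auto simp: d0_def)
    have a0: "a j \<prec> d0" and e0: "e j \<prec> d0" if "j \<prec> t" for j
      using d1(2)[OF that] d2(2)[OF that] d3 d0 wo_less_le_trans by blast+
    define s where "s = (\<lambda>j. if j \<prec> t then Some (y j, x j, i j) else None)"
    have dom_s: "dom s = dn t" by (auto simp: s_def split: if_splits)
    have y_seq: "y j \<in> seqs r" if "j \<prec> t" for j using lv_dom[OF y[OF that]] by (auto simp: seqs_def)
    have ran_s: "ran s \<subseteq> seqs r \<times> seqs r \<times> UNIV"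
    proof
      fix p assume "p \<in> ran s"
      then obtain j where "j \<prec> t" "p = (y j, x j, i j)" unfolding ran_def s_def by (auto split: if_splits)
      then show "p \<in> seqs r \<times> seqs r \<times> UNIV" using y_seq T_seqs x by auto
    qed
    have sR: "s \<in> R d0"
    proof -
      let ?h = "restrict (\<lambda>j. (y j, x j, i j)) (dn t)"
      have "s = (\<lambda>(s, h). \<lambda>j. if j \<prec> s then Some (h j) else None) (t, ?h)"
        unfolding s_def by (rule ext) simp
      moreover have "?h \<in> dn t \<rightarrow>\<^sub>E ((\<Union>a\<in>dn d0. lv a) \<times> (\<Union>a\<in>dn d0. T a) \<times> dn th)"
      proof (rule restrict_PiE_iff[THEN iffD2], rule ballI)
        fix j assume "j \<in> dn t"
        then have j: "j \<prec> t" by simp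
        have "y j \<in> (\<Union>a\<in>dn d0. lv a)" by (rule UN_I[of "e j"]) (simp_all add: e0 y j)
        moreover have "x j \<in> (\<Union>a\<in>dn d0. T a)" by (rule UN_I[of "a j"]) (simp_all add: a0 x j)
        ultimately show "(y j, x j, i j) \<in> (\<Union>a\<in>dn d0. lv a) \<times> (\<Union>a\<in>dn d0. T a) \<times> dn th"
          using i[OF j] by simp
      qed
      ultimately show ?thesis unfolding R_def using t_es by (intro image_eqI[of _ _ "(t, ?h)"]) simp_all
    qed
    define n where "n = (SOME n. en n = s)"
    have "s \<in> range en" using en_surj[OF dom_s ran_s] .
    then have en_n: "en n = s" unfolding n_def by (metis (mono_tags) rangeE someI)
    have "n \<prec> g4 d0" unfolding n_def by (rule g4[OF sR])
    then have n_al: "n \<prec> al" using al(4)[OF d0(1)] wo_less_trans by blast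
    have "s \<in> tasks" unfolding tasks_def using dom_s ran_s by blast
    then have A_n: "A n = {g. is_limit r g \<and> (\<forall>x. x \<prec> g \<longrightarrow> g12 x \<prec> g) \<and> gt g = s \<and> gD g = {z\<in>D. code z \<prec> g}}"
      unfolding A_def en_n by simp
    obtain d where d: "d \<in> C al" "d0 \<prec> d" "succ_omega r {c\<in>C al. d \<preceq> c} \<subseteq> A n"
    proof -
      have "\<not> (\<forall>b\<in>{b\<in>C al. succ_omega r {c\<in>C al. b \<preceq> c} \<subseteq> A n}. b \<preceq> d0)"
        using hit[OF n_al] d0(1) wo_leD unfolding is_sup_def by blast
      then show thesis using that wo_not_le by blast
    qed
    have d_al: "d \<prec> al" using C_lt d(1) by blast
    \<comment> \<open>The point of C al after d. Exactly one point of the tail starting at d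
      precedes it, so it belongs to \<open>succ_omega\<close> of that tail and hence to A n.\<close>
    define be where "be = least (\<lambda>b. b \<in> C al \<and> d \<prec> b)"
    have "\<exists>b. b \<in> C al \<and> d \<prec> b" using club_unbounded[OF C_club[OF al(3)] al(3) d_al] by blast
    then have be: "be \<in> C al" "d \<prec> be" unfolding be_def using wo_LeastI_ex[of "\<lambda>b. b \<in> C al \<and> d \<prec> b"] by blast+
    have be_least: "c \<preceq> d" if "c \<in> C al" "c \<prec> be" for c
      using wo_not_less_Least[OF that(2)[unfolded be_def]] that(1) wo_not_less by blast
    have pd: "pd (C al) be d" unfolding pd_def using d(1) be be_least by blast
    have be_al: "be \<prec> al" using C_lt be(1) by blast
    have "{c\<in>C al. d \<preceq> c} \<inter> dn be = {d}"
      using d(1) be be_least wo_antisym by auto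
    then have "be \<in> succ_omega r {c\<in>C al. d \<preceq> c}"
      unfolding succ_omega_def using be wo_less_imp_le by simp
    then have be_A: "is_limit r be" "\<And>x. x \<prec> be \<Longrightarrow> g12 x \<prec> be" "gt be = s" "gD be = {z\<in>D. code z \<prec> be}"
      using d(3) unfolding A_n by blast+
    \<comment> \<open>be is a limit but not an accumulation point of C al, which excludes the weak alternative of sqleq\<close>
    have good: "good al"
    proof (rule ccontr)
      assume bad: "\<not> good al"
      have "be \<notin> acc r (C al)"
        using accD(3)[of be "C al" d] be(2) be_least wo_leD by blast
      then have "be \<in> nacc r (C al)" using be(1) by (simp add: nacc_def)
      then have "is_successor r be" using bad_nacc[OF bad] by blast
      then show False using is_successor_iff limit_not_sc[OF be_A(1)] by blast
    qed
    have xd: "x j \<in> Tle d" if "j \<prec> t" for j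
      by (rule Tle_I[OF x[OF that] wo_less_imp_le[OF wo_less_trans[OF a0[OF that] d(2)]]])
    have xb: "x j \<in> Tle be" if "j \<prec> t" for j
      by (rule Tle_mono[OF xd[OF that] wo_less_imp_le[OF be(2)]])
    \<comment> \<open>The stages at d are the restrictions of f to d, so the process sees this part
      of f when it treats \<open>be\<close>.\<close>
    let ?G = "\<lambda>d j. G d (C al) (bb al) (u j |` dn d) (x j) (i j)"
    have Gd: "?G d j = f j |` dn d" if j: "j \<prec> t" for j
    proof -
      note g = G_below_F[OF al(3) good d(1) u[OF j] xd[OF j] i[OF j]]
      show ?thesis unfolding f_eq[OF j] using map_le_restrict[OF g(2) T_dom[OF g(1)]] by simp
    qed
    have Gbe: "?G be j \<subseteq>\<^sub>m f j" if j: "j \<prec> t" for j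
      using G_below_F(2)[OF al(3) good be(1) u[OF j] xb[OF j] i[OF j]] f_eq[OF j] by simp
    define h where "h j = (if j \<prec> t then f j |` dn d else Map.empty)" for j
    have h: "h \<in> XL d" by (rule XL_restrict[OF f wo_less_imp_le[OF d_al]]) (simp_all add: h_def)
    have b0d: "b0 \<preceq> d" using d0(3) d(2) wo_le_less_trans wo_less_imp_le by blast
    \<comment> \<open>Witness that the guess at \<open>be\<close> offers a suitable tuple; the
      process itself may choose another one.\<close>
    let ?z = "de h"
    have zD: "?z \<in> D" "below h ?z" using de[OF XL_X[OF h]] by blast+
    have "lvl ?z \<prec> g1 d" using g1[OF h] .
    moreover have "g1 d \<prec> be" using g12[OF be_A(2)[OF be(2)]] by blast
    ultimately have lz: "lvl ?z \<prec> be" by (rule wo_less_trans)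
    have zXL: "?z \<in> XL (lvl ?z)" using zD(1) D X_lvl by blast
    \<comment> \<open>Closure is applied twice, first to d for the level of the tuple and then to
      this level for its code.\<close>
    have "code ?z \<prec> g2 (lvl ?z)" using g2[OF zXL] .
    moreover have "g2 (lvl ?z) \<prec> be" using g12[OF be_A(2)[OF lz]] by blast
    ultimately have "code ?z \<prec> be" by (rule wo_less_trans)
    then have zg: "?z \<in> gD be" unfolding be_A(4) using zD(1) by simp
    let ?Q = "choices T (G d (C al) (bb al)) d (bb al) be"
    have s_Some: "j \<prec> t \<and> y' = y j \<and> x' = x j \<and> i' = i j" if "gt be j = Some (y', x', i')" for j y' x' i'
      using that unfolding be_A(3) s_def by (auto split: if_splits)
    have zQ: "?z \<in> ?Q"
    proof -
      have "?z j \<in> (\<Union>a\<in>dn be. T a) \<and> G d (C al) (bb al) (bb al y' |` dn d) x' i' \<subseteq>\<^sub>m ?z j"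
        if "gt be j = Some (y', x', i')" for j y' x' i'
      proof -
        have j: "j \<prec> t" and eq: "y' = y j" "x' = x j" "i' = i j" using s_Some[OF that] by auto
        have "?z j \<in> (\<Union>a\<in>dn be. T a)" by (rule UN_I[of "lvl ?z"]) (simp_all add: lz XL_T[OF zXL j])
        moreover have "h j \<subseteq>\<^sub>m ?z j" using zD(2) j by (simp add: below_def)
        ultimately show ?thesis unfolding eq uy[OF j, symmetric] Gd[OF j] by (simp add: h_def j)
      qed
      then show ?thesis unfolding choices_def using zg by blast
    qed
    have act: "active (C al) be"
      unfolding active_def
    proof (intro conjI allI impI)
      show "nusmall (dom (gt be))" unfolding be_A(3) dom_s using card_nu t_nu by (simp add: is_cardinal_def)
      fix j y' x' i' assume "gt be j = Some (y', x', i')"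
      then have j: "j \<prec> t" and eq: "y' = y j" using s_Some by blast+
      have "e j \<prec> be" using e0[OF j] d(2) be(2) wo_less_trans by blast
      then show "y' \<in> restr_levels r U (C al \<inter> dn be)"
        unfolding restr_levels_def eq using lv_U[OF y[OF j]] lv_dom[OF y[OF j]] e[OF j] by auto
    qed
    let ?Z = "SOME z. z \<in> ?Q"
    have ZQ: "?Z \<in> ?Q" by (rule someI[of "\<lambda>z. z \<in> ?Q", OF zQ])
    then have ZD: "?Z \<in> D" unfolding choices_def be_A(4) by blast
    have gtj: "gt be j = Some (y j, x j, i j)" if "j \<prec> t" for j
      unfolding be_A(3) s_def using that by simp
    have "?Z j \<subseteq>\<^sub>m f j" if j: "j \<prec> t" for j
    proof -
      have dx: "dom (x j) \<subseteq> dn d"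
        using T_dom[OF x[OF j]] wo_less_imp_le[OF wo_less_trans[OF a0[OF j] d(2)]] by simp
      have "?Z j \<subseteq>\<^sub>m G be (C al) (bb al) (bb al (y j) |` dn be) (x j) (i j)"
      proof (rule G_seal[OF pd dx T_extendable act _ gtj[OF j]])
        show "?Q \<noteq> {}" using zQ by blast
        \<comment> \<open>Two coordinates with the same path up to \<open>be\<close> have the same
          stage at d, so f would agree on them at level d.\<close>
        fix k y' assume k: "gt be k = Some (y', x j, i j)" and eq: "bb al y' |` dn be = bb al (y j) |` dn be"
        have kt: "k \<prec> t" and y': "y' = y k" and xk: "x k = x j" "i k = i j" using s_Some[OF k] by auto
        have "u k |` dn be = u j |` dn be" using eq y' uy[OF j] uy[OF kt] by simp
        then have "u k |` dn d = u j |` dn d" using restrict_dn[OF wo_less_imp_le[OF be(2)]] by metis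
        then have "f k |` dn d = f j |` dn d" using Gd[OF j] Gd[OF kt] xk by simp
        then show "k = j" using XL_inj[OF h b0d kt j] kt j by (simp add: h_def)
      qed
      then show ?thesis using Gbe[OF j] unfolding uy[OF j] by (rule map_le_trans)
    qed
    then have "below ?Z f" by (simp add: below_def)
    moreover have "lvl ?Z \<prec> al"
    proof -
      obtain l where l: "l \<prec> be" "?Z zr \<in> T l" using choicesD(1)[OF ZQ gtj[OF t_pos]] by blast
      have "lvl ?Z = l" unfolding lvl_def by (rule lev[OF T_dom[OF l(2)]])
      then show ?thesis using l(1) be_al wo_less_trans by blast
    qed
    ultimately show ?thesis using ZD by blast
  qed
  then show ?thesis by blast
qed

section \<open>No large antichains and no cofinal branches\<close>

lemma below_refl: "below f f" and below_trans: "below f g \<Longrightarrow> below g h \<Longrightarrow> below f h"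
  unfolding below_def by (blast intro: map_le_refl map_le_trans)+

lemma XL_nonempty: "\<exists>f. f \<in> XL a"
proof (cases "a \<preceq> b0")
  case True
  define f where "f j = (if j \<prec> t then w j |` dn a else Map.empty)" for j
  have "f \<in> XL a"
  proof (rule XL_I)
    fix j assume j: "j \<prec> t"
    show "f j \<in> T a" using T_restrict[OF w_T[OF j] True] j by (simp add: f_def)
    show "f j \<subseteq>\<^sub>m w j \<or> w j \<subseteq>\<^sub>m f j" using restrict_map_le[of "w j" "dn a"] j by (simp add: f_def)
  qed (simp add: f_def)
  then show ?thesis by blast
next
  case False
  then have ba: "b0 \<preceq> a" using wo_linear by blast
  define f where "f j = (if j \<prec> t then (SOME e. e \<in> T a \<and> w j \<subseteq>\<^sub>m e) else Map.empty)" for j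
  have f: "f j \<in> T a \<and> w j \<subseteq>\<^sub>m f j" if "j \<prec> t" for j
    using someI_ex[of "\<lambda>e. e \<in> T a \<and> w j \<subseteq>\<^sub>m e"] T_extend[OF w_T[OF that] ba] that
    unfolding f_def by auto
  have "f \<in> XL a" by (rule XL_I) (use f in \<open>auto simp: f_def\<close>)
  then show ?thesis by blast
qed

text \<open>Seal the tuples that lie above a member of A or have no extension in A. A member f of A
  on or above the sealed level extends such a tuple z. As z has the extension f, it lies above some
  g in A, and g is strictly below f.\<close>

lemma antichain_small:
  assumes A: "A \<subseteq> X"
    and anti: "\<And>f h. f \<in> A \<Longrightarrow> h \<in> A \<Longrightarrow> f \<noteq> h \<Longrightarrow> \<not> derived_less r t f h"
  shows "small A"
proof -
  define D where "D = {f\<in>X. (\<exists>a\<in>A. below a f) \<or> (\<forall>a\<in>A. \<not> below f a)}"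
  have D: "D \<subseteq> X" by (auto simp: D_def)
  have "\<exists>z\<in>D. below f z" if f: "f \<in> X" for f
  proof (cases "\<exists>a\<in>A. below f a")
    case True
    then obtain a where a: "a \<in> A" "below f a" by blast
    then have "a \<in> D" using A below_refl unfolding D_def by blast
    then show ?thesis using a by blast
  next
    case False
    then have "f \<in> D" using f unfolding D_def by blast
    then show ?thesis using below_refl by blast
  qed
  from sealing[OF D this] obtain a where a: "\<And>f. f \<in> XL a \<Longrightarrow> \<exists>z\<in>D. lvl z \<prec> a \<and> below z f" by blast
  have "A \<subseteq> (\<Union>b\<in>dn a. XL b)"
  proof
    fix f assume f: "f \<in> A"
    then have fX: "f \<in> XL (lvl f)" using A X_lvl by blast
    have "lvl f \<prec> a"
    proof (rule ccontr)
      assume "\<not> lvl f \<prec> a"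
      then have al: "a \<preceq> lvl f" by (rule wo_leI)
      define h where "h j = (if j \<prec> t then f j |` dn a else Map.empty)" for j
      have h: "h \<in> XL a" by (rule XL_restrict[OF fX al]) (simp_all add: h_def)
      have hf: "below h f" unfolding below_def
      proof (intro allI impI)
        fix j assume "j \<prec> t"
        then show "h j \<subseteq>\<^sub>m f j" using restrict_map_le[of "f j" "dn a"] by (simp add: h_def)
      qed
      obtain z where z: "z \<in> D" "lvl z \<prec> a" "below z h" using a[OF h] by blast
      have zf: "below z f" using z(3) hf by (rule below_trans)
      then obtain g where g: "g \<in> A" "below g z" using z(1) f unfolding D_def by blast
      have zX: "z \<in> XL (lvl z)" and gX: "g \<in> XL (lvl g)" using z(1) g(1) D A X_lvl by blast+
      have "lvl g \<prec> lvl f" using below_XL[OF gX zX g(2)] z(2) al wo_le_less_trans wo_less_le_trans by blast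
      then have ne: "lvl g \<noteq> lvl f" by auto
      have "derived_less r t g f" by (rule below_less[OF gX fX below_trans[OF g(2) zf] ne])
      then show False using anti[OF g(1) f] ne by auto
    qed
    then show "f \<in> (\<Union>b\<in>dn a. XL b)" using fX by auto
  qed
  moreover have "small (\<Union>b\<in>dn a. XL b)" by (intro small_UN small_dn small_XL)
  ultimately show ?thesis by (rule small_subset[rotated])
qed

text \<open>A cofinal branch gives kappa many pairwise incomparable tuples, obtained by leaving the
  branch at each level from b0 on; this contradicts \<open>antichain_small\<close>.\<close>

lemma no_branch:
  assumes B: "B \<subseteq> X" and chain: "\<And>f h. f \<in> B \<Longrightarrow> h \<in> B \<Longrightarrow> f = h \<or> derived_less r t f h \<or> derived_less r t h f"
    and cof: "\<And>a. \<exists>f\<in>B. f \<in> XL a"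
  shows False
proof -
  define p where "p a = (SOME f. f \<in> B \<and> f \<in> XL a)" for a
  have p: "p a \<in> B" "p a \<in> XL a" for a
    using someI_ex[of "\<lambda>f. f \<in> B \<and> f \<in> XL a"] cof[of a] unfolding p_def by blast+
  have pp: "below (p a) (p b)" if "a \<preceq> b" for a b
  proof -
    consider "p a = p b" | "derived_less r t (p a) (p b)" | "derived_less r t (p b) (p a)"
      using chain[OF p(1)[of a] p(1)[of b]] by blast
    then show ?thesis
    proof cases
      case 3
      then have b: "below (p b) (p a)" by (rule less_below)
      then have "a = b" using below_XL[OF p(2) p(2)] that wo_antisym by blast
      then show ?thesis using below_refl by simp
    qed (simp_all add: below_refl less_below)
  qed
  \<comment> \<open>One of the labels 0 and 1, chosen to differ from the branch in coordinate 0.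
    Finite labels are available at every level, and the same one is appended in all
    coordinates.\<close>
  define l where "l a = (if p (sc a) zr a = Some zr then sc zr else zr)" for a
  define g where "g a = (\<lambda>j. if j \<prec> t then (p a j)(a \<mapsto> l a) else Map.empty)" for a
  have fin: "finite (dn (l a))" for a unfolding l_def by (simp add: dn_sc)
  have g: "g a \<in> XL (sc a)" if "b0 \<preceq> a" for a
  proof (rule XL_I)
    fix j assume j: "j \<prec> t"
    show "g a j \<in> T (sc a)" using TT_extend_label[OF XL_T[OF p(2) j]] fin j by (simp add: g_def)
    have "a \<notin> dom (p a j)" using XL_dom[OF p(2) j] by simp
    then have "p a j \<subseteq>\<^sub>m g a j" using j unfolding g_def by (simp add: map_le_def)
    then show "g a j \<subseteq>\<^sub>m w j \<or> w j \<subseteq>\<^sub>m g a j"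
      using XL_above_w[OF p(2) that j] map_le_trans by blast
  qed (simp add: g_def)
  have g_ne: "\<not> below (g a) (g b)" if ab: "a \<prec> b" for a b
  proof
    assume "below (g a) (g b)"
    then have le: "g a zr \<subseteq>\<^sub>m g b zr" using t_pos by (simp add: below_def)
    have "g a zr a = Some (l a)" using t_pos by (simp add: g_def)
    then have "g b zr a = Some (l a)" using le unfolding map_le_def by (metis domI)
    moreover have "a \<noteq> b" using ab by auto
    ultimately have pb: "p b zr a = Some (l a)" using t_pos by (simp add: g_def)
    have "a \<in> dom (p (sc a) zr)" using XL_dom[OF p(2) t_pos] by simp
    moreover have "p (sc a) zr \<subseteq>\<^sub>m p b zr" using pp[of "sc a" b] ab t_pos by (simp add: below_def)
    ultimately have "p (sc a) zr a = Some (l a)" using pb unfolding map_le_def by simp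
    moreover have "sc zr \<noteq> zr" by (metis lt_sc not_lt_zr wo_refl)
    ultimately show False unfolding l_def by (auto split: if_splits)
  qed
  have gb: "a \<preceq> b" if "b0 \<preceq> a" "b0 \<preceq> b" "below (g a) (g b)" for a b
    using below_XL[OF g[OF that(1)] g[OF that(2)] that(3)] wo_leI[of b a] by (metis lt_sc sc_le wo_leI wo_leD)
  have inj: "inj_on g {a. b0 \<preceq> a}"
  proof (rule inj_onI)
    fix a b assume *: "a \<in> {a. b0 \<preceq> a}" "b \<in> {a. b0 \<preceq> a}" "g a = g b"
    then show "a = b" using gb[of a b] gb[of b a] below_refl[of "g a"] wo_antisym by simp
  qed
  have "small (g ` {a. b0 \<preceq> a})"
  proof (rule antichain_small)
    show "g ` {a. b0 \<preceq> a} \<subseteq> X" using g XL_X by blast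
    fix f h assume "f \<in> g ` {a. b0 \<preceq> a}" "h \<in> g ` {a. b0 \<preceq> a}" "f \<noteq> h"
    then obtain a b where ab: "b0 \<preceq> a" "b0 \<preceq> b" "f = g a" "h = g b" "a \<noteq> b" by blast
    show "\<not> derived_less r t f h"
    proof
      assume "derived_less r t f h"
      then have lt: "below (g a) (g b)" unfolding ab by (rule less_below)
      then have "a \<prec> b" using gb[OF ab(1,2)] ab(5) wo_le_neq_trans by blast
      then show False using g_ne lt by blast
    qed
  qed
  then have "small {a. b0 \<preceq> a}" by (rule small_inj_on[OF inj subset_refl])
  then have "small (dn b0 \<union> {a. b0 \<preceq> a})" by (rule small_Un[OF small_dn])
  moreover have "dn b0 \<union> {a. b0 \<preceq> a} = UNIV" using wo_leI by auto
  ultimately show False using not_small_UNIV by simp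
qed

theorem souslin: "kappa_souslin_gen r X (derived_less r t) (derived_level r t)"
  unfolding kappa_souslin_gen_def kappa_tree_gen_def
proof (intro conjI allI notI)
  have lv_eq: "{x\<in>X. derived_level r t x a} = XL a" for a using X_level XL_X by blast
  show False if "{x\<in>X. derived_level r t x a} = {}" for a using that XL_nonempty unfolding lv_eq by blast
  show "small {x\<in>X. derived_level r t x a}" for a unfolding lv_eq by (rule small_XL)
next
  assume "\<exists>B\<subseteq>X. (\<forall>x\<in>B. \<forall>y\<in>B. x = y \<or> derived_less r t x y \<or> derived_less r t y x) \<and>
    (\<forall>a. \<exists>x\<in>B. derived_level r t x a)"
  then obtain B where B: "B \<subseteq> X" "\<And>x y. x \<in> B \<Longrightarrow> y \<in> B \<Longrightarrow> x = y \<or> derived_less r t x y \<or> derived_less r t y x"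
    "\<And>a. \<exists>x\<in>B. derived_level r t x a" by blast
  have "\<exists>f\<in>B. f \<in> XL a" for a using B(3)[of a] X_level B(1) by blast
  then show False using no_branch[OF B(1,2)] by blast
next
  assume "\<exists>A\<subseteq>X. (\<forall>x\<in>A. \<forall>y\<in>A. x \<noteq> y \<longrightarrow> \<not> derived_less r t x y \<and> \<not> derived_less r t y x) \<and> |A| =o r"
  then obtain A where A: "A \<subseteq> X" "\<And>x y. x \<in> A \<Longrightarrow> y \<in> A \<Longrightarrow> x \<noteq> y \<Longrightarrow> \<not> derived_less r t x y"
    "|A| =o r" by blast
  have "small A" using antichain_small[OF A(1,2)] by blast
  then show False using A(3) not_ordLess_ordIso by blast
qed

end

context souslin_setup
begin

theorem TT_free:
  assumes "\<And>t. below_chi t \<Longrightarrow> es t \<and> t \<prec> nu"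
  shows "chi_free r below_chi TT"
  unfolding chi_free_def
proof (intro allI impI)
  fix t b w
  assume *: "(\<exists>c. c \<prec> t) \<and> below_chi t \<and> (\<forall>i\<in>dn t. w i \<in> level r TT b) \<and> inj_on w (dn t)"
  obtain c where "c \<prec> t" using * by blast
  then have "zr \<prec> t" using wo_le_less_trans[OF zr_le] by blast
  then interpret derived r nu th es U C bb gt gD St code en t b w
    using assms[of t] * by unfold_locales (simp_all add: TT_level)
  show "kappa_souslin_gen r (derived_tree r TT t w) (derived_less r t) (derived_level r t)"
    by (rule souslin)
qed

text \<open>The tree itself is the derived tree of its root.\<close>

theorem TT_souslin:
  assumes "es (sc zr)"
  shows "kappa_souslin r TT"
proof -
  have dn1: "dn (sc zr) = {zr}" by (simp add: dn_sc)
  have lt1: "j \<prec> sc zr \<longleftrightarrow> j = zr" for j using wo_antisym by auto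
  have "sc zr \<prec> nu"
  proof (rule ccontr)
    assume "\<not> sc zr \<prec> nu"
    then have "dn nu \<subseteq> dn (sc zr)" by (simp add: wo_not_less)
    then show False using inf_nu unfolding dn1 using finite_subset by blast
  qed
  then interpret derived r nu th es U C bb gt gD St code en "sc zr" zr "\<lambda>_. Map.empty"
    using assms by unfold_locales (simp_all add: T_zr dn1)
  \<comment> \<open>The isomorphism of the tree with its one-coordinate derived tree, padded with
    empty nodes.\<close>
  define e :: "'k node \<Rightarrow> 'k \<Rightarrow> 'k node" where "e x = (\<lambda>j. if j = zr then x else Map.empty)" for x
  have e_zr [simp]: "e x zr = x" for x by (simp add: e_def)
  have e_X: "e x \<in> X" if "x \<in> TT" for x
    using TT_ex[OF that] that unfolding derived_tree_def dn1 by (auto simp: e_def)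
  have e_less: "derived_less r (sc zr) (e x) (e y) \<longleftrightarrow> sless x y" for x y
    unfolding derived_less_def dn1 by simp
  have e_level: "derived_level r (sc zr) (e x) a \<longleftrightarrow> dom x = dn a" for x a
    unfolding derived_level_def dn1 by simp
  have "inj e" by (rule injI) (metis e_zr)
  show ?thesis unfolding kappa_souslin_def kappa_souslin_gen_def
  proof (intro conjI notI)
    show "kappa_tree_gen r TT (\<lambda>x a. dom x = dn a)" using TT_tree by (simp add: kappa_tree_def)
  next
    assume "\<exists>B\<subseteq>TT. (\<forall>x\<in>B. \<forall>y\<in>B. x = y \<or> sless x y \<or> sless y x) \<and> (\<forall>a. \<exists>x\<in>B. dom x = dn a)"
    then obtain B where B: "B \<subseteq> TT" "\<And>x y. x \<in> B \<Longrightarrow> y \<in> B \<Longrightarrow> x = y \<or> sless x y \<or> sless y x"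
      "\<And>a. \<exists>x\<in>B. dom x = dn a" by blast
    show False
    proof (rule no_branch)
      show "e ` B \<subseteq> X" using e_X B(1) by blast
      show "f = h \<or> derived_less r (sc zr) f h \<or> derived_less r (sc zr) h f"
        if "f \<in> e ` B" "h \<in> e ` B" for f h
        using that B(2) e_less by blast
      show "\<exists>f\<in>e ` B. f \<in> XL a" for a
      proof -
        obtain x where "x \<in> B" "dom x = dn a" using B(3) by blast
        then show ?thesis using X_level[OF e_X] e_level B(1) by blast
      qed
    qed
  next
    assume "\<exists>A\<subseteq>TT. (\<forall>x\<in>A. \<forall>y\<in>A. x \<noteq> y \<longrightarrow> \<not> sless x y \<and> \<not> sless y x) \<and> |A| =o r"
    then obtain A where A: "A \<subseteq> TT" "\<And>x y. x \<in> A \<Longrightarrow> y \<in> A \<Longrightarrow> x \<noteq> y \<Longrightarrow> \<not> sless x y" "|A| =o r"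
      by blast
    have "small (e ` A)"
    proof (rule antichain_small)
      show "e ` A \<subseteq> X" using e_X A(1) by blast
      show "\<not> derived_less r (sc zr) f h" if "f \<in> e ` A" "h \<in> e ` A" "f \<noteq> h" for f h
        using that A(2) e_less by blast
    qed
    then have "small A" by (rule small_inj_on[OF inj_on_subset[OF \<open>inj e\<close> subset_UNIV] subset_refl])
    then show False using A(3) not_ordLess_ordIso by blast
  qed
qed

end

section \<open>Guessing tasks and dense sets\<close>

context kappa_order
begin

text \<open>Covers the finite lengths, which belong to \<open>es\<close> whatever eta is.\<close>

lemma small_PiE_finite:
  assumes "finite I" "small X"
  shows "small (I \<rightarrow>\<^sub>E X)"
  using assms(1)
proof (induction I rule: finite_induct)
  case empty
  then show ?case by (simp add: small_finite)
next
  case (insert i I)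
  have "small ((\<lambda>(y, g). g(i := y)) ` (X \<times> (I \<rightarrow>\<^sub>E X)))"
    using insert.IH assms(2) by (intro small_image small_Sigma)
  then show ?case by (simp only: PiE_insert_eq)
qed

lemma limit_finite_bounded:
  assumes "is_limit r a" "finite X" "X \<subseteq> dn a"
  shows "\<exists>b. b \<prec> a \<and> (\<forall>x\<in>X. x \<preceq> b)"
  using assms(2,3)
proof (induction X rule: finite_induct)
  case empty
  then show ?case using limit_zr[OF assms(1)] by blast
next
  case (insert x X)
  then obtain b where b: "b \<prec> a" "\<forall>x\<in>X. x \<preceq> b" by auto
  define m where "m = (if x \<preceq> b then b else x)"
  have "m \<prec> a" using b(1) insert.prems by (simp add: m_def)
  moreover have "b \<preceq> m" "x \<preceq> m" using wo_linear[of x b] by (auto simp: m_def)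
  ultimately show ?case using b(2) wo_trans by blast
qed

text \<open>The graph of f is coded by a bounded subset of kappa, and diamond guesses every bounded set
exactly at some level, which then serves as the code of f.\<close>

lemma diamond_code:
  fixes e :: "'x \<Rightarrow> 'k"
  assumes dia: "diamond r" and e: "inj_on e X"
  shows "\<exists>c :: ('k \<Rightarrow> 'x option) \<Rightarrow> 'k. inj_on c {f. (\<exists>t. dom f = dn t) \<and> ran f \<subseteq> X}"
proof -
  obtain A where A: "\<And>Z. stationary r {a. Z \<inter> dn a = A a}"
    using dia unfolding diamond_def by blast
  define Z where "Z f = {pr j (e x) |j x. f j = Some x}" for f
  have ex: "\<exists>a. Z f = A a" if t: "dom f = dn t" for f t
  proof -
    have "Z f \<subseteq> (\<lambda>j. pr j (e (the (f j)))) ` dn t" unfolding Z_def t[symmetric] by force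
    then have "small (Z f)" using small_image[OF small_dn] small_subset by blast
    then obtain b where b: "\<And>x. x \<in> Z f \<Longrightarrow> x \<prec> b" by (rule small_bdd) blast
    obtain a where a: "a \<in> {a. Z f \<inter> dn a = A a}" "b \<prec> a" using stationary_closed[OF A] by blast
    then have "Z f \<subseteq> dn a" using wo_less_trans[OF b] by auto
    then show ?thesis using a(1) by (intro exI[of _ a]) auto
  qed
  have inj: "f = g" if f: "ran f \<subseteq> X" and g: "ran g \<subseteq> X" and eq: "Z f = Z g" for f g
  proof -
    have *: "g j = Some x" if "f j = Some x" "ran f \<subseteq> X" "ran g \<subseteq> X" "Z f = Z g" for f g j x
    proof -
      have "pr j (e x) \<in> Z g" using that unfolding Z_def by blast
      then obtain j' x' where j': "pr j (e x) = pr j' (e x')" "g j' = Some x'" unfolding Z_def by blast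
      then have "j = j'" "e x = e x'" by simp_all
      moreover have "x \<in> X" "x' \<in> X" using that j'(2) by (auto intro: ranI)
      ultimately show ?thesis using j'(2) e by (simp add: inj_on_eq_iff)
    qed
    show ?thesis
    proof
      fix j show "f j = g j"
      proof (cases "f j")
        case None
        then show ?thesis using *[OF _ g f eq[symmetric]] by (cases "g j") auto
      next
        case (Some x)
        then show ?thesis using *[OF _ f g eq] by simp
      qed
    qed
  qed
  show ?thesis
  proof (intro exI inj_onI)
    fix f g assume fg: "f \<in> {f. (\<exists>t. dom f = dn t) \<and> ran f \<subseteq> X}" "g \<in> {f. (\<exists>t. dom f = dn t) \<and> ran f \<subseteq> X}"
      and eq: "(SOME a. Z f = A a) = (SOME a. Z g = A a)"
    have *: "Z f = A (SOME a. Z f = A a)" if "\<exists>t. dom f = dn t" for f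
      using someI_ex[of "\<lambda>a. Z f = A a"] ex that by blast
    have "Z f = A (SOME a. Z f = A a)" "Z g = A (SOME a. Z g = A a)" by (rule *, use fg in blast)+
    then show "f = g" using inj fg eq by simp
  qed
qed

text \<open>The task and the family are merged into one subset of kappa. A task is a single point of
  it, which the guesses contain from some level on, while the family is guessed through the codes of
  its members.\<close>

lemma diamond_guessing:
  assumes dia: "diamond r"
  shows "\<exists>(gt :: 'k \<Rightarrow> 'k \<Rightarrow> ('k node \<times> 'k node \<times> 'k) option) (gD :: 'k \<Rightarrow> ('k \<Rightarrow> 'k node) set)
      (code :: ('k \<Rightarrow> 'k node) \<Rightarrow> 'k) (en :: 'k \<Rightarrow> 'k \<Rightarrow> ('k node \<times> 'k node \<times> 'k) option).
      (\<forall>s D f b t t'. dom s = dn t \<longrightarrow> ran s \<subseteq> seqs r \<times> seqs r \<times> UNIV \<longrightarrow>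
        (\<forall>z\<in>D. \<forall>j. z j \<in> seqs r \<and> (j \<notin> dn t' \<longrightarrow> z j = Map.empty)) \<longrightarrow>
        (\<exists>g. b \<prec> g \<and> is_limit r g \<and> (\<forall>x. x \<prec> g \<longrightarrow> f x \<prec> g) \<and>
          gt g = s \<and> gD g = {z\<in>D. code z \<prec> g})) \<and>
      (\<forall>s t. dom s = dn t \<longrightarrow> ran s \<subseteq> seqs r \<times> seqs r \<times> UNIV \<longrightarrow> s \<in> range en)"
proof -
  obtain A where A: "\<And>Z. stationary r {a. Z \<inter> dn a = A a}"
    using dia unfolding diamond_def by blast
  obtain cn :: "'k node \<Rightarrow> 'k" where cn: "inj_on cn (seqs r)"
    using diamond_code[OF dia inj_on_id[of UNIV]] unfolding seqs_def by auto
  have "inj_on (\<lambda>(y, x, i). pr (cn y) (pr (cn x) i)) (seqs r \<times> seqs r \<times> UNIV)"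
    using cn by (auto simp: inj_on_def)
  note ct_ex = diamond_code[OF dia this]
  let ?tasks = "{f :: 'k \<Rightarrow> ('k node \<times> 'k node \<times> 'k) option. (\<exists>t. dom f = dn t) \<and> ran f \<subseteq> seqs r \<times> seqs r \<times> UNIV}"
  obtain ct :: "_ \<Rightarrow> 'k" where ct: "inj_on ct ?tasks" using ct_ex by blast
  obtain cs :: "_ \<Rightarrow> 'k" where cs: "inj_on cs {f. (\<exists>t. dom f = dn t) \<and> ran f \<subseteq> seqs r}"
    using diamond_code[OF dia cn] by blast
  \<comment> \<open>Tuples with bounded support; only these can be coded by
    \<open>diamond_code\<close>.\<close>
  define H :: "('k \<Rightarrow> 'k node) set"
    where "H = {z. (\<exists>t. \<forall>j. j \<notin> dn t \<longrightarrow> z j = Map.empty) \<and> (\<forall>j. z j \<in> seqs r)}"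
  define tz where "tz z = (SOME t. \<forall>j. j \<notin> dn t \<longrightarrow> z j = Map.empty)" for z :: "'k \<Rightarrow> 'k node"
  define fz where "fz z = (\<lambda>j. if j \<prec> tz z then Some (z j) else None)" for z :: "'k \<Rightarrow> 'k node"
  have tz: "z j = Map.empty" if "z \<in> H" "\<not> j \<prec> tz z" for z j
  proof -
    have "\<exists>t. \<forall>j. j \<notin> dn t \<longrightarrow> z j = Map.empty" using that(1) unfolding H_def by blast
    from someI_ex[OF this] have "\<forall>j. j \<notin> dn (tz z) \<longrightarrow> z j = Map.empty" unfolding tz_def .
    then show ?thesis using that(2) by simp
  qed
  have dom_fz: "dom (fz z) = dn (tz z)" for z by (auto simp: fz_def split: if_splits)
  have ran_fz: "ran (fz z) \<subseteq> seqs r" if "z \<in> H" for z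
  proof
    fix x assume "x \<in> ran (fz z)"
    then obtain j where "fz z j = Some x" unfolding ran_def by blast
    then have "x = z j" unfolding fz_def by (simp split: if_splits)
    then show "x \<in> seqs r" using that unfolding H_def by blast
  qed
  have fz_inj: "z = z'" if z: "z \<in> H" "z' \<in> H" and eq: "fz z = fz z'" for z z'
  proof
    fix j
    have t: "tz z = tz z'" using dom_fz[of z] dom_fz[of z'] eq by simp
    show "z j = z' j"
    proof (cases "j \<prec> tz z")
      case True
      have "fz z j = fz z' j" using eq by simp
      then show ?thesis using True t by (simp add: fz_def)
    next
      case False
      then show ?thesis using tz[OF z(1)] tz[OF z(2)] t by simp
    qed
  qed
  \<comment> \<open>The tag 1 separates codes of tuples from codes of tasks, which carry the tag
    0.\<close>
  define code where "code z = pr (sc zr) (cs (fz z))" for z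
  have code_inj: "z = z'" if z: "z \<in> H" "z' \<in> H" and eq: "code z = code z'" for z z'
  proof -
    have "cs (fz z) = cs (fz z')" using eq by (simp add: code_def)
    then have "fz z = fz z'" using inj_onD[OF cs] dom_fz ran_fz z by blast
    then show ?thesis using fz_inj z by blast
  qed
  have ne: "zr \<noteq> sc zr" by (metis lt_sc not_lt_zr wo_refl)
  define gt where "gt g = (SOME s. s \<in> ?tasks \<and> pr zr (ct s) \<in> A g)" for g
  define gD where "gD g = {z\<in>H. code z \<in> A g}" for g
  show ?thesis
  proof (rule exI[of _ gt], rule exI[of _ gD], rule exI[of _ code], rule exI[of _ "inv_into ?tasks ct"],
      rule conjI[rotated], intro allI impI)
    fix s :: "'k \<Rightarrow> ('k node \<times> 'k node \<times> 'k) option" and t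
    assume "dom s = dn t" "ran s \<subseteq> seqs r \<times> seqs r \<times> UNIV"
    then have "s \<in> ?tasks" by blast
    then have "inv_into ?tasks ct (ct s) = s" using ct by simp
    then show "s \<in> range (inv_into ?tasks ct)" by (rule range_eqI[OF sym])
  next
    show "\<forall>s D f b t t'. dom s = dn t \<longrightarrow> ran s \<subseteq> seqs r \<times> seqs r \<times> UNIV \<longrightarrow>
        (\<forall>z\<in>D. \<forall>j. z j \<in> seqs r \<and> (j \<notin> dn t' \<longrightarrow> z j = Map.empty)) \<longrightarrow>
        (\<exists>g. b \<prec> g \<and> is_limit r g \<and> (\<forall>x. x \<prec> g \<longrightarrow> f x \<prec> g) \<and>
          gt g = s \<and> gD g = {z\<in>D. code z \<prec> g})"
    proof (intro allI impI)
      fix s :: "'k \<Rightarrow> ('k node \<times> 'k node \<times> 'k) option" and D f b t t'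
      assume s: "dom s = dn t" "ran s \<subseteq> seqs r \<times> seqs r \<times> UNIV"
        and D: "\<forall>z\<in>D. \<forall>j. z j \<in> seqs r \<and> (j \<notin> dn t' \<longrightarrow> z j = Map.empty)"
      have sT: "s \<in> ?tasks" using s by blast
      have DH: "D \<subseteq> H" unfolding H_def using D by blast
      define Z where "Z = insert (pr zr (ct s)) (code ` D)"
      \<comment> \<open>Levels beyond the code of the task, so that the guess cannot miss
        it.\<close>
      define b' where "b' = (if b \<preceq> pr zr (ct s) then pr zr (ct s) else b)"
      have b': "b \<preceq> b'" "pr zr (ct s) \<preceq> b'" using wo_linear[of b "pr zr (ct s)"] by (auto simp: b'_def)
      obtain g where g: "g \<in> {a. Z \<inter> dn a = A a}" "b' \<prec> g" "is_limit r g" "\<And>x. x \<prec> g \<Longrightarrow> f x \<prec> g"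
        using stationary_closed[OF A] by blast
      have Ag: "A g = Z \<inter> dn g" using g(1) by blast
      have "gt g = s" unfolding gt_def
      proof (rule some_equality)
        show "s \<in> ?tasks \<and> pr zr (ct s) \<in> A g"
          using sT b'(2) g(2) wo_le_less_trans unfolding Ag Z_def by auto
        fix s' assume s': "s' \<in> ?tasks \<and> pr zr (ct s') \<in> A g"
        then have "pr zr (ct s') \<in> Z" unfolding Ag by blast
        then have "ct s' = ct s" using ne unfolding Z_def code_def by auto
        then show "s' = s" using inj_onD[OF ct] s' sT by blast
      qed
      moreover have "gD g = {z\<in>D. code z \<prec> g}"
      proof (intro equalityI subsetI)
        fix z assume "z \<in> gD g"
        then have z: "z \<in> H" "code z \<in> Z" "code z \<prec> g" unfolding gD_def Ag by auto
        have "code z \<noteq> pr zr (ct s)" using ne by (simp add: code_def)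
        then obtain z' where "z' \<in> D" "code z = code z'" using z(2) unfolding Z_def by blast
        then have "z = z'" using code_inj[OF z(1)] DH by blast
        then show "z \<in> {z\<in>D. code z \<prec> g}" using \<open>z' \<in> D\<close> z(3) by blast
      next
        fix z assume "z \<in> {z\<in>D. code z \<prec> g}"
        then show "z \<in> gD g" using DH unfolding gD_def Ag Z_def by auto
      qed
      ultimately show "\<exists>g. b \<prec> g \<and> is_limit r g \<and> (\<forall>x. x \<prec> g \<longrightarrow> f x \<prec> g) \<and>
          gt g = s \<and> gD g = {z\<in>D. code z \<prec> g}"
        using g(3,4) wo_le_less_trans[OF b'(1) g(2)] by blast
    qed
  qed
qed

end

section \<open>Choice of the parameters\<close>

theorem theorem6p3:
  fixes r :: "'k rel" and nu eta :: 'k and U :: "'k node set"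
  assumes kappa: "card_order r" "regularCard r" "(natLeq, r) \<in> ordLess"
    and nu: "regular_cardinal r nu"
    and eta: "is_cardinal r eta"
    and eta_pow: "\<forall>l. (card_of (SIGMA d:{d. olt r d eta}. (underS r d \<rightarrow>\<^sub>E underS r l)), r) \<in> ordLess"
    and U: "down_closed r U" "kappa_tree r U" "respecting r nu eta U"
    and dia: "diamond r"
  shows "\<forall>th. is_cardinal r th \<and> infinite (underS r th) \<longrightarrow>
    (\<exists>T. down_closed r T \<and> prolific r T \<and>
         chi_free r (\<lambda>tau. olt r tau eta \<and> olt r tau nu) T \<and>
         eta_complete r eta T \<and> kappa_souslin r T \<and>
         (\<exists>f. injective_ascent_path r nu th U T f))"
proof (intro allI impI)
  fix th assume "is_cardinal r th \<and> infinite (underS r th)"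
  interpret kappa_order r by (rule kappa_order.intro) (fact kappa)+
  obtain gt gD code and en :: "'k \<Rightarrow> _" where guess: "\<forall>(s :: 'k \<Rightarrow> ('k node \<times> 'k node \<times> 'k) option) D f b t t'. dom s = dn t \<longrightarrow> ran s \<subseteq> seqs r \<times> seqs r \<times> UNIV \<longrightarrow>
        (\<forall>z\<in>D. \<forall>j. z j \<in> seqs r \<and> (j \<notin> dn t' \<longrightarrow> z j = Map.empty)) \<longrightarrow>
        (\<exists>g. b \<prec> g \<and> is_limit r g \<and> (\<forall>x. x \<prec> g \<longrightarrow> f x \<prec> g) \<and>
          gt g = s \<and> gD g = {z\<in>D. code z \<prec> g})"
    and en: "\<forall>(s :: 'k \<Rightarrow> ('k node \<times> 'k node \<times> 'k) option) t. dom s = dn t \<longrightarrow> ran s \<subseteq> seqs r \<times> seqs r \<times> UNIV \<longrightarrow> s \<in> range en"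
    using diamond_guessing[OF dia] by (elim exE conjE) (rule that; assumption)
  obtain St C bb where St: "\<forall>a\<in>St. level r U a \<subseteq> bb a ` restr_levels r U (C a)"
    and wit: "P14_witness r nu (E_ge r eta \<inter> St) C"
    and coh: "\<forall>a' a. \<forall>x\<in>restr_levels r U (C a').
        C a \<inter> (dn a' - dom x) = C a' \<inter> (dn a' - dom x) \<longrightarrow> bb a' x = bb a x |` dn a'"
    using U(3)[unfolded respecting_def] by (elim exE conjE) (rule that; assumption)
  note wit' = wit[unfolded P14_witness_def]
  note wit_sub = conjunct1[OF wit'] and wit_club = conjunct1[OF conjunct2[OF wit']]
    and wit_coh = conjunct1[OF conjunct2[OF conjunct2[OF wit']]]
    and wit_hit = conjunct2[OF conjunct2[OF conjunct2[OF wit']]]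
  \<comment> \<open>with th at least nu the filter is proper, and the path is restricted to th in the end\<close>
  define th' where "th' = (if th \<preceq> nu then nu else th)"
  have th': "nu \<preceq> th'" "th \<preceq> th'" using wo_linear[of th nu] by (auto simp: th'_def)
  \<comment> \<open>The finite lengths are added so that length zero is available at the root and
    length one for the tree itself, even when eta is finite.\<close>
  define es where "es t \<longleftrightarrow> t \<prec> eta \<or> finite (dn t)" for t
  have es_pow: "small (SIGMA t:Collect es. dn t \<rightarrow>\<^sub>E dn l)" for l
  proof -
    have "small (SIGMA d:{d. d \<prec> eta}. dn d \<rightarrow>\<^sub>E dn l)" using eta_pow by blast
    moreover have "small (SIGMA d:{d. finite (dn d)}. dn d \<rightarrow>\<^sub>E dn l)"
      by (intro small_Sigma small_finite_ords small_PiE_finite small_dn) simp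
    ultimately have "small ((SIGMA d:{d. d \<prec> eta}. dn d \<rightarrow>\<^sub>E dn l) \<union>
        (SIGMA d:{d. finite (dn d)}. dn d \<rightarrow>\<^sub>E dn l))" by (rule small_Un)
    then show ?thesis by (rule small_subset) (auto simp: es_def)
  qed
  interpret ascent_setup r nu th' es U C bb gt gD
  proof unfold_locales
    show "regular_cardinal r nu" by fact
    show "|dn nu| \<le>o |dn th'|" using th'(1) by (intro card_of_mono1) simp
    show "\<exists>t. es t" unfolding es_def by (intro exI[of _ zr]) simp
    show "small (SIGMA t:Collect es. dn t \<rightarrow>\<^sub>E dn l)" for l by (rule es_pow)
    show "down_closed r U" "kappa_tree r U" by fact+
    show "C a \<subseteq> dn a" for a using wit_sub by (rule spec)
    show "club_in r (dn a) (C a)" if "is_limit r a" for a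
      using wit_club that by simp
    show "sqleq r nu (C a') (C a)" if "a' \<in> acc r (C a)" for a a'
      using wit_coh that by simp
    show "bb a' x = bb a x |` dn a'" if "x \<in> restr_levels r U (C a')"
      "C a \<inter> (dn a' - dom x) = C a' \<inter> (dn a' - dom x)" for a a' x
      using coh[THEN spec, of a', THEN spec, of a] that by blast
  qed
  \<comment> \<open>A finite set is never cofinal in a limit. A cofinal set indexed by an infinite
    length in \<open>es\<close> has fewer than eta elements, against the cofinality of a.\<close>
  have not_cofs: "\<not> cofs a" if a: "a \<in> E_ge r eta" and lim: "is_limit r a" for a
  proof
    assume "cofs a"
    then obtain t Y where Y: "es t" "cofinal_in r Y a" "|Y| \<le>o |dn t|" unfolding cofs_def by blast
    show False
    proof (cases "finite (dn t)")
      case True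
      then have "finite Y" using Y(3) card_of_ordLeq_finite by blast
      moreover have "Y \<subseteq> dn a" using Y(2) by (simp add: cofinal_in_def)
      ultimately obtain b where b: "b \<prec> a" "\<forall>x\<in>Y. x \<preceq> b" using limit_finite_bounded[OF lim] by blast
      then obtain x where "x \<in> Y" "sc b \<preceq> x" using Y(2) is_limitD[OF lim b(1)] unfolding cofinal_in_def by blast
      then show False using b(2) wo_leD by auto
    next
      case False
      then have "|dn t| <o |dn eta|" using Y(1) eta unfolding es_def is_cardinal_def by blast
      then have "|Y| <o |dn eta|" using Y(3) ordLeq_ordLess_trans by blast
      then have "Restr r Y <o Restr r (dn eta)" using Restr_less_iff[OF eta] by blast
      then show False using a Y(2) unfolding E_ge_def cf_ge_def by blast
    qed
  qed
  interpret souslin_setup r nu th' es U C bb gt gD St code en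
  proof unfold_locales
    show "level r U a \<subseteq> bb a ` restr_levels r U (C a)" if "a \<in> St" for a using St that by (rule bspec)
    show "s \<in> range en" if "dom s = dn t" "ran s \<subseteq> seqs r \<times> seqs r \<times> UNIV" for s t
      using en that by blast
  next
    fix A :: "'k \<Rightarrow> 'k set" and f b
    assume A: "\<And>i b. \<exists>c\<in>A i. b \<preceq> c"
    define S where "S = {a\<in>E_ge r eta \<inter> St. \<forall>i. i \<prec> a \<longrightarrow>
        is_sup r {b\<in>C a. succ_omega r {c\<in>C a. b \<preceq> c} \<subseteq> A i} a}"
    have "stationary r S" unfolding S_def using wit_hit[THEN spec, of A] A by simp
    then obtain a where a: "a \<in> S" "b \<prec> a" "is_limit r a" "\<And>x. x \<prec> a \<Longrightarrow> f x \<prec> a"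
      using stationary_closed[of S b f] by blast
    then have "a \<in> E_ge r eta" "a \<in> St"
      "\<forall>i. i \<prec> a \<longrightarrow> is_sup r {b\<in>C a. succ_omega r {c\<in>C a. b \<preceq> c} \<subseteq> A i} a"
      unfolding S_def by simp_all
    then show "\<exists>a\<in>St. b \<prec> a \<and> is_limit r a \<and> (\<forall>x. x \<prec> a \<longrightarrow> f x \<prec> a) \<and> \<not> cofs a \<and>
        (\<forall>i. i \<prec> a \<longrightarrow> is_sup r {b\<in>C a. succ_omega r {c\<in>C a. b \<preceq> c} \<subseteq> A i} a)"
      using not_cofs a by (intro bexI[of _ a]) simp_all
  next
    fix s :: "'k \<Rightarrow> ('k node \<times> 'k node \<times> 'k) option" and D f b t t'
    assume "dom s = dn t" "ran s \<subseteq> seqs r \<times> seqs r \<times> UNIV"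
      "\<And>z j. z \<in> D \<Longrightarrow> z j \<in> seqs r" "\<And>z j. z \<in> D \<Longrightarrow> j \<notin> dn t' \<Longrightarrow> z j = Map.empty"
    then show "\<exists>g. b \<prec> g \<and> is_limit r g \<and> (\<forall>x. x \<prec> g \<longrightarrow> f x \<prec> g) \<and>
        gt g = s \<and> gD g = {z\<in>D. code z \<prec> g}"
      using guess[THEN spec, of s, THEN spec, of D, THEN spec, of f, THEN spec, of b, THEN spec, of t,
          THEN spec, of t'] by blast
  qed
  show "\<exists>T. down_closed r T \<and> prolific r T \<and>
         chi_free r (\<lambda>tau. olt r tau eta \<and> olt r tau nu) T \<and>
         eta_complete r eta T \<and> kappa_souslin r T \<and>
         (\<exists>f. injective_ascent_path r nu th U T f)"
  proof (intro exI conjI)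
    show "down_closed r TT" by (rule TT_down)
    show "prolific r TT" by (rule TT_prolific)
    show "chi_free r (\<lambda>tau. tau \<prec> eta \<and> tau \<prec> nu) TT" by (rule TT_free) (simp add: es_def)
    show "kappa_souslin r TT" by (rule TT_souslin) (simp add: es_def dn_sc)
    show "injective_ascent_path r nu th U TT ascent" by (rule TT_ascent[OF th'(2)])
    show "eta_complete r eta TT" unfolding eta_complete_def
    proof (intro allI impI)
      fix d s assume *: "d \<prec> eta \<and> (\<forall>i\<in>dn d. s i \<in> TT) \<and>
        (\<forall>i\<in>dn d. \<forall>j\<in>dn d. i \<prec> j \<longrightarrow> sless (s i) (s j))"
      show "\<exists>t\<in>TT. \<forall>i\<in>dn d. s i \<subseteq>\<^sub>m t"
        by (rule TT_complete) (use * in \<open>auto simp: es_def sless_def\<close>)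
    qed
  qed
qed

end
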